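(* Let $t_1>0$ and consider the coupled control system $\dot y(t)=A_Yy(t)+A_{YZ}z(t)+b_Yu(t)$, $\dot z(t)=A_Zz(t)+b_Zu(t)$ on $X=Y\times Z$ with scalar control $u$, under the standing assumptions listed in the context, in the case $\sigma_Y\cap\sigma_Z\neq\varnothing$. Put $b_{1j}=(b,\psi_j)$ for $j\in I_Y\setminus I_{YZ}$, $b_{1j}=(b,\psi_{1j})$ and $b_{2j}=(b,\psi_{2j})$ for $j\in I_{YZ}$, and for $\tau\in[0,t_1]$ $$b_j(\tau)=\begin{cases}b_{1j}-e^{-\lambda_j(t_1-\tau)}\left(S_Z(t_1-\tau)b_Z,\psi_{Zj}\right),& j\in I_Y\setminus I_{YZ},\\[2pt] b_{1j}+b_{2j}c_j(t_1-\tau)-e^{-\lambda_j(t_1-\tau)}\left(S_Z(t_1-\tau)b_Z,\psi_{1Zj}\right),& j\in I_{YZ}.\end{cases}$$ Assume that the series $$\sum_{j\in I_Y}\left|e^{-\lambda_jt_1}\right|^{2}\left|\left(S_Z(t_1)x_Z^0,\psi_{Zj}\right)\right|^2\qquad(\text{where }\psi_{Zj}:=\psi_{1Zj}\text{ for }j\in I_{YZ})$$ converges for every $x_Z^0\in Z$. Then the system is partially null-controllable on $[0,t_1]$ if and only if the family $\{e^{-\lambda_jt}b_j(t),\ t\in[0,t_1]\}_{j\in I_Y}$ is strongly minimal in $L_2[0,t_1]$.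
   Context: Setting. $Y,Z$ are separable complex Hilbert spaces with inner products $(\cdot,\cdot)$ linear in the first argument, and $X=Y\times Z$. $A_Y$ and $A_Z$ generate strongly continuous semigroups $S_Y(t)$ on $Y$ and $S_Z(t)$ on $Z$; $A_{YZ}:Z\to Y$ is a bounded linear operator; $A=\begin{pmatrix}A_Y&A_{YZ}\\0&A_Z\end{pmatrix}$ (domain $D(A_Y)\times D(A_Z)$) generates the strongly continuous semigroup $S(t)$ on $X$; $b=(b_Y,b_Z)\in X$. The coupled system is $\dot x=Ax+bu$ with $x=(y,z)$, $x(0)=x^0=(x^0_Y,x^0_Z)$, and mild solution $x(t)=S(t)x^0+\int_0^tS(t-\tau)bu(\tau)\,d\tau$. Standing assumptions. $A$ has purely point spectrum $\sigma_A$, which is finite or has no finite limit points, each eigenvalue having finite multiplicity; the generalized eigenvectors of $A$ form a Riesz basis of $X$; the eigenvalues of $A_Y$ and of $A_Z$ are simple. $\sigma_Y,\sigma_Z$ are the spectra of $A_Y,A_Z$; $\sigma_A=\sigma_Y\cup\sigma_Z=\{\lambda_i\}$ is an enumeration of the distinct eigenvalues; $I_Y=\{i:\lambda_i\in\sigma_Y\}$, $I_Z=\{i:\lambda_i\in\sigma_Z\}$, $I_{YZ}=\{i:\lambda_i\in\sigma_Y\cap\sigma_Z\}$. (Generalized) eigenvectors. For $j\in I_Y\setminus I_{YZ}$: $\varphi_j=(\varphi_{Yj},0)$ with $A_Y\varphi_{Yj}=\lambda_j\varphi_{Yj}$, and $\psi_j=(\psi_{Yj},\psi_{Zj})$ with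 $A_Y^*\psi_{Yj}=\bar\lambda_j\psi_{Yj}$, $A_{YZ}^*\psi_{Yj}+A_Z^*\psi_{Zj}=\bar\lambda_j\psi_{Zj}$. For $k\in I_Z\setminus I_{YZ}$: $\varphi_k=(\varphi_{Yk},\varphi_{Zk})$ with $A_Z\varphi_{Zk}=\lambda_k\varphi_{Zk}$, $A_Y\varphi_{Yk}+A_{YZ}\varphi_{Zk}=\lambda_k\varphi_{Yk}$, and $\psi_k=(0,\psi_{Zk})$ with $A_Z^*\psi_{Zk}=\bar\lambda_k\psi_{Zk}$. For $m\in I_{YZ}$: $\phi_{1m}=(\phi_{1Ym},0)$ with $A_Y\phi_{1Ym}=\lambda_m\phi_{1Ym}$; $\phi_{2m}=(\phi_{2Ym},\phi_{2Zm})$ with $A_Z\phi_{2Zm}=\lambda_m\phi_{2Zm}$ and $A\phi_{2m}-\lambda_m\phi_{2m}=c_m\phi_{1m}$; $\psi_{2m}=(0,\psi_{2Zm})$ with $A_Z^*\psi_{2Zm}=\bar\lambda_m\psi_{2Zm}$; $\psi_{1m}=(\psi_{1Ym},\psi_{1Zm})$ with $A_Y^*\psi_{1Ym}=\bar\lambda_m\psi_{1Ym}$ and $A^*\psi_{1m}-\bar\lambda_m\psi_{1m}=\bar c_m\psi_{2m}$; here $c_m=(A_{YZ}\phi_{2Zm},\psi_{1Ym})$. These vectors are chosen so that the family of all $\varphi_j,\varphi_k,\phi_{1m},\phi_{2m}$ and the family of all $\psi_j,\psi_k,\psi_{1m},\psi_{2m}$ are Riesz bases of $X$ biorthogonal to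 each other ($\varphi_i\leftrightarrow\psi_i$, $\phi_{1m}\leftrightarrow\psi_{1m}$, $\phi_{2m}\leftrightarrow\psi_{2m}$). Partial null-controllability on $[0,t_1]$: for each $x^0\in X$ there is a scalar control $u\in L_2[0,t_1]$ such that the $Y$-component of $x(t_1)$ is zero, i.e. $Px(t_1)=0$ with $P(y,z)=(y,0)$. Strong minimality: a sequence $x_1,x_2,\dots$ in a Hilbert space is strongly minimal if, with $\lambda_1^n$ the smallest eigenvalue of the Gram matrix $((x_i,x_j))_{i,j=1}^n$, one has $\lim_{n\to\infty}\lambda_1^n>0$ (for a finite family: the smallest eigenvalue of its Gram matrix is positive). *)

theory Defs
  imports "HOL-Analysis.Analysis" "Jordan_Normal_Form.Char_Poly"
begin

section \<open>Separable complex Hilbert spaces\<close>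

text \<open>
  The complex inner product is linear in its first argument and its real part is the inner
  product of the underlying real inner product space, so norm, topology and measurability are
  those of the library.
\<close>

class complex_inner = real_inner +
  fixes scaleC :: "complex \<Rightarrow> 'a \<Rightarrow> 'a" (infixr "*\<^sub>C" 75)
    and cinner :: "'a \<Rightarrow> 'a \<Rightarrow> complex"
  assumes scaleC_add_right: "c *\<^sub>C (x + y) = c *\<^sub>C x + c *\<^sub>C y"
    and scaleC_add_left: "(c + d) *\<^sub>C x = c *\<^sub>C x + d *\<^sub>C x"
    and scaleC_scaleC: "c *\<^sub>C d *\<^sub>C x = (c * d) *\<^sub>C x"
    and scaleC_of_real: "complex_of_real r *\<^sub>C x = r *\<^sub>R x"
    and cinner_commute: "cinner x y = cnj (cinner y x)"
    and cinner_add_left: "cinner (x + y) z = cinner x z + cinner y z"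
    and cinner_scaleC_left: "cinner (c *\<^sub>C x) y = c * cinner x y"
    and Re_cinner: "Re (cinner x y) = inner x y"

class separable_complex_hilbert = complex_inner + banach + second_countable_topology

instantiation complex :: separable_complex_hilbert
begin

definition scaleC_complex :: "complex \<Rightarrow> complex \<Rightarrow> complex"
  where "scaleC_complex c x = c * x"

definition cinner_complex :: "complex \<Rightarrow> complex \<Rightarrow> complex"
  where "cinner_complex x y = x * cnj y"

instance
  by standard
    (auto simp: scaleC_complex_def cinner_complex_def algebra_simps scaleR_conv_of_real
      inner_complex_def)

end

instantiation prod :: (complex_inner, complex_inner) complex_inner
begin

definition scaleC_prod :: "complex \<Rightarrow> 'a \<times> 'b \<Rightarrow> 'a \<times> 'b"
  where "scaleC_prod c x = (c *\<^sub>C fst x, c *\<^sub>C snd x)"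

definition cinner_prod :: "'a \<times> 'b \<Rightarrow> 'a \<times> 'b \<Rightarrow> complex"
  where "cinner_prod x y = cinner (fst x) (fst y) + cinner (snd x) (snd y)"

instance
proof
  fix x y z :: "'a \<times> 'b" and c d :: complex and r :: real
  show "c *\<^sub>C (x + y) = c *\<^sub>C x + c *\<^sub>C y"
    by (simp add: scaleC_prod_def scaleC_add_right)
  show "(c + d) *\<^sub>C x = c *\<^sub>C x + d *\<^sub>C x"
    by (simp add: scaleC_prod_def scaleC_add_left)
  show "c *\<^sub>C d *\<^sub>C x = (c * d) *\<^sub>C x"
    by (simp add: scaleC_prod_def scaleC_scaleC)
  show "complex_of_real r *\<^sub>C x = r *\<^sub>R x"
    by (simp add: scaleC_prod_def scaleC_of_real scaleR_prod_def)
  show "cinner x y = cnj (cinner y x)"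
    by (simp add: cinner_prod_def cinner_commute[symmetric])
  show "cinner (x + y) z = cinner x z + cinner y z"
    by (simp add: cinner_prod_def cinner_add_left)
  show "cinner (c *\<^sub>C x) y = c * cinner x y"
    by (simp add: cinner_prod_def scaleC_prod_def cinner_scaleC_left distrib_left)
  show "Re (cinner x y) = inner x y"
    by (simp add: cinner_prod_def inner_prod_def Re_cinner)
qed

end

instance prod :: (separable_complex_hilbert, separable_complex_hilbert) separable_complex_hilbert ..

global_interpretation complex_vector: vector_space "scaleC :: complex \<Rightarrow> 'a \<Rightarrow> 'a :: complex_inner"
  defines cspan = complex_vector.span
    and cdim = complex_vector.dim
    and cdependent = complex_vector.dependent
    and crepresentation = complex_vector.representation
    and csubspace = complex_vector.subspace
    and cextend_basis = complex_vector.extend_basis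
proof unfold_locales
  show "1 *\<^sub>C x = x" for x :: 'a
    using scaleC_of_real[of 1 x] by simp
qed (simp_all add: scaleC_add_right scaleC_add_left scaleC_scaleC)

definition bounded_clinear :: "('a::complex_inner \<Rightarrow> 'b::complex_inner) \<Rightarrow> bool"
  where "bounded_clinear T \<longleftrightarrow> bounded_linear T \<and> (\<forall>c x. T (c *\<^sub>C x) = c *\<^sub>C T x)"

definition riesz_basis :: "'i set \<Rightarrow> ('i \<Rightarrow> 'a::complex_inner) \<Rightarrow> bool"
  where "riesz_basis J f \<longleftrightarrow>
    closure (cspan (f ` J)) = UNIV \<and>
    (\<exists>m>0. \<exists>M>0. \<forall>F a. finite F \<longrightarrow> F \<subseteq> J \<longrightarrow>
       m * (\<Sum>j\<in>F. (cmod (a j))\<^sup>2) \<le> (norm (\<Sum>j\<in>F. a j *\<^sub>C f j))\<^sup>2 \<and>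
       (norm (\<Sum>j\<in>F. a j *\<^sub>C f j))\<^sup>2 \<le> M * (\<Sum>j\<in>F. (cmod (a j))\<^sup>2))"

definition biorthogonal :: "'i set \<Rightarrow> ('i \<Rightarrow> 'a::complex_inner) \<Rightarrow> ('i \<Rightarrow> 'a) \<Rightarrow> bool"
  where "biorthogonal J f g \<longleftrightarrow>
    (\<forall>i\<in>J. \<forall>j\<in>J. cinner (f i) (g j) = (if i = j then 1 else 0))"


section \<open>Unbounded operators\<close>

text \<open>
  An unbounded operator is a domain \<open>D\<close> together with a function \<open>A\<close> whose values outside
  \<open>D\<close> are irrelevant.
\<close>

definition op_eigenvalue :: "'a::complex_inner set \<Rightarrow> ('a \<Rightarrow> 'a) \<Rightarrow> complex \<Rightarrow> bool"
  where "op_eigenvalue D A l \<longleftrightarrow> (\<exists>x\<in>D. x \<noteq> 0 \<and> A x = l *\<^sub>C x)"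

definition op_spectrum :: "'a::complex_inner set \<Rightarrow> ('a \<Rightarrow> 'a) \<Rightarrow> complex set"
  where "op_spectrum D A = - {l. \<exists>R. bounded_clinear R \<and>
    (\<forall>x. R x \<in> D \<and> A (R x) - l *\<^sub>C R x = x) \<and> (\<forall>x\<in>D. R (A x - l *\<^sub>C x) = x)}"

text \<open>\<open>ker_power D A l n\<close> is the kernel of the \<open>n\<close>-th power of \<open>A - l\<close> on its natural domain.\<close>

primrec ker_power :: "'a::complex_inner set \<Rightarrow> ('a \<Rightarrow> 'a) \<Rightarrow> complex \<Rightarrow> nat \<Rightarrow> 'a set"
  where
    "ker_power D A l 0 = {0}"
  | "ker_power D A l (Suc n) = {x \<in> D. A x - l *\<^sub>C x \<in> ker_power D A l n}"

definition gen_eigenspace :: "'a::complex_inner set \<Rightarrow> ('a \<Rightarrow> 'a) \<Rightarrow> complex \<Rightarrow> 'a set"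
  where "gen_eigenspace D A l = (\<Union>n. ker_power D A l n)"

definition finite_multiplicity :: "'a::complex_inner set \<Rightarrow> ('a \<Rightarrow> 'a) \<Rightarrow> complex \<Rightarrow> bool"
  where "finite_multiplicity D A l \<longleftrightarrow> (\<exists>B. finite B \<and> gen_eigenspace D A l \<subseteq> cspan B)"

definition simple_eigenvalue :: "'a::complex_inner set \<Rightarrow> ('a \<Rightarrow> 'a) \<Rightarrow> complex \<Rightarrow> bool"
  where "simple_eigenvalue D A l \<longleftrightarrow> op_eigenvalue D A l \<and> cdim (gen_eigenspace D A l) = 1"

definition adjoint_domain ::
    "'a::complex_inner set \<Rightarrow> ('a \<Rightarrow> 'b::complex_inner) \<Rightarrow> 'b set"
  where "adjoint_domain D A = {v. \<exists>w. \<forall>x\<in>D. cinner (A x) v = cinner x w}"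

text \<open>Only meaningful on \<open>adjoint_domain D A\<close> and for dense \<open>D\<close>.\<close>

definition op_adjoint ::
    "'a::complex_inner set \<Rightarrow> ('a \<Rightarrow> 'b::complex_inner) \<Rightarrow> 'b \<Rightarrow> 'a"
  where "op_adjoint D A v = (THE w. \<forall>x\<in>D. cinner (A x) v = cinner x w)"

definition block_op ::
    "('y \<Rightarrow> 'y) \<Rightarrow> ('z \<Rightarrow> 'y) \<Rightarrow> ('z \<Rightarrow> 'z) \<Rightarrow> 'y::plus \<times> 'z \<Rightarrow> 'y \<times> 'z"
  where "block_op A\<^sub>Y A\<^sub>Y\<^sub>Z A\<^sub>Z = (\<lambda>(y, z). (A\<^sub>Y y + A\<^sub>Y\<^sub>Z z, A\<^sub>Z z))"


section \<open>Strongly continuous semigroups\<close>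

definition C0_semigroup :: "(real \<Rightarrow> 'a::complex_inner \<Rightarrow> 'a) \<Rightarrow> bool"
  where "C0_semigroup S \<longleftrightarrow>
    (\<forall>t\<ge>0. bounded_clinear (S t)) \<and>
    (\<forall>x. S 0 x = x) \<and>
    (\<forall>s\<ge>0. \<forall>t\<ge>0. \<forall>x. S (s + t) x = S s (S t x)) \<and>
    (\<forall>x. ((\<lambda>t. S t x) \<longlongrightarrow> x) (at_right 0))"

definition generates ::
    "'a::complex_inner set \<Rightarrow> ('a \<Rightarrow> 'a) \<Rightarrow> (real \<Rightarrow> 'a \<Rightarrow> 'a) \<Rightarrow> bool"
  where "generates D A S \<longleftrightarrow> C0_semigroup S \<and>
    D = {x. \<exists>v. ((\<lambda>t. (S t x - x) /\<^sub>R t) \<longlongrightarrow> v) (at_right 0)} \<and>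
    (\<forall>x\<in>D. ((\<lambda>t. (S t x - x) /\<^sub>R t) \<longlongrightarrow> A x) (at_right 0))"


section \<open>Square integrable functions on an interval\<close>

text \<open>
  Functions rather than classes modulo null sets; every class has a Borel representative.
\<close>

definition L2 :: "real \<Rightarrow> (real \<Rightarrow> complex) set"
  where "L2 T = {u. set_borel_measurable lborel {0..T} u \<and>
    set_integrable lborel {0..T} (\<lambda>t. (cmod (u t))\<^sup>2)}"

definition L2_inner :: "real \<Rightarrow> (real \<Rightarrow> complex) \<Rightarrow> (real \<Rightarrow> complex) \<Rightarrow> complex"
  where "L2_inner T f g = (LINT t:{0..T}|lborel. f t * cnj (g t))"


section \<open>Strong minimality\<close>

definition gram_matrix :: "('a \<Rightarrow> 'a \<Rightarrow> complex) \<Rightarrow> (nat \<Rightarrow> 'a) \<Rightarrow> nat \<Rightarrow> complex mat"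
  where "gram_matrix ip x n = mat n n (\<lambda>(i, j). ip (x i) (x j))"

text \<open>Used for Hermitian matrices, all of whose eigenvalues are real.\<close>

definition smallest_eigenvalue :: "complex mat \<Rightarrow> real"
  where "smallest_eigenvalue G = Min {r. eigenvalue G (complex_of_real r)}"

text \<open>A family indexed by a set of naturals is listed in increasing order of its indices.\<close>

definition strongly_minimal :: "('a \<Rightarrow> 'a \<Rightarrow> complex) \<Rightarrow> nat set \<Rightarrow> (nat \<Rightarrow> 'a) \<Rightarrow> bool"
  where "strongly_minimal ip J f \<longleftrightarrow>
    (let g = (\<lambda>n. smallest_eigenvalue (gram_matrix ip (\<lambda>i. f (enumerate J i)) n))
     in if finite J then g (card J) > 0 else (\<exists>L>0. g \<longlonglongrightarrow> L))"

definition strongly_minimal_L2 :: "real \<Rightarrow> nat set \<Rightarrow> (nat \<Rightarrow> real \<Rightarrow> complex) \<Rightarrow> bool"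
  where "strongly_minimal_L2 T J f \<longleftrightarrow>
    (\<forall>j\<in>J. f j \<in> L2 T) \<and> strongly_minimal (L2_inner T) J f"


section \<open>Partial null-controllability\<close>

definition mild_solution ::
    "(real \<Rightarrow> 'a \<Rightarrow> 'a) \<Rightarrow> 'a::separable_complex_hilbert \<Rightarrow> 'a \<Rightarrow> (real \<Rightarrow> complex) \<Rightarrow> real \<Rightarrow> 'a"
  where "mild_solution S b x0 u t =
    S t x0 + (LINT s:{0..t}|lborel. S (t - s) (u s *\<^sub>C b))"

definition proj_Y :: "'y \<times> 'z::zero \<Rightarrow> 'y \<times> 'z"
  where "proj_Y x = (fst x, 0)"

definition partially_null_controllable ::
    "(real \<Rightarrow> 'y \<times> 'z \<Rightarrow> 'y \<times> 'z) \<Rightarrow>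
      'y::separable_complex_hilbert \<times> 'z::separable_complex_hilbert \<Rightarrow> real \<Rightarrow> bool"
  where "partially_null_controllable S b T \<longleftrightarrow>
    (\<forall>x0. \<exists>u\<in>L2 T. proj_Y (mild_solution S b x0 u T) = 0)"


section \<open>The full family of generalized eigenvectors\<close>

text \<open>
  \<open>f\<close> lists the vectors belonging to eigenvalues of exactly one of the two diagonal blocks;
  \<open>f1\<close>, \<open>f2\<close> list the two vectors attached to a common eigenvalue (indices in \<open>K\<close>).
  The full family is indexed by the disjoint sum of the two index sets: the vectors
  \<open>f j\<close>, \<open>f1 j\<close> of the first block carry the tag \<open>Inl\<close>, the vectors \<open>f k\<close>, \<open>f2 k\<close> of the
  second block the tag \<open>Inr\<close>.
\<close>

definition joint_family ::
    "nat set \<Rightarrow> (nat \<Rightarrow> 'a) \<Rightarrow> (nat \<Rightarrow> 'a) \<Rightarrow> (nat \<Rightarrow> 'a) \<Rightarrow> nat + nat \<Rightarrow> 'a"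
  where "joint_family K f f1 f2 =
    case_sum (\<lambda>j. if j \<in> K then f1 j else f j) (\<lambda>k. if k \<in> K then f2 k else f k)"

end

theory Submission
  imports Defs
begin

text \<open>
  Pairing the \<open>Y\<close>-component of the mild solution with the first components of the adjoint
  (generalized) eigenvectors \<open>\<psi>\<^sub>j\<close>, \<open>j \<in> I\<^sub>Y\<close>, which are complete in \<open>Y\<close>, turns
  \<open>P x(t\<^sub>1) = 0\<close> into the moment problem \<open>\<integral> f\<^sub>j u = - a\<^sub>j(x\<^sup>0)\<close> for
  \<open>f\<^sub>j(t) = exp (- \<lambda>\<^sub>j t) b\<^sub>j(t)\<close>. The Bessel inequality, the boundedness of the \<open>c\<^sub>j\<close> and the
  convergence of the given series put \<open>a(x\<^sup>0)\<close> in \<open>\<ell>\<^sub>2\<close>. By the Rayleigh principle strong minimality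
  means \<open>L (\<Sum> |c\<^sub>j|\<^sup>2) \<le> \<parallel>\<Sum> c\<^sub>j f\<^sub>j\<parallel>\<^sup>2\<close> for some \<open>L > 0\<close> and all finite sums. Such a bound makes
  every \<open>\<ell>\<^sub>2\<close> moment problem solvable; conversely, solvability for the initial states \<open>(y, 0)\<close>
  yields it by the uniform boundedness principle.
\<close>

section \<open>Complex inner product spaces\<close>

text \<open>For j in \<open>I\<^sub>Y\<close> the vector \<psi>_j has a second component as well, so
  pairing a state with its first component alone means removing a contribution of the second
  component of the state. That is the origin of the subtracted term in \<open>bf\<close>. Writing it
  with \<open>S\<^sub>Z\<close> needs \<open>snd (S t x) = S\<^sub>Z t (snd x)\<close>, which is
  derived from uniqueness of solutions of the second equation. At a common eigenvalue the dual
  vectors form a Jordan chain, whence the summand linear in t.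

  Members of \<open>L2\<close> are functions rather than classes and \<open>L2_sq\<close> is only
  the square of a seminorm, so completeness and minimization are phrased for sequences of functions.
  One minimization lemma serves both the moment problem and Riesz representation, which in turn
  provides the adjoint of the coupling operator.

  The states \<open>(y, 0)\<close> are enough for the converse: their moments are plain pairings of
  y with the first components of the \<psi>_j. These are biorthogonal to the first components of the
  \<phi>_j, since the latter vectors have second component 0.\<close>

lemma norm_scaleC: "norm (c *\<^sub>C x) = cmod c * norm (x::'a::complex_inner)"
proof -
  have "(norm (c *\<^sub>C x))\<^sup>2 = Re (cinner (c *\<^sub>C x) (c *\<^sub>C x))"
    by (simp add: Re_cinner power2_norm_eq_inner)
  also have "cinner (c *\<^sub>C x) (c *\<^sub>C x) = (c * cnj c) * cnj (cinner x x)"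
    by (metis cinner_commute cinner_scaleC_left complex_cnj_mult mult.assoc)
  also have "c * cnj c = of_real ((cmod c)\<^sup>2)"
    by (metis complex_norm_square of_real_power)
  finally have "(norm (c *\<^sub>C x))\<^sup>2 = (cmod c * norm x)\<^sup>2"
    by (simp add: power_mult_distrib Re_cinner power2_norm_eq_inner del: of_real_power)
  then show ?thesis
    by (rule power2_eq_imp_eq) auto
qed

lemma cinner_add_right: "cinner x (y + z) = cinner x y + cinner (x::'a::complex_inner) z"
  by (metis cinner_add_left cinner_commute complex_cnj_add)

lemma cinner_scaleC_right: "cinner x (c *\<^sub>C y) = cnj c * cinner (x::'a::complex_inner) y"
  by (metis cinner_commute cinner_scaleC_left complex_cnj_mult)

lemma cinner_self: "cinner x x = of_real ((norm (x::'a::complex_inner))\<^sup>2)"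
  by (rule complex_eqI)
    (metis Re_cinner Re_complex_of_real power2_norm_eq_inner,
     metis Im_complex_of_real cinner_commute complex.sel(2) complex_cnj complex_surj equal_neg_zero)

lemma cmod_cinner_le: "cmod (cinner x y) \<le> norm x * norm (y::'a::complex_inner)"
proof -
  \<comment> \<open>\<open>w\<close> is the unimodular phase that rotates \<open>cinner x y\<close>
    onto the nonnegative real axis, so the real Cauchy--Schwarz inequality suffices; it is set to 1
    where \<open>sgn\<close> would vanish.\<close>
  define w where "w = (if cinner x y = 0 then 1 else cnj (sgn (cinner x y)))"
  have w: "cmod w = 1" "w * cinner x y = of_real (cmod (cinner x y))"
    by (auto simp: w_def sgn_eq norm_divide power2_eq_square mult.commute[of "cnj _"]
        simp flip: complex_norm_square)
  have "cmod (cinner x y) = Re (cinner (w *\<^sub>C x) y)"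
    by (simp add: cinner_scaleC_left w)
  also have "\<dots> \<le> norm (w *\<^sub>C x) * norm y"
    by (simp add: Re_cinner norm_cauchy_schwarz)
  finally show ?thesis by (simp add: norm_scaleC w)
qed

lemma bounded_bilinear_cinner:
  "bounded_bilinear (cinner :: 'a::complex_inner \<Rightarrow> 'a \<Rightarrow> complex)"
proof
  fix a a' b b' :: 'a and r :: real
  show "cinner (a + a') b = cinner a b + cinner a' b" "cinner a (b + b') = cinner a b + cinner a b'"
    by (simp_all add: cinner_add_left cinner_add_right)
  show "cinner (r *\<^sub>R a) b = r *\<^sub>R cinner a b"
    by (metis cinner_scaleC_left scaleC_of_real scaleR_conv_of_real)
  show "cinner a (r *\<^sub>R b) = r *\<^sub>R cinner a b"
    by (metis cinner_scaleC_right complex_cnj_complex_of_real scaleC_of_real scaleR_conv_of_real)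
  show "\<exists>K. \<forall>a b::'a. cmod (cinner a b) \<le> norm a * norm b * K"
    using cmod_cinner_le by (intro exI[of _ 1]) auto
qed

lemma bounded_bilinear_scaleC:
  "bounded_bilinear (scaleC :: complex \<Rightarrow> 'a \<Rightarrow> 'a::complex_inner)"
proof
  fix a a' :: complex and b b' :: 'a and r :: real
  show "(a + a') *\<^sub>C b = a *\<^sub>C b + a' *\<^sub>C b" "a *\<^sub>C (b + b') = a *\<^sub>C b + a *\<^sub>C b'"
    by (simp_all add: scaleC_add_left scaleC_add_right)
  show "(r *\<^sub>R a) *\<^sub>C b = r *\<^sub>R a *\<^sub>C b"
    by (metis scaleC_of_real scaleC_scaleC scaleR_conv_of_real)
  show "a *\<^sub>C r *\<^sub>R b = r *\<^sub>R a *\<^sub>C b"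
    by (metis mult.commute scaleC_of_real scaleC_scaleC)
  show "\<exists>K. \<forall>a (b::'a). norm (a *\<^sub>C b) \<le> norm a * norm b * K"
    using norm_scaleC by (intro exI[of _ 1]) (auto simp: norm_scaleC)
qed

lemmas bounded_linear_cinner_left = bounded_bilinear.bounded_linear_left[OF bounded_bilinear_cinner]
lemmas bounded_linear_scaleC_right = bounded_bilinear.bounded_linear_right[OF bounded_bilinear_scaleC]
lemmas cinner_simps = bounded_bilinear.diff_left[OF bounded_bilinear_cinner]
  bounded_bilinear.diff_right[OF bounded_bilinear_cinner]
  bounded_bilinear.zero_left[OF bounded_bilinear_cinner]
  bounded_bilinear.zero_right[OF bounded_bilinear_cinner]
  bounded_bilinear.sum_left[OF bounded_bilinear_cinner]
  bounded_bilinear.sum_right[OF bounded_bilinear_cinner]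
  cinner_add_left cinner_add_right cinner_scaleC_left cinner_scaleC_right
lemmas continuous_on_cinner = bounded_bilinear.continuous_on[OF bounded_bilinear_cinner]
lemmas continuous_on_scaleC = bounded_bilinear.continuous_on[OF bounded_bilinear_scaleC]

lemma scaleC_zero_right [simp]: "c *\<^sub>C (0::'a::complex_inner) = 0"
  by (rule bounded_bilinear.zero_right[OF bounded_bilinear_scaleC])

text \<open>Baire category: by pointwise boundedness the closed sets \<open>E n\<close> cover the
  space, so one of them contains a ball, and linearity moves the bound to a ball around 0. It is
  applied to semigroups near time 0 and to the functionals of the moment problem.\<close>

theorem uniform_boundedness:
  fixes T :: "'i \<Rightarrow> 'a::banach \<Rightarrow> 'b::real_normed_vector"
  assumes lin: "\<And>i. i \<in> I \<Longrightarrow> bounded_linear (T i)"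
    and bdd: "\<And>x. \<exists>B. \<forall>i\<in>I. norm (T i x) \<le> B"
  shows "\<exists>B. \<forall>i\<in>I. \<forall>x. norm (T i x) \<le> B * norm x"
proof -
  define E where "E n = {x. \<forall>i\<in>I. norm (T i x) \<le> real n}" for n :: nat
  have cl: "closed (E n)" for n
  proof -
    have "E n = (\<Inter>i\<in>I. {x. norm (T i x) \<le> real n})" by (auto simp: E_def)
    moreover have "closed {x. norm (T i x) \<le> real n}" if "i \<in> I" for i
      by (intro closed_Collect_le continuous_intros linear_continuous_on lin that)
    ultimately show ?thesis by auto
  qed
  have "(\<Union>n. E n) = UNIV"
    using bdd real_arch_simple unfolding E_def by (auto; meson order_trans)
  then have "(euclidean :: 'a topology) interior_of \<Union>(range E) \<noteq> {}"
    by (simp add: interior_of_topspace)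
  then obtain n where n: "interior (E n) \<noteq> {}"
    using Baire_category_alt[of "euclidean :: 'a topology" "range E"] cl
      completely_metrizable_space_euclidean by auto
  then obtain x0 where "x0 \<in> interior (E n)" by blast
  then obtain e where e: "e > 0" "cball x0 e \<subseteq> E n"
    by (meson mem_interior_cball)
  show ?thesis
  proof (intro exI ballI allI)
    fix i x assume i: "i \<in> I"
    interpret bounded_linear "T i" using lin i .
    show "norm (T i x) \<le> 2 * real n / e * norm x"
    proof (cases "x = 0")
      case False
      \<comment> \<open>\<open>y\<close> is \<open>x\<close> rescaled to length \<open>e\<close>.
        Its image is a difference of values at two points of the ball, which is the origin of the
        factor 2.\<close>
      define y where "y = (e / norm x) *\<^sub>R x"
      have "x0 + y \<in> cball x0 e" "x0 \<in> cball x0 e"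
        using e False by (auto simp: y_def dist_norm)
      then have "norm (T i (x0 + y)) \<le> n" "norm (T i x0) \<le> n"
        using e i unfolding E_def by blast+
      then have "norm (T i y) \<le> 2 * n"
        using norm_triangle_ineq4[of "T i (x0 + y)" "T i x0"] by (simp add: add)
      moreover have "norm (T i y) = e / norm x * norm (T i x)"
        using e by (simp add: y_def scaleR)
      ultimately show ?thesis using e False by (simp add: field_simps)
    qed (simp add: zero)
  qed
qed

text \<open>Common core of Riesz representation and of the moment problem. \<open>N x y\<close>
  plays the part of the squared distance, and \<open>mid\<close> is the parallelogram law with
  \<open>m\<close> as midpoint. With the rate \<open>(1/4)^n\<close> consecutive distances decay
  like \<open>(1/2)^n\<close>, so they are summable.\<close>

lemma minimizing_sequence:
  fixes \<Phi> :: "'v \<Rightarrow> real" and N :: "'v \<Rightarrow> 'v \<Rightarrow> real"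
  assumes "V \<noteq> {}" and low: "\<And>x. x \<in> V \<Longrightarrow> d \<le> \<Phi> x"
    and mid: "\<And>x y. x \<in> V \<Longrightarrow> y \<in> V \<Longrightarrow> \<exists>m\<in>V. N x y = 2 * \<Phi> x + 2 * \<Phi> y - 4 * \<Phi> m"
  obtains p where "\<And>n::nat. p n \<in> V" and "\<And>n y. y \<in> V \<Longrightarrow> \<Phi> (p n) \<le> \<Phi> y + (1/4)^n"
    and "\<And>m n. N (p m) (p n) \<le> 2 * (1/4)^m + 2 * (1/4)^n"
proof -
  have bb: "bdd_below (\<Phi> ` V)" using low by (auto intro!: bdd_belowI[of _ d])
  define I where "I = Inf (\<Phi> ` V)"
  have "\<exists>x\<in>V. \<Phi> x < I + (1/4)^n" for n
    using cInf_lessD[of "\<Phi> ` V" "I + (1/4)^n"] \<open>V \<noteq> {}\<close> by (auto simp: I_def)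
  then obtain p where p: "\<And>n. p n \<in> V" "\<And>n. \<Phi> (p n) < I + (1/4)^n" by metis
  have I: "I \<le> \<Phi> y" if "y \<in> V" for y
    using cInf_lower[OF _ bb] that by (auto simp: I_def)
  show thesis
  proof (rule that[of p])
    show "\<Phi> (p n) \<le> \<Phi> y + (1/4)^n" if "y \<in> V" for n y
      using p(2)[of n] I[OF that] by linarith
    \<comment> \<open>Both values exceed \<open>I\<close> by less than the stated powers and the
      midpoint value is at least \<open>I\<close>; since 2 + 2 = 4, the infimum cancels.\<close>
    show "N (p m) (p n) \<le> 2 * (1/4)^m + 2 * (1/4)^n" for m n
      using mid[OF p(1)[of m] p(1)[of n]] p(2)[of m] p(2)[of n] I by fastforce
  qed (rule p)
qed

text \<open>The discriminant condition, read off at the vertex of the parabola. With a small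
  \<open>\<epsilon>\<close> it says that a near-minimizer is nearly stationary, with
  \<open>\<epsilon> = 0\<close> it gives exact stationarity, and with a squared norm as
  \<open>\<epsilon>\<close> it is Cauchy--Schwarz.\<close>

lemma quadratic_nonneg_bound:
  fixes \<alpha> \<beta> \<epsilon> :: real
  assumes "\<And>t. 0 \<le> \<epsilon> + 2 * t * \<alpha> + t\<^sup>2 * \<beta>" and "\<beta> \<ge> 0"
  shows "\<alpha>\<^sup>2 \<le> \<epsilon> * \<beta>"
proof (cases "\<beta> = 0")
  case True
  have "\<alpha> = 0"
  proof (rule ccontr)
    assume "\<alpha> \<noteq> 0"
    \<comment> \<open>At this \<open>t\<close> the affine function takes the value -1.\<close>
    then show False using assms(1)[of "-(\<epsilon> + 1) / (2 * \<alpha>)"] True by (simp add: field_simps)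
  qed
  then show ?thesis using True by simp
next
  case False
  then show ?thesis
    using assms(1)[of "- \<alpha> / \<beta>"] assms(2)
    by (simp add: field_simps power2_eq_square split: if_splits)
qed

text \<open>The minimizer of \<open>\<parallel>x\<parallel>\<^sup>2 - 2 Re (F x)\<close> represents \<open>F\<close>.\<close>

theorem Riesz_representation:
  fixes F :: "'a::separable_complex_hilbert \<Rightarrow> complex"
  assumes F: "bounded_clinear F"
  shows "\<exists>w. \<forall>x. F x = cinner x w"
proof -
  interpret F: bounded_linear F using F by (simp add: bounded_clinear_def)
  have FC: "F (c *\<^sub>C x) = c * F x" for c x
    using F by (simp add: bounded_clinear_def scaleC_complex_def)
  define f where "f x = Re (F x)" for x
  interpret f: bounded_linear f
    unfolding f_def by (intro bounded_linear_compose[OF bounded_linear_Re] F.bounded_linear_axioms)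
  obtain K where K: "\<And>x. norm (f x) \<le> norm x * K" using f.bounded by blast
  define \<Phi> where "\<Phi> x = x \<bullet> x - 2 * f x" for x
  have exp: "\<Phi> (x + t *\<^sub>R y) = \<Phi> x + 2 * t * (x \<bullet> y - f y) + t\<^sup>2 * (y \<bullet> y)" for x y t
    by (simp add: \<Phi>_def f.add f.scaleR inner_simps inner_commute algebra_simps power2_eq_square)
  obtain p where p: "\<And>n y. \<Phi> (p n) \<le> \<Phi> y + (1/4)^n"
    "\<And>m n. (norm (p m - p n))\<^sup>2 \<le> 2 * (1/4)^m + 2 * (1/4)^n"
  proof (rule minimizing_sequence[of UNIV "- K\<^sup>2" \<Phi> "\<lambda>x y. (norm (x - y))\<^sup>2"])
    show "- K\<^sup>2 \<le> \<Phi> x" for x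
    proof -
      have "0 \<le> (norm x - K)\<^sup>2" by simp
      also have "\<dots> = x \<bullet> x - 2 * (norm x * K) + K\<^sup>2"
        by (simp add: power2_diff power2_norm_eq_inner)
      also have "\<dots> \<le> x \<bullet> x - 2 * f x + K\<^sup>2" using K[of x] by auto
      finally show ?thesis by (simp add: \<Phi>_def)
    qed
    show "\<exists>m\<in>UNIV. (norm (x - y))\<^sup>2 = 2 * \<Phi> x + 2 * \<Phi> y - 4 * \<Phi> m" for x y
      by (rule bexI[of _ "(1/2) *\<^sub>R (x + y)"])
        (simp_all add: \<Phi>_def f.add f.scaleR power2_norm_eq_inner inner_simps inner_commute
          algebra_simps)
  qed auto
  have "Cauchy p"
  proof (rule metric_CauchyI)
    fix e :: real assume e: "e > 0"
    then have "eventually (\<lambda>n. (1/4::real)^n < e\<^sup>2/4) sequentially"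
      by (intro order_tendstoD[OF LIMSEQ_realpow_zero]) auto
    then obtain M where M: "\<And>n. n \<ge> M \<Longrightarrow> (1/4::real)^n < e\<^sup>2/4"
      by (auto simp: eventually_sequentially)
    show "\<exists>M. \<forall>m\<ge>M. \<forall>n\<ge>M. dist (p m) (p n) < e"
    proof (intro exI allI impI)
      fix m n assume "M \<le> m" "M \<le> n"
      then have "(norm (p m - p n))\<^sup>2 < e\<^sup>2" using M[of m] M[of n] p(2)[of m n] by auto
      then show "dist (p m) (p n) < e" using e by (auto simp: dist_norm intro: power2_less_imp_less)
    qed
  qed
  then obtain w where w: "p \<longlonglongrightarrow> w" using Cauchy_convergent_iff convergent_def by blast
  have fw: "f y = y \<bullet> w" for y
  proof -
    \<comment> \<open>Comparing \<open>p n\<close> with its translates along \<open>y\<close> bounds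
      the defect in the representing equation at \<open>p n\<close> by the minimization error, which
      tends to 0.\<close>
    have "(p n \<bullet> y - f y)\<^sup>2 \<le> (1/4)^n * (y \<bullet> y)" for n
    proof (rule quadratic_nonneg_bound)
      show "0 \<le> (1/4)^n + 2 * t * (p n \<bullet> y - f y) + t\<^sup>2 * (y \<bullet> y)" for t
        using p(1)[of n "p n + t *\<^sub>R y"] by (simp add: exp)
    qed simp
    moreover have "(\<lambda>n. (p n \<bullet> y - f y)\<^sup>2) \<longlonglongrightarrow> (w \<bullet> y - f y)\<^sup>2"
      by (intro tendsto_intros w)
    moreover have "(\<lambda>n. (1/4)^n * (y \<bullet> y)) \<longlonglongrightarrow> 0"
      by (intro tendsto_mult_left_zero LIMSEQ_realpow_zero) auto
    ultimately have "(w \<bullet> y - f y)\<^sup>2 \<le> 0" by (intro LIMSEQ_le) auto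
    then show ?thesis by (simp add: inner_commute)
  qed
  have "F y = cinner y w" for y
  proof (rule complex_eqI)
    show "Re (F y) = Re (cinner y w)" using fw[of y] by (simp add: f_def Re_cinner)
    \<comment> \<open>By complex linearity the real identity at \<open>\<i> *\<^sub>C y\<close> is,
      up to sign, the identity of imaginary parts at \<open>y\<close>.\<close>
    have "Re (F (\<i> *\<^sub>C y)) = Re (cinner (\<i> *\<^sub>C y) w)" using fw[of "\<i> *\<^sub>C y"] by (simp add: f_def Re_cinner)
    then show "Im (F y) = Im (cinner y w)" by (simp add: FC cinner_scaleC_left)
  qed
  then show ?thesis by blast
qed

section \<open>Strongly continuous semigroups\<close>

text \<open>Generators are defined through difference quotients, while the chain rule and the
  vanishing-derivative theorem speak of vector derivatives; this translates between the two.\<close>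

lemma has_vector_derivative_iff_quotient:
  "(f has_vector_derivative D) (at x within S) \<longleftrightarrow>
    ((\<lambda>y. (f y - f x) /\<^sub>R (y - x)) \<longlongrightarrow> D) (at x within S)"
proof -
  have *: "norm ((1 / norm (y - x)) *\<^sub>R (f y - (f x + (y - x) *\<^sub>R D)))
      = norm ((f y - f x) /\<^sub>R (y - x) - D)" if "y \<noteq> x" for y
  proof -
    have "(f y - f x) /\<^sub>R (y - x) - D = (f y - (f x + (y - x) *\<^sub>R D)) /\<^sub>R (y - x)"
      using that by (simp add: diff_diff_eq[symmetric] scaleR_diff_right[of _ "f y - f x"])
    then show ?thesis by (simp add: divide_inverse)
  qed
  have "(f has_vector_derivative D) (at x within S) \<longleftrightarrow>
      ((\<lambda>y. norm ((1 / norm (y - x)) *\<^sub>R (f y - (f x + (y - x) *\<^sub>R D)))) \<longlongrightarrow> 0) (at x within S)"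
    by (simp add: has_vector_derivative_def has_derivative_within bounded_linear_scaleR_left
        tendsto_norm_zero_iff del: norm_scaleR)
  also have "\<dots> \<longleftrightarrow> ((\<lambda>y. norm ((f y - f x) /\<^sub>R (y - x) - D)) \<longlongrightarrow> 0) (at x within S)"
    unfolding eventually_at_filter
    by (intro tendsto_cong) (simp only: eventually_at_filter, intro always_eventually allI impI, rule *)
  also have "\<dots> \<longleftrightarrow> ((\<lambda>y. (f y - f x) /\<^sub>R (y - x)) \<longlongrightarrow> D) (at x within S)"
    by (simp only: tendsto_norm_zero_iff Lim_null[symmetric])
  finally show ?thesis .
qed

locale strongly_continuous =
  fixes S :: "real \<Rightarrow> 'a::separable_complex_hilbert \<Rightarrow> 'a"
  assumes C0: "C0_semigroup S"
begin

lemma bounded_linear_S: "t \<ge> 0 \<Longrightarrow> bounded_linear (S t)"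
  and S_scaleC: "t \<ge> 0 \<Longrightarrow> S t (c *\<^sub>C x) = c *\<^sub>C S t x"
  and S_0 [simp]: "S 0 x = x"
  and S_add: "s \<ge> 0 \<Longrightarrow> t \<ge> 0 \<Longrightarrow> S (s + t) x = S s (S t x)"
  and S_at_right_0: "((\<lambda>t. S t x) \<longlongrightarrow> x) (at_right 0)"
  using C0 by (auto simp: C0_semigroup_def bounded_clinear_def)

lemma S_diff: "t \<ge> 0 \<Longrightarrow> S t (x - y) = S t x - S t y"
  using bounded_linear_S by (simp add: bounded_linear.linear linear_diff)

lemma near_0:
  assumes "e > 0"
  shows "\<exists>d>0. \<forall>t\<in>{0..<d}. norm (S t x - x) < e"
proof -
  from tendstoD[OF S_at_right_0[of x] assms] obtain d where
    "d > 0" "\<And>t. 0 < t \<Longrightarrow> t < d \<Longrightarrow> dist (S t x) x < e"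
    by (auto simp: eventually_at_right_field)
  moreover have "dist (S 0 x) x < e" using assms by simp
  ultimately show ?thesis
    by (intro exI[of _ d]) (auto simp: dist_norm le_less)
qed

text \<open>Otherwise some \<open>t\<^sub>n \<rightarrow> 0\<close> makes \<open>S t\<^sub>n\<close> unbounded although \<open>S t\<^sub>n x \<rightarrow> x\<close> for every \<open>x\<close>.\<close>

lemma bounded_near_0: "\<exists>d>0. \<exists>M. \<forall>t\<in>{0..d}. \<forall>x. norm (S t x) \<le> M * norm x"
proof (rule ccontr)
  assume "\<not> ?thesis"
  then have "\<exists>t\<in>{0..1 / real (Suc n)}. \<exists>x. norm (S t x) > real n * norm x" for n
    by (meson not_le of_nat_0_less_iff zero_less_Suc zero_less_divide_1_iff)
  then obtain t x where t: "\<And>n. t n \<in> {0..1 / real (Suc n)}"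
    and x: "\<And>n. norm (S (t n) (x n)) > real n * norm (x n)" by metis
  have lim: "(\<lambda>n. S (t n) y) \<longlonglongrightarrow> y" for y
  proof (rule LIMSEQ_I)
    fix e :: real assume "e > 0"
    then obtain d where d: "d > 0" "\<forall>t\<in>{0..<d}. norm (S t y - y) < e" using near_0 by blast
    have "eventually (\<lambda>n. 1 / real (Suc n) < d) sequentially"
      using order_tendstoD(2)[OF LIMSEQ_inverse_real_of_nat d(1)] by (simp add: inverse_eq_divide)
    then have "eventually (\<lambda>n. norm (S (t n) y - y) < e) sequentially"
    proof eventually_elim
      case (elim n)
      then show ?case using t[of n] d(2) by auto
    qed
    then show "\<exists>no. \<forall>n\<ge>no. norm (S (t n) y - y) < e" by (simp add: eventually_sequentially)
  qed
  have "\<exists>B. \<forall>n\<in>UNIV. \<forall>x. norm (S (t n) x) \<le> B * norm x"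
  proof (rule uniform_boundedness)
    show "bounded_linear (S (t n))" for n using t[of n] by (intro bounded_linear_S) auto
    show "\<exists>B. \<forall>n\<in>UNIV. norm (S (t n) y) \<le> B" for y
      using convergent_imp_Bseq[OF convergentI[OF lim[of y]]] by (auto simp: Bseq_def)
  qed
  then obtain B where B: "\<And>n x. norm (S (t n) x) \<le> B * norm x" by blast
  obtain n where n: "real n \<ge> B" using real_arch_simple by blast
  have "B * norm (x n) \<le> real n * norm (x n)" using n by (intro mult_right_mono) auto
  then show False using x[of n] B[of n "x n"] by linarith
qed

text \<open>The semigroup law propagates the bound near 0: each further step of length
  \<open>d\<close> costs one more factor of the constant.\<close>

lemma bounded_on_interval: "\<exists>M>0. \<forall>t\<in>{0..T}. \<forall>x. norm (S t x) \<le> M * norm x"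
proof -
  obtain d M where d: "d > 0" and M: "\<And>t x. t \<in> {0..d} \<Longrightarrow> norm (S t x) \<le> M * norm x"
    using bounded_near_0 by blast
  \<comment> \<open>A constant of at least 1 has increasing powers, so the bound for many steps also
    covers short times.\<close>
  define M' where "M' = max M 1"
  have M': "norm (S t x) \<le> M' * norm x" if "t \<in> {0..d}" for t x
    using M[OF that, of x] mult_right_mono[of M M' "norm x"] by (auto simp: M'_def)
  have M1: "M' \<ge> 1" by (simp add: M'_def)
  have *: "norm (S t x) \<le> M' ^ Suc n * norm x" if "t \<in> {0..real (Suc n) * d}" for n t x
    using that
  proof (induction n arbitrary: t x)
    case (Suc n)
    show ?case
    proof (cases "t \<le> d")
      case True
      have "norm (S t x) \<le> M' ^ 1 * norm x" using M'[of t x] True Suc by auto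
      also have "\<dots> \<le> M' ^ Suc (Suc n) * norm x"
        using M1 by (intro mult_right_mono power_increasing) auto
      finally show ?thesis .
    next
      case False
      have "S t x = S d (S (t - d) x)" using S_add[of d "t - d" x] d False by simp
      also have "norm \<dots> \<le> M' * norm (S (t - d) x)" using d by (intro M') auto
      also have "\<dots> \<le> M' * (M' ^ Suc n * norm x)"
        using Suc.prems False M1 by (intro mult_left_mono Suc.IH) (auto simp: algebra_simps)
      finally show ?thesis by (simp add: algebra_simps)
    qed
  qed (use M' in auto)
  obtain n where n: "T / d \<le> real n" using real_arch_simple by blast
  have "T \<le> real (Suc n) * d" using n d by (simp add: field_simps)
  then have "\<forall>t\<in>{0..T}. \<forall>x. norm (S t x) \<le> M' ^ Suc n * norm x" using * by auto
  then show ?thesis using M1 by (intro exI[of _ "M' ^ Suc n"]) auto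
qed

lemma continuous_on_S: "continuous_on {0..} (\<lambda>t. S t x)"
  unfolding continuous_on_iff
proof (intro ballI allI impI)
  fix s e :: real assume s: "s \<in> {0..}" and e: "e > 0"
  obtain M where M: "M > 0" "\<And>t x. t \<in> {0..s + 1} \<Longrightarrow> norm (S t x) \<le> M * norm x"
    using bounded_on_interval by blast
  obtain d where d: "d > 0" "\<And>t. t \<in> {0..<d} \<Longrightarrow> norm (S t x - x) < e / M"
    using near_0[of "e / M" x] e M by auto
  \<comment> \<open>\<open>a\<close> is always the earlier time. Factoring out \<open>S a\<close>
    reduces continuity from the left as well as from the right to continuity at 0.\<close>
  have *: "norm (S b x - S a x) < e" if "0 \<le> a" "a \<le> b" "a \<le> s + 1" "b - a < d" for a b
  proof -
    have "S b x - S a x = S a (S (b - a) x - x)"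
      using that S_add[of a "b - a" x] by (simp add: S_diff)
    also have "norm \<dots> \<le> M * norm (S (b - a) x - x)" using that by (intro M) auto
    also have "\<dots> < M * (e / M)" using d(2)[of "b - a"] that M by (intro mult_strict_left_mono) auto
    finally show ?thesis using M by simp
  qed
  show "\<exists>d>0. \<forall>t\<in>{0..}. dist t s < d \<longrightarrow> dist (S t x) (S s x) < e"
  proof (intro exI[of _ "min d 1"] conjI ballI impI)
    fix t assume "t \<in> {0..}" "dist t s < min d 1"
    then show "dist (S t x) (S s x) < e"
      using *[of t s] *[of s t] s by (cases "t \<le> s") (auto simp: dist_norm norm_minus_commute)
  qed (use d in auto)
qed

text \<open>Strong continuity gives no norm continuity in time. When time and vector move together,
  the locally uniform operator bound handles \<open>v h - x\<close> and strong continuity handles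
  the fixed \<open>x\<close>. This carries the product rules below.\<close>

lemma tendsto_S:
  assumes \<tau>: "(\<tau> \<longlongrightarrow> s) F" and v: "(v \<longlongrightarrow> x) F" and nn: "eventually (\<lambda>h. \<tau> h \<ge> 0) F" and "s \<ge> 0"
  shows "((\<lambda>h. S (\<tau> h) (v h)) \<longlongrightarrow> S s x) F"
proof -
  obtain M where M: "M > 0" "\<And>t x. t \<in> {0..s + 1} \<Longrightarrow> norm (S t x) \<le> M * norm x"
    using bounded_on_interval by blast
  have near: "eventually (\<lambda>h. \<tau> h < s + 1) F" using order_tendstoD(2)[OF \<tau>, of "s + 1"] by simp
  have "((\<lambda>h. S (\<tau> h) (v h - x)) \<longlongrightarrow> 0) F"
  proof (rule Lim_null_comparison)
    show "eventually (\<lambda>h. norm (S (\<tau> h) (v h - x)) \<le> M * norm (v h - x)) F"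
      using near nn by eventually_elim (auto intro!: M)
    show "((\<lambda>h. M * norm (v h - x)) \<longlongrightarrow> 0) F"
      using v by (auto intro!: tendsto_mult_right_zero tendsto_norm_zero simp: Lim_null[symmetric])
  qed
  moreover have "((\<lambda>h. S (\<tau> h) x) \<longlongrightarrow> S s x) F"
    by (rule continuous_on_tendsto_compose[OF continuous_on_S \<tau>]) (use nn \<open>s \<ge> 0\<close> in auto)
  ultimately have "((\<lambda>h. S (\<tau> h) (v h - x) + S (\<tau> h) x) \<longlongrightarrow> 0 + S s x) F" by (rule tendsto_add)
  moreover have "eventually (\<lambda>h. S (\<tau> h) (v h - x) + S (\<tau> h) x = S (\<tau> h) (v h)) F"
    using nn by eventually_elim (simp add: S_diff)
  ultimately show ?thesis by (simp add: Lim_transform_eventually)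
qed

end

section \<open>Generators and differentiable orbits\<close>

locale generated_semigroup = strongly_continuous S
  for S :: "real \<Rightarrow> 'a::separable_complex_hilbert \<Rightarrow> 'a" +
  fixes D :: "'a set" and A :: "'a \<Rightarrow> 'a"
  assumes gen: "generates D A S"
begin

lemma in_D_iff: "x \<in> D \<longleftrightarrow> (\<exists>v. ((\<lambda>t. (S t x - x) /\<^sub>R t) \<longlongrightarrow> v) (at_right 0))"
  and generator: "x \<in> D \<Longrightarrow> ((\<lambda>t. (S t x - x) /\<^sub>R t) \<longlongrightarrow> A x) (at_right 0)"
  using gen by (auto simp: generates_def)

lemma generator_eqI:
  assumes "((\<lambda>t. (S t x - x) /\<^sub>R t) \<longlongrightarrow> v) (at_right 0)" shows "x \<in> D" "A x = v"
proof -
  show "x \<in> D" using assms in_D_iff by blast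
  then show "A x = v" using generator assms tendsto_unique trivial_limit_at_right_real by blast
qed

lemma zero_in_D: "0 \<in> D"
proof -
  have "eventually (\<lambda>t. (S t 0 - 0) /\<^sub>R t = 0) (at_right 0)"
    by (auto simp: eventually_at_filter bounded_linear.linear[OF bounded_linear_S] linear_0)
  then have "((\<lambda>t. (S t 0 - 0) /\<^sub>R t) \<longlongrightarrow> 0) (at_right 0)" by (rule tendsto_eventually)
  then show ?thesis by (rule generator_eqI)
qed

lemma subspace_D:
  shows "x \<in> D \<Longrightarrow> y \<in> D \<Longrightarrow> x + y \<in> D" and "x \<in> D \<Longrightarrow> c *\<^sub>C x \<in> D"
proof -
  show "x + y \<in> D" if "x \<in> D" "y \<in> D"
  proof (rule generator_eqI(1))
    show "((\<lambda>t. (S t (x + y) - (x + y)) /\<^sub>R t) \<longlongrightarrow> A x + A y) (at_right 0)"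
      by (rule Lim_transform_eventually[OF tendsto_add[OF generator[OF that(1)] generator[OF that(2)]]])
        (auto simp: eventually_at_filter linear_add[OF bounded_linear.linear[OF bounded_linear_S]]
          algebra_simps)
  qed
  show "c *\<^sub>C x \<in> D" if "x \<in> D"
  proof (rule generator_eqI(1))
    note [simp] = linear_cmul[OF bounded_linear.linear[OF bounded_linear_scaleC_right]]
      linear_diff[OF bounded_linear.linear[OF bounded_linear_scaleC_right]]
    show "((\<lambda>t. (S t (c *\<^sub>C x) - c *\<^sub>C x) /\<^sub>R t) \<longlongrightarrow> c *\<^sub>C A x) (at_right 0)"
      by (rule Lim_transform_eventually
          [OF bounded_linear.tendsto[OF bounded_linear_scaleC_right generator[OF that]]])
        (auto simp: eventually_at_filter S_scaleC)
  qed
qed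

lemma S_in_D:
  assumes "x \<in> D" "t \<ge> 0"
  shows "S t x \<in> D" and "A (S t x) = S t (A x)"
proof -
  interpret bounded_linear "S t" using assms bounded_linear_S by simp
  have "((\<lambda>h. S t ((S h x - x) /\<^sub>R h)) \<longlongrightarrow> S t (A x)) (at_right 0)"
    by (intro tendsto generator assms)
  then have "((\<lambda>h. (S h (S t x) - S t x) /\<^sub>R h) \<longlongrightarrow> S t (A x)) (at_right 0)"
    by (rule Lim_transform_eventually)
      (use assms S_add[of t _ x] S_add[of _ t x] in
        \<open>auto simp: eventually_at_filter scaleR diff add.commute intro!: always_eventually\<close>)
  then show "S t x \<in> D" "A (S t x) = S t (A x)" using generator_eqI by blast+
qed

text \<open>The generator supplies only a right derivative at 0. Pulling out \<open>S\<close> at the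
  earlier of the times \<open>y\<close> and \<open>t\<close> turns the quotient on either side of
  \<open>t\<close> into such a right quotient.\<close>

lemma has_vector_derivative_S:
  assumes x: "x \<in> D" and t: "t \<ge> 0"
  shows "((\<lambda>t. S t x) has_vector_derivative S t (A x)) (at t within {0..})"
  unfolding has_vector_derivative_iff_quotient
proof -
  have "((\<lambda>y. \<bar>y - t\<bar>) \<longlongrightarrow> 0) (at t within {0..})"
    by (rule tendsto_eq_intros refl | simp)+
  then have "filterlim (\<lambda>y. \<bar>y - t\<bar>) (at_right 0) (at t within {0..})"
    by (auto simp: filterlim_at eventually_at_filter)
  from filterlim_compose[OF generator[OF x] this]
  have "((\<lambda>y. S (min y t) ((S \<bar>y - t\<bar> x - x) /\<^sub>R \<bar>y - t\<bar>)) \<longlongrightarrow> S t (A x)) (at t within {0..})"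
  proof (rule tendsto_S[rotated])
    show "((\<lambda>y. min y t) \<longlongrightarrow> t) (at t within {0..})" by (rule tendsto_eq_intros refl | simp)+
  qed (use t in \<open>auto simp: eventually_at_filter\<close>)
  then show "((\<lambda>y. (S y x - S t x) /\<^sub>R (y - t)) \<longlongrightarrow> S t (A x)) (at t within {0..})"
  proof (rule Lim_transform_eventually)
    show "eventually (\<lambda>y. S (min y t) ((S \<bar>y - t\<bar> x - x) /\<^sub>R \<bar>y - t\<bar>) = (S y x - S t x) /\<^sub>R (y - t))
        (at t within {0..})"
      unfolding eventually_at_filter
    proof (intro always_eventually allI impI)
      fix y assume y: "y \<noteq> t" "y \<in> {0..}"
      note lin = bounded_linear.linear[OF bounded_linear_S]
      show "S (min y t) ((S \<bar>y - t\<bar> x - x) /\<^sub>R \<bar>y - t\<bar>) = (S y x - S t x) /\<^sub>R (y - t)"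
      proof (cases "y \<le> t")
        case True
        have "inverse (t - y) = - inverse (y - t)" by (metis inverse_minus_eq minus_diff_eq)
        with True show ?thesis using y t S_add[of y "t - y" x]
          by (simp add: linear_cmul[OF lin] linear_diff[OF lin] min_def algebra_simps)
      next
        case False
        then show ?thesis using y t S_add[of t "y - t" x]
          by (simp add: linear_cmul[OF lin] linear_diff[OF lin] min_def)
      qed
    qed
  qed
qed

text \<open>Along a solution \<open>z\<close> the function \<open>s \<mapsto> S (T - s) (z s)\<close> is constant.\<close>

lemma solution_unique:
  assumes T: "T \<ge> 0"
    and z: "\<And>s. s \<in> {0..T} \<Longrightarrow> (z has_vector_derivative A (z s)) (at s within {0..T})"
    and zD: "\<And>s. s \<in> {0..T} \<Longrightarrow> z s \<in> D"
  shows "z T = S T (z 0)"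
proof -
  have "((\<lambda>s. S (T - s) (z s)) has_vector_derivative 0) (at s within {0..T})" if s: "s \<in> {0..T}" for s
    unfolding has_vector_derivative_iff_quotient
  proof -
    \<comment> \<open>Product rule by hand: \<open>1\<close> varies the vector and \<open>2\<close>
      the time of the semigroup, and the two limits cancel.\<close>
    have 1: "((\<lambda>y. S (T - y) ((z y - z s) /\<^sub>R (y - s))) \<longlongrightarrow> S (T - s) (A (z s))) (at s within {0..T})"
      using z[OF s] s unfolding has_vector_derivative_iff_quotient
      by (intro tendsto_S) (auto intro!: tendsto_intros simp: eventually_at_filter)
    have "((\<lambda>t. S t (z s)) \<circ> (\<lambda>y. T - y) has_vector_derivative (-1) *\<^sub>R S (T - s) (A (z s))) (at s within {0..T})"
    proof (rule vector_diff_chain_within)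
      show "((-) T has_vector_derivative -1) (at s within {0..T})"
        by (auto intro!: derivative_eq_intros)
      show "((\<lambda>t. S t (z s)) has_vector_derivative S (T - s) (A (z s))) (at (T - s) within (-) T ` {0..T})"
        by (rule has_vector_derivative_within_subset[OF has_vector_derivative_S[OF zD[OF s]]]) (use s in auto)
    qed
    then have 2: "((\<lambda>y. (S (T - y) (z s) - S (T - s) (z s)) /\<^sub>R (y - s)) \<longlongrightarrow> - S (T - s) (A (z s))) (at s within {0..T})"
      by (simp add: has_vector_derivative_iff_quotient)
    show "((\<lambda>y. (S (T - y) (z y) - S (T - s) (z s)) /\<^sub>R (y - s)) \<longlongrightarrow> 0) (at s within {0..T})"
    proof (rule Lim_transform_eventually[OF tendsto_add[OF 1 2, simplified]])
      note lin = bounded_linear.linear[OF bounded_linear_S]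
      show "eventually (\<lambda>y. S (T - y) ((z y - z s) /\<^sub>R (y - s)) + (S (T - y) (z s) - S (T - s) (z s)) /\<^sub>R (y - s)
        = (S (T - y) (z y) - S (T - s) (z s)) /\<^sub>R (y - s)) (at s within {0..T})"
        unfolding eventually_at_filter
      proof (intro always_eventually allI impI)
        fix y assume "y \<in> {0..T}"
        then show "S (T - y) ((z y - z s) /\<^sub>R (y - s)) + (S (T - y) (z s) - S (T - s) (z s)) /\<^sub>R (y - s)
            = (S (T - y) (z y) - S (T - s) (z s)) /\<^sub>R (y - s)"
          by (simp add: linear_cmul[OF lin] linear_diff[OF lin] flip: scaleR_add_right)
      qed
    qed
  qed
  then obtain k where k: "\<And>s. s \<in> {0..T} \<Longrightarrow> S (T - s) (z s) = k"
    using has_vector_derivative_zero_constant[OF convex_real_interval(5), of 0 T "\<lambda>s. S (T - s) (z s)"]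
    by blast
  show ?thesis using k[of 0] k[of T] T by simp
qed

text \<open>The hypotheses describe a Jordan chain of the adjoint in weak form;
  \<open>\<psi>2 = 0\<close> covers plain eigenvectors. After multiplication by
  \<open>exp (- l * of_real t)\<close>, the pairing with \<open>\<psi>2\<close> is constant in time,
  hence the pairing with \<open>\<psi>1\<close> has constant derivative.\<close>

lemma cinner_S_adjoint_eigenvector:
  assumes dense: "closure D = UNIV"
    and \<psi>2: "\<And>x. x \<in> D \<Longrightarrow> cinner (A x) \<psi>2 = l * cinner x \<psi>2"
    and \<psi>1: "\<And>x. x \<in> D \<Longrightarrow> cinner (A x) \<psi>1 = l * cinner x \<psi>1 + c * cinner x \<psi>2"
    and t: "t \<ge> 0"
  shows "cinner (S t x) \<psi>1 = exp (l * of_real t) * (cinner x \<psi>1 + c * of_real t * cinner x \<psi>2)"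
proof -
  have der: "((\<lambda>t. cinner (S t x) \<psi>) has_vector_derivative cinner (A (S t x)) \<psi>) (at t within {0..})"
    if "x \<in> D" "t \<ge> 0" for x t \<psi>
    using bounded_linear.has_vector_derivative[OF bounded_linear_cinner_left has_vector_derivative_S[OF that]]
      S_in_D[OF that] by simp
  have exp: "((\<lambda>t. exp (- l * of_real t)) has_vector_derivative - l * exp (- l * of_real t)) (at t within X)" for t X
    by (auto intro!: derivative_eq_intros has_vector_derivative_real_field)
  have const: "f t = f 0" if f: "\<And>t. t \<ge> 0 \<Longrightarrow> (f has_vector_derivative 0) (at t within {0..})" and "t \<ge> 0"
    for f :: "real \<Rightarrow> complex" and t
  proof -
    obtain k where k: "\<And>s. s \<in> {0..} \<Longrightarrow> f s = k"
      using has_vector_derivative_zero_constant[OF convex_real_interval(1), of 0 f] f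
      by (metis atLeast_iff)
    show ?thesis using k[of 0] k[of t] \<open>t \<ge> 0\<close> by simp
  qed
  have e0: "exp (- l * of_real t) * exp (l * of_real t) = 1" for t
    by (simp flip: exp_add)
  have h: "exp (- l * of_real t) * cinner (S t x) \<psi>2 = cinner x \<psi>2" if x: "x \<in> D" and t: "t \<ge> 0" for x t
  proof -
    have "((\<lambda>t. exp (- l * of_real t) * cinner (S t x) \<psi>2) has_vector_derivative 0) (at t within {0..})"
      if "t \<ge> 0" for t
      by (rule has_vector_derivative_eq_rhs[OF has_vector_derivative_mult[OF exp der[OF x that]]])
        (simp add: \<psi>2 S_in_D(1)[OF x that])
    from const[OF this t] show ?thesis by simp
  qed
  have D: "cinner (S t x) \<psi>1 = exp (l * of_real t) * (cinner x \<psi>1 + c * of_real t * cinner x \<psi>2)"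
    if x: "x \<in> D" for x
  proof -
    have lin: "((\<lambda>t. c * of_real t * cinner x \<psi>2) has_vector_derivative c * cinner x \<psi>2) (at t within X)" for t X
      by (auto intro!: derivative_eq_intros has_vector_derivative_real_field)
    \<comment> \<open>The linear term compensates the derivative contributed by
      \<open>\<psi>2\<close>, so a constant function remains.\<close>
    have "((\<lambda>t. exp (- l * of_real t) * cinner (S t x) \<psi>1 - c * of_real t * cinner x \<psi>2)
        has_vector_derivative 0) (at t within {0..})"
      if "t \<ge> 0" for t
    proof (rule has_vector_derivative_eq_rhs[OF has_vector_derivative_diff[OF has_vector_derivative_mult[OF exp der[OF x that]] lin]])
      have "exp (- l * of_real t) * (c * cinner (S t x) \<psi>2) = c * cinner x \<psi>2"
        using h[OF x that] by (simp add: mult.left_commute)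
      then show "exp (- l * of_real t) * cinner (A (S t x)) \<psi>1 + - l * exp (- l * of_real t) * cinner (S t x) \<psi>1
          - c * cinner x \<psi>2 = 0"
        by (simp add: \<psi>1 S_in_D(1)[OF x that] algebra_simps)
    qed
    from const[OF this t] have "exp (- l * of_real t) * cinner (S t x) \<psi>1 = cinner x \<psi>1 + c * of_real t * cinner x \<psi>2"
      by (simp add: algebra_simps)
    then show ?thesis
      using e0[of t] by (metis mult.assoc mult.commute mult_1)
  qed
  \<comment> \<open>For fixed \<open>t\<close> both sides are continuous in \<open>x\<close>, so the
    identity passes from \<open>D\<close> to its closure.\<close>
  have "closed {x. cinner (S t x) \<psi>1 = exp (l * of_real t) * (cinner x \<psi>1 + c * of_real t * cinner x \<psi>2)}"
    by (intro closed_Collect_eq continuous_intros continuous_on_cinner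
        linear_continuous_on bounded_linear_S t)
  then have "closure D \<subseteq> {x. cinner (S t x) \<psi>1 = exp (l * of_real t) * (cinner x \<psi>1 + c * of_real t * cinner x \<psi>2)}"
    by (rule closure_minimal[rotated]) (use D in auto)
  then show ?thesis using dense by auto
qed

end

section \<open>Square integrable functions\<close>

text \<open>\<open>bf\<close> is prescribed on \<open>{0..t1}\<close> only, so membership in
  \<open>L2\<close> has to be independent of values elsewhere.\<close>

lemma L2_cong:
  assumes "\<And>t. t \<in> {0..T} \<Longrightarrow> u t = v t"
  shows "u \<in> L2 T \<longleftrightarrow> v \<in> L2 T"
proof -
  have "(\<lambda>t. indicator {0..T} t *\<^sub>R u t) = (\<lambda>t. indicator {0..T} t *\<^sub>R v t)"
    "(\<lambda>t. indicator {0..T} t *\<^sub>R (cmod (u t))\<^sup>2) = (\<lambda>t. indicator {0..T} t *\<^sub>R (cmod (v t))\<^sup>2)"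
    using assms by (auto simp: indicator_def intro!: ext)
  then show ?thesis by (simp add: L2_def set_borel_measurable_def set_integrable_def)
qed

lemma L2_measurable: "u \<in> L2 T \<Longrightarrow> (\<lambda>t. indicator {0..T} t *\<^sub>R u t) \<in> borel_measurable lborel"
  by (simp add: L2_def set_borel_measurable_def)

lemma L2_square_integrable: "u \<in> L2 T \<Longrightarrow> set_integrable lborel {0..T} (\<lambda>t. (cmod (u t))\<^sup>2)"
  by (simp add: L2_def)

lemma L2_I:
  assumes "(\<lambda>t. indicator {0..T} t *\<^sub>R u t) \<in> borel_measurable lborel"
    and "set_integrable lborel {0..T} g" and "\<And>t. t \<in> {0..T} \<Longrightarrow> (cmod (u t))\<^sup>2 \<le> g t"
  shows "u \<in> L2 T"
  unfolding L2_def
proof (intro CollectI conjI)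
  show "set_borel_measurable lborel {0..T} u" using assms(1) by (simp add: set_borel_measurable_def)
  have "(\<lambda>t. indicator {0..T} t *\<^sub>R (cmod (u t))\<^sup>2) = (\<lambda>t. (cmod (indicator {0..T} t *\<^sub>R u t))\<^sup>2)"
    by (auto simp: indicator_def)
  also have "\<dots> \<in> borel_measurable lborel" using assms(1) by measurable
  finally have "set_borel_measurable lborel {0..T} (\<lambda>t. (cmod (u t))\<^sup>2)"
    by (simp add: set_borel_measurable_def)
  then show "set_integrable lborel {0..T} (\<lambda>t. (cmod (u t))\<^sup>2)"
    by (rule set_integrable_bound[OF assms(2)])
      (auto intro!: AE_I2 order_trans[OF assms(3) abs_ge_self])
qed

lemma L2_continuous:
  assumes "continuous_on {0..T} u" shows "u \<in> L2 T"
proof (rule L2_I)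
  show "(\<lambda>t. indicator {0..T} t *\<^sub>R u t) \<in> borel_measurable lborel"
    using borel_measurable_continuous_on_indicator[OF _ assms] by simp
  show "set_integrable lborel {0..T} (\<lambda>t. (cmod (u t))\<^sup>2)"
    unfolding set_integrable_def
    by (intro borel_integrable_compact continuous_intros assms) auto
qed auto

lemma L2_scale:
  assumes "u \<in> L2 T" shows "(\<lambda>t. c * u t) \<in> L2 T"
proof (rule L2_I)
  have "(\<lambda>t. indicator {0..T} t *\<^sub>R (c * u t)) = (\<lambda>t. c * (indicator {0..T} t *\<^sub>R u t))"
    by (auto simp: indicator_def)
  also have "\<dots> \<in> borel_measurable lborel" using L2_measurable[OF assms] by measurable
  finally show "(\<lambda>t. indicator {0..T} t *\<^sub>R (c * u t)) \<in> borel_measurable lborel" .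
  show "set_integrable lborel {0..T} (\<lambda>t. (cmod c)\<^sup>2 * (cmod (u t))\<^sup>2)"
    using L2_square_integrable[OF assms] by simp
qed (simp add: norm_mult power_mult_distrib)

lemma L2_add:
  assumes "u \<in> L2 T" "v \<in> L2 T" shows "(\<lambda>t. u t + v t) \<in> L2 T"
proof (rule L2_I)
  have "(\<lambda>t. indicator {0..T} t *\<^sub>R (u t + v t))
      = (\<lambda>t. indicator {0..T} t *\<^sub>R u t + indicator {0..T} t *\<^sub>R v t)"
    by (auto simp: indicator_def)
  also have "\<dots> \<in> borel_measurable lborel" using assms[THEN L2_measurable] by measurable
  finally show "(\<lambda>t. indicator {0..T} t *\<^sub>R (u t + v t)) \<in> borel_measurable lborel" .
  show "set_integrable lborel {0..T} (\<lambda>t. 2 * (cmod (u t))\<^sup>2 + 2 * (cmod (v t))\<^sup>2)"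
    using assms[THEN L2_square_integrable] by (intro set_integral_add) auto
  fix t
  have "(cmod (u t + v t))\<^sup>2 \<le> (cmod (u t) + cmod (v t))\<^sup>2"
    by (intro power_mono norm_triangle_ineq) auto
  also have "\<dots> \<le> 2 * (cmod (u t))\<^sup>2 + 2 * (cmod (v t))\<^sup>2"
    using sum_squares_bound[of "cmod (u t)" "cmod (v t)"] by (simp add: power2_sum)
  finally show "(cmod (u t + v t))\<^sup>2 \<le> 2 * (cmod (u t))\<^sup>2 + 2 * (cmod (v t))\<^sup>2" .
qed

lemma L2_cnj:
  assumes "u \<in> L2 T" shows "(\<lambda>t. cnj (u t)) \<in> L2 T"
proof (rule L2_I)
  have "(\<lambda>t. indicator {0..T} t *\<^sub>R cnj (u t)) = (\<lambda>t. cnj (indicator {0..T} t *\<^sub>R u t))"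
    by (auto simp: indicator_def)
  also have "\<dots> \<in> borel_measurable lborel"
    using L2_measurable[OF assms]
    by (rule borel_measurable_continuous_on[rotated]) (intro continuous_intros)
  finally show "(\<lambda>t. indicator {0..T} t *\<^sub>R cnj (u t)) \<in> borel_measurable lborel" .
qed (use L2_square_integrable[OF assms] in auto)

lemma L2_zero: "(\<lambda>t. 0) \<in> L2 T"
  by (rule L2_continuous) (intro continuous_intros)

lemma L2_sum: "(\<And>j. j \<in> F \<Longrightarrow> f j \<in> L2 T) \<Longrightarrow> (\<lambda>t. \<Sum>j\<in>F. c j * f j t) \<in> L2 T"
proof (induction F rule: infinite_finite_induct)
  case (insert x F)
  then show ?case using L2_add[OF L2_scale[of "f x" T "c x"], of "\<lambda>t. \<Sum>j\<in>F. c j * f j t"] by simp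
qed (simp_all add: L2_zero)

lemma L2_lincomb: "u \<in> L2 T \<Longrightarrow> v \<in> L2 T \<Longrightarrow> (\<lambda>t. \<alpha> * u t + \<beta> * v t) \<in> L2 T"
  by (intro L2_add L2_scale)

lemma L2_diff: "u \<in> L2 T \<Longrightarrow> v \<in> L2 T \<Longrightarrow> (\<lambda>t. u t - v t) \<in> L2 T"
  using L2_lincomb[of u T v 1 "-1"] by simp

lemma L2_product_integrable:
  assumes "u \<in> L2 T" "v \<in> L2 T"
  shows "set_integrable lborel {0..T} (\<lambda>t. u t * v t)"
proof (rule set_integrable_bound)
  show "set_integrable lborel {0..T} (\<lambda>t. (cmod (u t))\<^sup>2 + (cmod (v t))\<^sup>2)"
    using assms[THEN L2_square_integrable] by (rule set_integral_add)
  have "(\<lambda>t. indicator {0..T} t *\<^sub>R (u t * v t))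
      = (\<lambda>t. (indicator {0..T} t *\<^sub>R u t) * (indicator {0..T} t *\<^sub>R v t))"
    by (auto simp: indicator_def)
  also have "\<dots> \<in> borel_measurable lborel" using assms[THEN L2_measurable] by measurable
  finally show "set_borel_measurable lborel {0..T} (\<lambda>t. u t * v t)"
    by (simp add: set_borel_measurable_def)
  have "cmod (u t * v t) \<le> norm ((cmod (u t))\<^sup>2 + (cmod (v t))\<^sup>2)" for t
  proof -
    have "2 * (cmod (u t) * cmod (v t)) \<le> (cmod (u t))\<^sup>2 + (cmod (v t))\<^sup>2"
      using sum_squares_bound[of "cmod (u t)" "cmod (v t)"] by simp
    moreover have "0 \<le> cmod (u t) * cmod (v t)" by simp
    ultimately show ?thesis unfolding norm_mult real_norm_def by linarith
  qed
  then show "AE t in lborel. t \<in> {0..T} \<longrightarrow> cmod (u t * v t) \<le> norm ((cmod (u t))\<^sup>2 + (cmod (v t))\<^sup>2)"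
    by (intro AE_I2) auto
qed

lemma L2_inner_integrable:
  "u \<in> L2 T \<Longrightarrow> v \<in> L2 T \<Longrightarrow> set_integrable lborel {0..T} (\<lambda>t. u t * cnj (v t))"
  by (intro L2_product_integrable L2_cnj)

lemma L2_inner_add_left:
  "u \<in> L2 T \<Longrightarrow> v \<in> L2 T \<Longrightarrow> w \<in> L2 T \<Longrightarrow>
    L2_inner T (\<lambda>t. u t + v t) w = L2_inner T u w + L2_inner T v w"
  unfolding L2_inner_def
  by (subst set_integral_add(2)[symmetric]) (auto intro: L2_inner_integrable simp: algebra_simps)

lemma L2_inner_scale_left: "L2_inner T (\<lambda>t. c * u t) w = c * L2_inner T u w"
  by (simp add: L2_inner_def mult.assoc)

lemma L2_inner_commute: "L2_inner T u v = cnj (L2_inner T v u)"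
proof -
  have "cnj (L2_inner T v u) = (LINT t:{0..T}|lborel. cnj (v t * cnj (u t)))"
    unfolding L2_inner_def set_lebesgue_integral_def
    by (simp flip: Bochner_Integration.integral_cnj)
  then show ?thesis by (simp add: L2_inner_def mult.commute)
qed

lemma L2_inner_add_right:
  "u \<in> L2 T \<Longrightarrow> v \<in> L2 T \<Longrightarrow> w \<in> L2 T \<Longrightarrow>
    L2_inner T w (\<lambda>t. u t + v t) = L2_inner T w u + L2_inner T w v"
  by (metis L2_inner_commute L2_inner_add_left complex_cnj_add)

lemma L2_inner_scale_right: "L2_inner T w (\<lambda>t. c * u t) = cnj c * L2_inner T w u"
  by (metis L2_inner_commute L2_inner_scale_left complex_cnj_mult)

lemma L2_inner_sum_left:
  assumes "\<And>j. j \<in> F \<Longrightarrow> f j \<in> L2 T" "w \<in> L2 T"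
  shows "L2_inner T (\<lambda>t. \<Sum>j\<in>F. c j * f j t) w = (\<Sum>j\<in>F. c j * L2_inner T (f j) w)"
  using assms
proof (induction F rule: infinite_finite_induct)
  case (insert x F)
  have "L2_inner T (\<lambda>t. \<Sum>j\<in>insert x F. c j * f j t) w
      = L2_inner T (\<lambda>t. c x * f x t + (\<Sum>j\<in>F. c j * f j t)) w"
    using insert by simp
  also have "\<dots> = c x * L2_inner T (f x) w + L2_inner T (\<lambda>t. \<Sum>j\<in>F. c j * f j t) w"
    using insert by (subst L2_inner_add_left) (auto intro: L2_scale L2_sum simp: L2_inner_scale_left)
  finally show ?case using insert by simp
qed (auto simp: L2_inner_def)

lemma L2_inner_sum_sum:
  assumes "\<And>j. j \<in> F \<Longrightarrow> f j \<in> L2 T"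
  shows "L2_inner T (\<lambda>t. \<Sum>j\<in>F. c j * f j t) (\<lambda>t. \<Sum>j\<in>F. c j * f j t)
    = (\<Sum>i\<in>F. \<Sum>j\<in>F. c i * cnj (c j) * L2_inner T (f i) (f j))"
proof -
  have "L2_inner T (f i) (\<lambda>t. \<Sum>j\<in>F. c j * f j t) = (\<Sum>j\<in>F. cnj (c j) * L2_inner T (f i) (f j))"
    if "i \<in> F" for i
    using assms that
    by (subst L2_inner_commute, subst L2_inner_sum_left)
      (auto intro!: sum.cong simp: L2_inner_commute[of T _ "f i"])
  then show ?thesis
    using assms by (simp add: L2_inner_sum_left L2_sum sum_distrib_left mult.assoc)
qed

section \<open>The squared seminorm: Cauchy--Schwarz and completeness\<close>

abbreviation L2_sq :: "real \<Rightarrow> (real \<Rightarrow> complex) \<Rightarrow> real"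
  where "L2_sq T u \<equiv> Re (L2_inner T u u)"

lemma L2_sq_eq: "L2_sq T u = (LINT t:{0..T}|lborel. (cmod (u t))\<^sup>2)"
proof -
  have "L2_inner T u u = (LINT t:{0..T}|lborel. complex_of_real ((cmod (u t))\<^sup>2))"
    unfolding L2_inner_def by (simp only: complex_norm_square)
  then show ?thesis
    by (simp only: set_integral_complex_of_real Re_complex_of_real)
qed

lemma L2_sq_nonneg: "0 \<le> L2_sq T u"
  unfolding L2_sq_eq set_lebesgue_integral_def by (intro integral_nonneg_AE AE_I2) auto

text \<open>Serves the parallelogram law (coefficients 1, -1 and 1/2, 1/2) and perturbations by a
  real parameter; real coefficients are enough for both.\<close>

lemma L2_sq_lincomb:
  assumes "u \<in> L2 T" "v \<in> L2 T"
  shows "L2_sq T (\<lambda>t. complex_of_real \<alpha> * u t + complex_of_real \<beta> * v t)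
    = \<alpha>\<^sup>2 * L2_sq T u + 2 * \<alpha> * \<beta> * Re (L2_inner T u v) + \<beta>\<^sup>2 * L2_sq T v"
proof -
  have "Re (L2_inner T v u) = Re (L2_inner T u v)" by (subst L2_inner_commute) simp
  then show ?thesis using assms
    by (simp add: L2_inner_add_left L2_inner_add_right L2_scale L2_lincomb L2_inner_scale_left
        L2_inner_scale_right power2_eq_square algebra_simps)
qed

lemma L2_Cauchy_Schwarz:
  assumes u: "u \<in> L2 T" and v: "v \<in> L2 T"
  shows "(cmod (L2_inner T u v))\<^sup>2 \<le> L2_sq T u * L2_sq T v"
proof -
  have *: "(Re (L2_inner T u v))\<^sup>2 \<le> L2_sq T u * L2_sq T v" if u: "u \<in> L2 T" for u
  proof (rule quadratic_nonneg_bound)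
    show "0 \<le> L2_sq T u + 2 * t * Re (L2_inner T u v) + t\<^sup>2 * L2_sq T v" for t
      using L2_sq_nonneg[of T "\<lambda>s. complex_of_real 1 * u s + complex_of_real t * v s"]
      by (simp only: L2_sq_lincomb[OF u v]) simp
  qed (rule L2_sq_nonneg)
  define w where "w = (if L2_inner T u v = 0 then 1 else cnj (sgn (L2_inner T u v)))"
  have w: "cmod w = 1" "w * L2_inner T u v = of_real (cmod (L2_inner T u v))"
    by (auto simp: w_def sgn_eq norm_divide power2_eq_square mult.commute[of "cnj _"]
        simp flip: complex_norm_square)
  have "L2_inner T (\<lambda>t. w * u t) (\<lambda>t. w * u t) = (w * cnj w) * L2_inner T u u"
    by (simp add: L2_inner_scale_left L2_inner_scale_right)
  also have "w * cnj w = 1" using w by (simp flip: complex_norm_square)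
  finally show ?thesis
    using *[OF L2_scale[OF u, of w]] by (simp add: L2_inner_scale_left w)
qed

text \<open>With \<open>d\<^sub>k = u\<^sub>k\<^sub>+\<^sub>1 - u\<^sub>k\<close>, Cauchy--Schwarz bounds \<open>|u\<^sub>m - u\<^sub>n|\<^sup>2\<close> pointwise by
  \<open>2 * 2\<^sup>-\<^sup>n\<close> times the integrable function \<open>H = (\<Sum>k. 2\<^sup>k |d\<^sub>k|\<^sup>2)\<close>.\<close>

lemma L2_complete:
  assumes u: "\<And>n::nat. u n \<in> L2 T"
    and fast: "\<And>n. L2_sq T (\<lambda>t. u (Suc n) t - u n t) \<le> K * (1/4)^n"
  shows "\<exists>v\<in>L2 T. (\<lambda>n. L2_sq T (\<lambda>t. v t - u n t)) \<longlonglongrightarrow> 0"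
proof -
  \<comment> \<open>Cut off outside the interval, the functions are measurable on the whole line,
    and pointwise limits can be taken there.\<close>
  define w where "w n t = indicator {0..T} t *\<^sub>R u n t" for n t
  have w_meas [measurable]: "w n \<in> borel_measurable lborel" for n
    using L2_measurable[OF u] by (simp add: w_def[abs_def])
  define d where "d n t = w (Suc n) t - w n t" for n t
  have [measurable]: "d n \<in> borel_measurable lborel" for n
    unfolding d_def[abs_def] by measurable
  \<comment> \<open>The weight \<open>2^n\<close> balances two needs: against the decay
    \<open>(1/4)^n\<close> of the integrals it leaves a summable series, and its reciprocals are
    summable as well.\<close>
  define h where "h n t = 2^n * (cmod (d n t))\<^sup>2" for n t
  have [measurable]: "h n \<in> borel_measurable lborel" for n unfolding h_def[abs_def] by measurable
  have h_nonneg: "h n t \<ge> 0" for n t by (simp add: h_def)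
  have d_eq: "(cmod (d n t))\<^sup>2 = indicator {0..T} t *\<^sub>R (cmod (u (Suc n) t - u n t))\<^sup>2" for n t
    by (auto simp: d_def w_def indicator_def)
  have d_int: "integrable lborel (\<lambda>t. (cmod (d n t))\<^sup>2)"
    and d_le: "(LINT t|lborel. (cmod (d n t))\<^sup>2) \<le> K * (1/4)^n" for n
    using L2_square_integrable[OF L2_diff[OF u[of "Suc n"] u[of n]]] fast[of n]
    by (simp_all only: d_eq set_integrable_def L2_sq_eq set_lebesgue_integral_def)
  have h_int: "integrable lborel (h n)" for n unfolding h_def[abs_def] using d_int by simp
  have h_le: "(LINT t|lborel. h n t) \<le> K * (1/2)^n" for n
  proof -
    have "(LINT t|lborel. h n t) = 2^n * (LINT t|lborel. (cmod (d n t))\<^sup>2)"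
      by (simp add: h_def)
    also have "\<dots> \<le> 2^n * (K * (1/4)^n)" by (intro mult_left_mono d_le) auto
    also have "\<dots> = K * (2 * (1/4))^n" by (simp only: power_mult_distrib ac_simps)
    also have "\<dots> = K * (1/2)^n" by simp
    finally show ?thesis .
  qed
  have h_sum: "summable (\<lambda>n. LINT t|lborel. norm (h n t))"
  proof (rule summable_comparison_test')
    show "summable (\<lambda>n. K * (1/2)^n)" by (intro summable_mult summable_geometric) auto
    show "norm (LINT t|lborel. norm (h n t)) \<le> K * (1/2)^n" if "n \<ge> 0" for n
      using h_le[of n] h_nonneg by simp
  qed
  have h_AE: "AE t in lborel. summable (\<lambda>n. norm (h n t))"
  proof -
    have "(\<integral>\<^sup>+t. (\<Sum>n. ennreal (h n t)) \<partial>lborel) = (\<Sum>n. \<integral>\<^sup>+t. ennreal (h n t) \<partial>lborel)"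
      by (intro nn_integral_suminf) measurable
    also have "\<dots> = (\<Sum>n. ennreal (LINT t|lborel. h n t))"
      using h_int h_nonneg by (intro suminf_cong nn_integral_eq_integral) auto
    also have "\<dots> \<noteq> \<infinity>"
      using h_sum h_nonneg by (subst suminf_ennreal2) (auto intro!: integral_nonneg_AE)
    finally have "AE t in lborel. (\<Sum>n. ennreal (h n t)) \<noteq> \<infinity>"
      by (intro nn_integral_PInf_AE) auto
    then show ?thesis
    proof eventually_elim
      case (elim t)
      then show ?case using h_nonneg by (auto intro!: summable_suminf_not_top simp: top_ennreal_def[symmetric])
    qed
  qed
  define H where "H t = (\<Sum>n. h n t)" for t
  have H_int: "integrable lborel H"
    unfolding H_def[abs_def] by (intro integrable_suminf h_int h_AE h_sum)
  have tail: "(cmod (w m t - w n t))\<^sup>2 \<le> 2 * (1/2)^n * H t"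
    if "summable (\<lambda>n. norm (h n t))" "n \<le> m" for m n t
  proof -
    have sh: "summable (\<lambda>n. h n t)" using that(1) h_nonneg by simp
    have geo: "(\<Sum>k\<in>{n..<m}. (1/2::real)^k) \<le> 2 * (1/2)^n"
    proof -
      have "(\<Sum>k\<in>{n..<m}. (1/2::real)^k) = 2 * (1/2)^n - 2 * (1/2)^m"
        using that(2) by (induction m rule: dec_induct) auto
      then show ?thesis by simp
    qed
    have "w m t - w n t = (\<Sum>k\<in>{n..<m}. d k t)"
      using sum_Suc_diff'[OF that(2), of "\<lambda>k. w k t"] by (simp add: d_def)
    then have "(cmod (w m t - w n t))\<^sup>2 \<le> (\<Sum>k\<in>{n..<m}. cmod (d k t))\<^sup>2"
      by (auto intro!: power_mono norm_sum)
    \<comment> \<open>Inserting a factor 1 splits each term so that Cauchy--Schwarz yields a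
      geometric sum times a partial sum of \<open>H\<close>.\<close>
    also have "\<dots> = (\<Sum>k\<in>{n..<m}. sqrt ((1/2)^k) * (sqrt (2^k) * cmod (d k t)))\<^sup>2"
    proof -
      have "sqrt ((1/2)^k) * sqrt (2^k) = 1" for k :: nat
        by (simp add: real_sqrt_mult[symmetric] power_mult_distrib[symmetric])
      then show ?thesis by (simp only: mult.assoc[symmetric] mult_1)
    qed
    also have "\<dots> \<le> (\<Sum>k\<in>{n..<m}. (sqrt ((1/2)^k))\<^sup>2) * (\<Sum>k\<in>{n..<m}. (sqrt (2^k) * cmod (d k t))\<^sup>2)"
      by (rule Cauchy_Schwarz_ineq_sum)
    also have "\<dots> = (\<Sum>k\<in>{n..<m}. (1/2)^k) * (\<Sum>k\<in>{n..<m}. h k t)"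
      by (simp add: power_mult_distrib h_def)
    also have "\<dots> \<le> (2 * (1/2)^n) * H t"
      unfolding H_def using geo h_nonneg sh
      by (intro mult_mono sum_le_suminf) (auto intro!: sum_nonneg)
    finally show ?thesis .
  qed
  \<comment> \<open>\<open>lim\<close> is measurable in \<open>t\<close> even where the sequence
    diverges; by \<open>h_AE\<close> such points form a null set.\<close>
  define v where "v t = lim (\<lambda>n. w n t)" for t
  have v_meas [measurable]: "v \<in> borel_measurable lborel"
    unfolding v_def[abs_def] by measurable
  have lim: "(\<lambda>n. w n t) \<longlonglongrightarrow> v t" if sh: "summable (\<lambda>n. norm (h n t))" for t
  proof -
    have "Cauchy (\<lambda>n. w n t)"
    proof (rule CauchyI')
      fix e :: real assume e: "e > 0"
      have "(\<lambda>n. 2 * (1/2)^n * H t) \<longlonglongrightarrow> 2 * 0 * H t"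
        by (intro tendsto_intros LIMSEQ_realpow_zero) auto
      then have "eventually (\<lambda>n. 2 * (1/2)^n * H t < e\<^sup>2) sequentially"
        using e by (intro order_tendstoD) auto
      then obtain M where M: "\<And>n. n \<ge> M \<Longrightarrow> 2 * (1/2)^n * H t < e\<^sup>2"
        by (auto simp: eventually_sequentially)
      have "dist (w m t) (w n t) < e" if "m \<ge> M" "n > m" for m n
      proof -
        have "(cmod (w n t - w m t))\<^sup>2 < e\<^sup>2"
          using tail[OF sh, of m n] M[of m] that by auto
        then show ?thesis using e
          by (auto simp: dist_norm norm_minus_commute intro: power2_less_imp_less)
      qed
      then show "\<exists>M. \<forall>m\<ge>M. \<forall>n>m. dist (w m t) (w n t) < e" by blast
    qed
    then show ?thesis by (simp add: v_def Cauchy_convergent_iff convergent_LIMSEQ_iff)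
  qed
  have v_le: "AE t in lborel. (cmod (v t - w n t))\<^sup>2 \<le> 2 * (1/2)^n * H t" for n
    using h_AE
  proof eventually_elim
    case (elim t)
    have "(\<lambda>m. (cmod (w m t - w n t))\<^sup>2) \<longlonglongrightarrow> (cmod (v t - w n t))\<^sup>2"
      by (intro tendsto_intros lim elim)
    then show ?case
      by (rule LIMSEQ_le_const2) (use tail[OF elim] in blast)
  qed
  have v_int: "integrable lborel (\<lambda>t. (cmod (v t - w n t))\<^sup>2)" for n
    by (rule Bochner_Integration.integrable_bound[of _ "\<lambda>t. 2 * (1/2)^n * H t"])
      (use v_le[of n] H_int in \<open>auto elim!: eventually_mono\<close>)
  have w_out: "w n t = u n t" if "t \<in> {0..T}" for n t using that by (simp add: w_def)
  have v_out: "v t = 0" if "t \<notin> {0..T}" for t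
    using that by (simp add: v_def w_def lim_const)
  have eq: "(\<lambda>t. (cmod (v t - w n t))\<^sup>2) = (\<lambda>t. indicator {0..T} t *\<^sub>R (cmod (v t - u n t))\<^sup>2)" for n
    by (auto simp: indicator_def w_def v_out)
  have vL2: "v \<in> L2 T"
  proof -
    have "(\<lambda>t. v t - u 0 t) \<in> L2 T"
    proof (rule L2_I)
      have "(\<lambda>t. indicator {0..T} t *\<^sub>R (v t - u 0 t)) = (\<lambda>t. v t - w 0 t)"
        by (auto simp: indicator_def w_def v_out)
      also have "\<dots> \<in> borel_measurable lborel" by measurable
      finally show "(\<lambda>t. indicator {0..T} t *\<^sub>R (v t - u 0 t)) \<in> borel_measurable lborel" .
      show "set_integrable lborel {0..T} (\<lambda>t. (cmod (v t - u 0 t))\<^sup>2)"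
        using v_int[of 0] by (simp only: eq set_integrable_def)
    qed auto
    from L2_add[OF this u[of 0]] show ?thesis by simp
  qed
  have "(\<lambda>n. L2_sq T (\<lambda>t. v t - u n t)) \<longlonglongrightarrow> 0"
  proof (rule tendsto_sandwich)
    show "eventually (\<lambda>n. 0 \<le> L2_sq T (\<lambda>t. v t - u n t)) sequentially"
      by (intro always_eventually allI L2_sq_nonneg)
    have "L2_sq T (\<lambda>t. v t - u n t) \<le> 2 * (1/2)^n * (LINT t|lborel. H t)" for n
    proof -
      have "L2_sq T (\<lambda>t. v t - u n t) = (LINT t|lborel. (cmod (v t - w n t))\<^sup>2)"
        by (simp only: L2_sq_eq set_lebesgue_integral_def eq)
      also have "\<dots> \<le> (LINT t|lborel. 2 * (1/2)^n * H t)"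
        by (rule integral_mono_AE) (use v_le v_int H_int in auto)
      finally show ?thesis by simp
    qed
    then show "eventually (\<lambda>n. L2_sq T (\<lambda>t. v t - u n t) \<le> 2 * (1/2)^n * (LINT t|lborel. H t)) sequentially"
      by simp
    have "(\<lambda>n. 2 * (1/2)^n * (LINT t|lborel. H t)) \<longlonglongrightarrow> 2 * 0 * (LINT t|lborel. H t)"
      by (intro tendsto_intros LIMSEQ_realpow_zero) auto
    then show "(\<lambda>n. 2 * (1/2)^n * (LINT t|lborel. H t)) \<longlonglongrightarrow> 0" by simp
  qed simp
  with vL2 show ?thesis by blast
qed

section \<open>Moment problems and Gram matrices\<close>

text \<open>Riesz representation on the closed span of the \<open>f j\<close> for the functional
  that sends \<open>f j\<close> to \<open>a j\<close>. The lower bound together with the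
  square-summability of \<open>a\<close> makes this functional bounded, and \<open>v\<close> is the
  limit of a minimizing sequence for the squared norm minus twice the real part of the
  functional.\<close>

lemma L2_moment_problem:
  assumes f: "\<And>j. j \<in> J \<Longrightarrow> f j \<in> L2 T" and L: "L > 0"
    and low: "\<And>F c. finite F \<Longrightarrow> F \<subseteq> J \<Longrightarrow>
      L * (\<Sum>j\<in>F. (cmod (c j))\<^sup>2) \<le> L2_sq T (\<lambda>t. \<Sum>j\<in>F. c j * f j t)"
    and a: "\<And>F. finite F \<Longrightarrow> F \<subseteq> J \<Longrightarrow> (\<Sum>j\<in>F. (cmod (a j))\<^sup>2) \<le> K"
  shows "\<exists>v\<in>L2 T. \<forall>j\<in>J. L2_inner T (f j) v = a j"
proof -
  \<comment> \<open>\<open>V\<close> is the graph of the functional. Carrying the value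
    \<open>r\<close> along with \<open>p\<close> spares a proof that \<open>r\<close> depends on
    \<open>p\<close> only.\<close>
  define V where "V = {(p, r). \<exists>F c. finite F \<and> F \<subseteq> J \<and>
      p = (\<lambda>t. \<Sum>j\<in>F. c j * f j t) \<and> r = (\<Sum>j\<in>F. c j * a j)}"
  have V_L2: "p \<in> L2 T" if "(p, r) \<in> V" for p r
    using that f unfolding V_def by (auto intro!: L2_sum)
  have V_comb: "((\<lambda>t. \<alpha> * p t + \<beta> * q t), \<alpha> * r + \<beta> * s) \<in> V"
    if pr: "(p, r) \<in> V" and qs: "(q, s) \<in> V" for p q r s \<alpha> \<beta>
  proof -
    obtain F c where F: "finite F" "F \<subseteq> J" "p = (\<lambda>t. \<Sum>j\<in>F. c j * f j t)" "r = (\<Sum>j\<in>F. c j * a j)"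
      using pr unfolding V_def by blast
    obtain G d where G: "finite G" "G \<subseteq> J" "q = (\<lambda>t. \<Sum>j\<in>G. d j * f j t)" "s = (\<Sum>j\<in>G. d j * a j)"
      using qs unfolding V_def by blast
    \<comment> \<open>Both coefficient families are extended by zero to the union of their index
      sets.\<close>
    define e where "e j = \<alpha> * (if j \<in> F then c j else 0) + \<beta> * (if j \<in> G then d j else 0)" for j
    have *: "\<alpha> * (\<Sum>j\<in>F. c j * x j) + \<beta> * (\<Sum>j\<in>G. d j * x j) = (\<Sum>j\<in>F \<union> G. e j * x j)" for x
    proof -
      have "(\<Sum>j\<in>F. c j * x j) = (\<Sum>j\<in>F \<union> G. (if j \<in> F then c j else 0) * x j)"
        using F(1) G(1) by (intro sum.mono_neutral_cong_left) auto
      moreover have "(\<Sum>j\<in>G. d j * x j) = (\<Sum>j\<in>F \<union> G. (if j \<in> G then d j else 0) * x j)"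
        using F(1) G(1) by (intro sum.mono_neutral_cong_left) auto
      ultimately show ?thesis
        by (simp add: e_def sum_distrib_left sum.distrib distrib_right mult.assoc)
    qed
    show ?thesis unfolding V_def
      using F(1,2) G(1,2) by (auto simp: F(3,4) G(3,4) * intro!: exI[of _ "F \<union> G"] exI[of _ e])
  qed
  define \<Phi> where "\<Phi> x = L2_sq T (fst x) - 2 * Re (snd x)" for x :: "(real \<Rightarrow> complex) \<times> complex"
  have K: "K \<ge> 0" using a[of "{}"] by simp
  have low\<Phi>: "- (K / L) \<le> \<Phi> x" if x: "x \<in> V" for x
  proof -
    obtain F c where F: "finite F" "F \<subseteq> J" "fst x = (\<lambda>t. \<Sum>j\<in>F. c j * f j t)" "snd x = (\<Sum>j\<in>F. c j * a j)"
      using x unfolding V_def by auto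
    have "(cmod (snd x))\<^sup>2 \<le> (\<Sum>j\<in>F. cmod (c j) * cmod (a j))\<^sup>2"
      unfolding F(4) by (intro power_mono order_trans[OF norm_sum]) (auto simp: norm_mult)
    also have "\<dots> \<le> (\<Sum>j\<in>F. (cmod (c j))\<^sup>2) * (\<Sum>j\<in>F. (cmod (a j))\<^sup>2)"
      by (rule Cauchy_Schwarz_ineq_sum)
    also have "\<dots> \<le> (L2_sq T (fst x) / L) * K"
      using low[OF F(1,2), of c] a[OF F(1,2)] L
      by (intro mult_mono) (auto simp: F(3) field_simps L2_sq_nonneg sum_nonneg)
    finally have *: "(cmod (snd x))\<^sup>2 \<le> L2_sq T (fst x) * (K / L)" by (simp add: field_simps)
    \<comment> \<open>The inequality 4xy <= (x + y)^2 converts the product bound into one that is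
      linear in \<open>L2_sq\<close>, which bounds \<open>\<Phi>\<close> from below.\<close>
    have "(2 * cmod (snd x))\<^sup>2 \<le> 4 * (L2_sq T (fst x) * (K / L))" using * by (simp add: power_mult_distrib)
    also have "4 * (x * y) \<le> (x + y)\<^sup>2" for x y :: real
      using sum_squares_bound[of x y] by (simp add: power2_sum)
    finally have "2 * cmod (snd x) \<le> L2_sq T (fst x) + K / L"
      by (rule power2_le_imp_le) (use K L L2_sq_nonneg in auto)
    then show ?thesis using complex_Re_le_cmod[of "snd x"] by (simp add: \<Phi>_def)
  qed
  obtain p where p: "\<And>n. p n \<in> V" "\<And>n y. y \<in> V \<Longrightarrow> \<Phi> (p n) \<le> \<Phi> y + (1/4)^n"
    "\<And>m n. L2_sq T (\<lambda>t. fst (p m) t - fst (p n) t) \<le> 2 * (1/4)^m + 2 * (1/4)^n"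
  proof (rule minimizing_sequence[of V "- (K / L)" \<Phi> "\<lambda>x y. L2_sq T (\<lambda>t. fst x t - fst y t)"])
    have "((\<lambda>t. 0), 0) \<in> V" unfolding V_def by (auto intro!: exI[of _ "{}"])
    then show "V \<noteq> {}" by blast
    fix x y assume xy: "x \<in> V" "y \<in> V"
    obtain p r q s where eq: "x = (p, r)" "y = (q, s)" by (cases x, cases y) auto
    let ?m = "((\<lambda>t. of_real (1/2) * p t + of_real (1/2) * q t), of_real (1/2) * r + of_real (1/2) * s)"
    have pq: "p \<in> L2 T" "q \<in> L2 T" using V_L2 xy eq by auto
    have "L2_sq T (\<lambda>t. p t - q t) = 2 * \<Phi> x + 2 * \<Phi> y - 4 * \<Phi> ?m"
      using L2_sq_lincomb[OF pq, of 1 "-1"] L2_sq_lincomb[OF pq, of "1/2" "1/2"]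
      by (simp add: \<Phi>_def eq power2_eq_square)
    moreover have "?m \<in> V" using V_comb xy eq by blast
    ultimately show "\<exists>m\<in>V. L2_sq T (\<lambda>t. fst x t - fst y t) = 2 * \<Phi> x + 2 * \<Phi> y - 4 * \<Phi> m"
      unfolding eq fst_conv by blast
  qed (use low\<Phi> in auto)
  have pL2: "fst (p n) \<in> L2 T" for n using V_L2 p(1)[of n] by (metis prod.collapse)
  have "\<exists>v\<in>L2 T. (\<lambda>n. L2_sq T (\<lambda>t. v t - fst (p n) t)) \<longlonglongrightarrow> 0"
  proof (rule L2_complete[OF pL2])
    \<comment> \<open>The two error terms add up to 5/2 times \<open>(1/4)^n\<close>; 4 is a rounded
      constant.\<close>
    show "L2_sq T (\<lambda>t. fst (p (Suc n)) t - fst (p n) t) \<le> 4 * (1/4)^n" for n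
      using p(3)[of "Suc n" n] by (rule order_trans) auto
  qed
  then obtain v where v: "v \<in> L2 T" "(\<lambda>n. L2_sq T (\<lambda>t. v t - fst (p n) t)) \<longlonglongrightarrow> 0" by blast
  have key: "Re (L2_inner T v q) = Re s" if qs: "(q, s) \<in> V" for q s
  proof -
    have qL2: "q \<in> L2 T" using V_L2 qs by blast
    \<comment> \<open>Moving \<open>p n\<close> in the direction \<open>(q, s)\<close> stays in
      \<open>V\<close>, so near-minimality bounds the defect of the desired equation for this
      pair.\<close>
    have 1: "(Re (L2_inner T (fst (p n)) q) - Re s)\<^sup>2 \<le> (1/4)^n * L2_sq T q" for n
    proof (rule quadratic_nonneg_bound)
      fix t :: real
      have "\<Phi> (p n) \<le> \<Phi> ((\<lambda>\<tau>. of_real 1 * fst (p n) \<tau> + of_real t * q \<tau>), of_real 1 * snd (p n) + of_real t * s) + (1/4)^n"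
        using p(1)[of n] by (intro p(2) V_comb qs) auto
      then show "0 \<le> (1/4)^n + 2 * t * (Re (L2_inner T (fst (p n)) q) - Re s) + t\<^sup>2 * L2_sq T q"
        unfolding \<Phi>_def fst_conv snd_conv L2_sq_lincomb[OF pL2 qL2] by (simp add: algebra_simps)
    qed (rule L2_sq_nonneg)
    have "(\<lambda>n. (1/4)^n * L2_sq T q) \<longlonglongrightarrow> 0"
      by (intro tendsto_mult_left_zero LIMSEQ_realpow_zero) auto
    then have "(\<lambda>n. (Re (L2_inner T (fst (p n)) q) - Re s)\<^sup>2) \<longlonglongrightarrow> 0"
      by (rule tendsto_sandwich[rotated 3]) (use 1 in auto)
    then have "(\<lambda>n. Re (L2_inner T (fst (p n)) q) - Re s) \<longlonglongrightarrow> 0"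
      by (simp add: power_tendsto_0_iff)
    moreover have "(\<lambda>n. Re (L2_inner T (\<lambda>t. v t - fst (p n) t) q)) \<longlonglongrightarrow> 0"
    proof -
      have "(\<lambda>n. sqrt (L2_sq T (\<lambda>t. v t - fst (p n) t) * L2_sq T q)) \<longlonglongrightarrow> sqrt (0 * L2_sq T q)"
        by (intro tendsto_intros v)
      then have "(\<lambda>n. sqrt (L2_sq T (\<lambda>t. v t - fst (p n) t) * L2_sq T q)) \<longlonglongrightarrow> 0" by simp
      then show ?thesis
      proof (rule Lim_null_comparison[rotated], intro always_eventually allI)
        fix n
        have "cmod (L2_inner T (\<lambda>t. v t - fst (p n) t) q) \<le> sqrt (L2_sq T (\<lambda>t. v t - fst (p n) t) * L2_sq T q)"
          using L2_Cauchy_Schwarz[OF L2_diff[OF v(1) pL2] qL2] by (rule real_le_rsqrt)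
        then show "norm (Re (L2_inner T (\<lambda>t. v t - fst (p n) t) q)) \<le> sqrt (L2_sq T (\<lambda>t. v t - fst (p n) t) * L2_sq T q)"
          using abs_Re_le_cmod order_trans by fastforce
      qed
    qed
    ultimately have "(\<lambda>n. (Re (L2_inner T (fst (p n)) q) - Re s) + Re (L2_inner T (\<lambda>t. v t - fst (p n) t) q)) \<longlonglongrightarrow> 0 + 0"
      by (rule tendsto_add)
    moreover have "(Re (L2_inner T (fst (p n)) q) - Re s) + Re (L2_inner T (\<lambda>t. v t - fst (p n) t) q)
        = Re (L2_inner T v q) - Re s" for n
      using L2_inner_add_left[OF L2_diff[OF v(1) pL2[of n]] pL2[of n] qL2] by simp
    ultimately show ?thesis by (simp add: LIMSEQ_const_iff)
  qed
  have "L2_inner T (f j) v = a j" if j: "j \<in> J" for j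
  proof -
    \<comment> \<open>Only real parts are known so far. \<open>V\<close> contains all complex
      multiples, and \<open>c = 1\<close> and \<open>c = \<i>\<close> recover the full
      equation.\<close>
    have 1: "((\<lambda>t. c * f j t), c * a j) \<in> V" for c
      unfolding V_def using j by (auto intro!: exI[of _ "{j}"] exI[of _ "\<lambda>_. c"])
    have 2: "Re (c * L2_inner T (f j) v) = Re (c * a j)" for c
      using key[OF 1[of c]] by (subst (asm) L2_inner_commute) (simp add: L2_inner_scale_left)
    show ?thesis using 2[of 1] 2[of \<i>] by (simp add: complex_eq_iff)
  qed
  with v(1) show ?thesis by blast
qed

text \<open>If \<open>G\<close> is a Gram matrix of vectors, this is the inner product of their
  combinations with coefficients \<open>d\<close> and \<open>e\<close>; hence \<open>e\<close> is
  conjugated and \<open>d\<close> multiplies \<open>G\<close> from the left.\<close>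

definition sesq :: "'i set \<Rightarrow> ('i \<Rightarrow> 'i \<Rightarrow> complex) \<Rightarrow> ('i \<Rightarrow> complex) \<Rightarrow> ('i \<Rightarrow> complex) \<Rightarrow> complex"
  where "sesq F G d e = (\<Sum>i\<in>F. \<Sum>j\<in>F. d i * cnj (e j) * G i j)"

lemma sesq_commute:
  assumes "\<And>i j. G j i = cnj (G i j)"
  shows "sesq F G e d = cnj (sesq F G d e)"
proof -
  have "e i * cnj (d j) * G i j = cnj (d j * cnj (e i) * G j i)" for i j
    using assms[of i j] by simp
  then show ?thesis
    unfolding sesq_def by (subst sum.swap) (simp only: cnj_sum)
qed

lemma sesq_add_scale:
  assumes herm: "\<And>i j. G j i = cnj (G i j)"
  shows "Re (sesq F G (\<lambda>i. d i + of_real t * e i) (\<lambda>i. d i + of_real t * e i))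
    = Re (sesq F G d d) + 2 * t * Re (sesq F G d e) + t\<^sup>2 * Re (sesq F G e e)"
proof -
  have "sesq F G (\<lambda>i. d i + of_real t * e i) (\<lambda>i. d i + of_real t * e i)
    = sesq F G d d + of_real t * sesq F G d e + of_real t * sesq F G e d + of_real (t\<^sup>2) * sesq F G e e"
    unfolding sesq_def
    by (simp add: sum.distrib sum_distrib_left algebra_simps power2_eq_square)
  moreover have "Re (sesq F G e d) = Re (sesq F G d e)" using sesq_commute[of G F e d, OF herm] by simp
  ultimately show ?thesis by simp
qed

text \<open>Vectors of length \<open>n\<close> are encoded as functions on all naturals that vanish
  from \<open>n\<close> on. In the product topology Tychonoff's theorem makes the box compact, and
  the unit sphere is a closed part of it.\<close>

lemma compact_box: "compact {d :: nat \<Rightarrow> complex. \<forall>i. d i \<in> (if i < n then cball 0 1 else {0})}"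
proof -
  let ?S = "\<lambda>i. if i < n then cball 0 1 else {0} :: complex set"
  have "compactin (product_topology (\<lambda>i. euclidean) UNIV) (PiE UNIV ?S)"
    unfolding compactin_PiE by simp
  then have "compact (PiE UNIV ?S)"
    by (simp add: euclidean_product_topology)
  moreover have "PiE UNIV ?S = {d. \<forall>i. d i \<in> ?S i}" by (auto simp: PiE_def Pi_def)
  ultimately show ?thesis by simp
qed

text \<open>Rayleigh principle: compactness gives a minimizer \<open>d\<close> on the unit sphere,
  with minimum \<open>L\<close>, and stationarity makes \<open>d\<close> an eigenvector. It is a
  left eigenvector because \<open>d\<close> is the linear argument of \<open>sesq\<close>.\<close>

lemma hermitian_form_minimum:
  fixes G :: "nat \<Rightarrow> nat \<Rightarrow> complex"
  assumes herm: "\<And>i j. G j i = cnj (G i j)" and n: "n > 0"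
  obtains L d where "\<And>e. L * (\<Sum>i<n. (cmod (e i))\<^sup>2) \<le> Re (sesq {..<n} G e e)"
    and "\<And>j. j < n \<Longrightarrow> (\<Sum>i<n. d i * G i j) = of_real L * d j" and "(\<Sum>i<n. (cmod (d i))\<^sup>2) = 1"
proof -
  define q where "q d = Re (sesq {..<n} G d d)" for d
  define N where "N d = (\<Sum>i<n. (cmod (d i))\<^sup>2)" for d :: "nat \<Rightarrow> complex"
  define Sp where "Sp = {d. \<forall>i. d i \<in> (if i < n then cball 0 1 else {0})} \<inter> {d. N d = 1}"
  have cont: "continuous_on UNIV q" "continuous_on UNIV N"
    unfolding q_def[abs_def] N_def[abs_def] sesq_def
    by (intro continuous_intros continuous_on_product_coordinates)+
  have "compact Sp" unfolding Sp_def
    by (intro compact_Int_closed compact_box closed_Collect_eq cont continuous_intros)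
  moreover have "Sp \<noteq> {}"
  proof -
    have "N (\<lambda>i. if i = 0 then 1 else 0) = (\<Sum>i<n. if i = 0 then 1 else 0)"
      unfolding N_def by (intro sum.cong) auto
    then have "(\<lambda>i. if i = 0 then 1 else 0) \<in> Sp" using n by (auto simp: Sp_def)
    then show ?thesis by blast
  qed
  ultimately obtain d where d: "d \<in> Sp" "\<And>e. e \<in> Sp \<Longrightarrow> q d \<le> q e"
    using continuous_attains_inf[of Sp q] continuous_on_subset[OF cont(1) subset_UNIV] by blast
  define L where "L = q d"
  have low: "L * N e \<le> q e" for e
  proof (cases "N e = 0")
    case True
    then have "\<forall>i<n. e i = 0" by (simp add: N_def sum_nonneg_eq_0_iff)
    then have "q e = 0" by (simp add: q_def sesq_def)
    then show ?thesis using True by simp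
  next
    case False
    then have pos: "N e > 0" using sum_nonneg[of "{..<n}" "\<lambda>i. (cmod (e i))\<^sup>2"] by (auto simp: N_def)
    define e' where "e' i = (if i < n then e i / of_real (sqrt (N e)) else 0)" for i
    have "N e' = (\<Sum>i<n. (cmod (e i))\<^sup>2 / N e)"
      unfolding N_def[of e'] using pos by (intro sum.cong) (auto simp: e'_def norm_divide power_divide)
    also have "\<dots> = 1" using False by (simp add: N_def flip: sum_divide_distrib)
    finally have N1: "N e' = 1" .
    have "cmod (e' i) \<le> 1" if "i < n" for i
    proof -
      have "(cmod (e' i))\<^sup>2 \<le> N e'" unfolding N_def using that by (intro member_le_sum) auto
      then show ?thesis using N1 by (simp add: abs_square_le_1)
    qed
    then have "e' \<in> Sp" using N1 by (auto simp: Sp_def e'_def)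
    then have "L \<le> q e'" using d(2) by (simp add: L_def)
    also have "q e' = q e / N e"
    proof -
      have "sesq {..<n} G e' e' = (\<Sum>i<n. \<Sum>j<n. (e i * cnj (e j) * G i j) / of_real (N e))"
        unfolding sesq_def using pos
        by (intro sum.cong) (auto simp: e'_def simp flip: of_real_mult)
      also have "\<dots> = sesq {..<n} G e e / of_real (N e)"
        by (simp add: sesq_def sum_divide_distrib)
      finally show ?thesis by (simp add: q_def)
    qed
    finally show ?thesis using pos by (simp add: field_simps)
  qed
  have Nd: "N d = 1" using d(1) by (simp add: Sp_def)
  \<comment> \<open>Subtracting \<open>L\<close> times the identity leaves a nonnegative form with
    value 0 at \<open>d\<close>; a discriminant bound with zero error then kills the mixed term in
    every direction.\<close>
  define G' where "G' i j = G i j - (if i = j then of_real L else 0)" for i j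
  have herm': "G' j i = cnj (G' i j)" for i j using herm[of j i] by (simp add: G'_def)
  have sq: "Re (sesq {..<n} G' e e) = q e - L * N e" for e
  proof -
    have "sesq {..<n} G' e e = sesq {..<n} G e e - (\<Sum>i<n. \<Sum>j<n. if i = j then e i * cnj (e j) * of_real L else 0)"
      unfolding sesq_def G'_def sum_subtractf[symmetric] by (intro sum.cong refl) (auto simp: algebra_simps)
    also have "(\<Sum>i<n. \<Sum>j<n. if i = j then e i * cnj (e j) * of_real L else 0) = of_real (L * N e)"
      by (simp add: N_def complex_norm_square sum_distrib_left mult.commute del: of_real_power)
    finally show ?thesis by (simp add: q_def)
  qed
  have "(\<Sum>i<n. d i * G i k) = of_real L * d k" if k: "k < n" for k
  proof -
    have "Re (cnj w * (\<Sum>i<n. d i * G' i k)) = 0" for w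
    proof -
      \<comment> \<open>Multiples of a unit vector isolate the \<open>k\<close>-th coordinate of the
        eigenvector equation.\<close>
      define e where "e i = (if i = k then w else 0)" for i
      have "(Re (sesq {..<n} G' d e))\<^sup>2 \<le> 0 * Re (sesq {..<n} G' e e)"
      proof (rule quadratic_nonneg_bound)
        show "0 \<le> 0 + 2 * t * Re (sesq {..<n} G' d e) + t\<^sup>2 * Re (sesq {..<n} G' e e)" for t
          using low[of "\<lambda>i. d i + of_real t * e i"] sesq_add_scale[of G' "{..<n}" d t e, OF herm']
          by (simp add: sq[of d] sq[of "\<lambda>i. d i + of_real t * e i"] Nd L_def)
        show "0 \<le> Re (sesq {..<n} G' e e)" using low[of e] sq[of e] by simp
      qed
      moreover have "sesq {..<n} G' d e = cnj w * (\<Sum>i<n. d i * G' i k)"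
      proof -
        have "sesq {..<n} G' d e = (\<Sum>i<n. \<Sum>j<n. if j = k then d i * cnj w * G' i j else 0)"
          unfolding sesq_def e_def by (intro sum.cong) auto
        also have "\<dots> = (\<Sum>i<n. d i * cnj w * G' i k)" using k by simp
        finally show ?thesis by (simp add: sum_distrib_left mult_ac)
      qed
      ultimately show ?thesis by simp
    qed
    from this[of 1] this[of \<i>] have "(\<Sum>i<n. d i * G' i k) = 0" by (simp add: complex_eq_iff)
    moreover have "(\<Sum>i<n. d i * G' i k) = (\<Sum>i<n. d i * G i k) - (\<Sum>i<n. if i = k then d i * of_real L else 0)"
      unfolding G'_def sum_subtractf[symmetric] by (intro sum.cong refl) (auto simp: algebra_simps)
    ultimately show ?thesis using k by simp
  qed
  then show thesis using that[of L d] low Nd by (simp add: q_def N_def)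
qed

text \<open>The minimum \<open>L\<close> of the form on the unit sphere is an eigenvalue, and every
  real eigenvalue is a value of the Rayleigh quotient, so \<open>L\<close> is the smallest.
  \<open>n > 0\<close> ensures that an eigenvalue exists.\<close>

lemma smallest_eigenvalue_hermitian:
  fixes G :: "nat \<Rightarrow> nat \<Rightarrow> complex"
  assumes herm: "\<And>i j. G j i = cnj (G i j)" and n: "n > 0"
  defines "M \<equiv> mat n n (\<lambda>(i, j). G i j)"
  shows "(\<forall>e. m * (\<Sum>i<n. (cmod (e i))\<^sup>2) \<le> Re (sesq {..<n} G e e)) \<longleftrightarrow> m \<le> smallest_eigenvalue M"
proof -
  obtain L d where low: "\<And>e. L * (\<Sum>i<n. (cmod (e i))\<^sup>2) \<le> Re (sesq {..<n} G e e)"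
    and eig: "\<And>j. j < n \<Longrightarrow> (\<Sum>i<n. d i * G i j) = of_real L * d j" and d1: "(\<Sum>i<n. (cmod (d i))\<^sup>2) = 1"
    by (rule hermitian_form_minimum[of G n, OF herm n]) (rule that)
  have M: "M \<in> carrier_mat n n" by (simp add: M_def)
  have mult: "(M *\<^sub>v v) $ i = (\<Sum>j<n. G i j * v $ j)" if "v \<in> carrier_vec n" "i < n" for v i
    using that by (simp add: M_def scalar_prod_def lessThan_atLeast0)
  have eL: "eigenvalue M (of_real L)"
  proof -
    \<comment> \<open>Since \<open>G\<close> is Hermitian and \<open>L\<close> is real, conjugation
      turns the left eigenvector into a right one.\<close>
    define v where "v = vec n (\<lambda>i. cnj (d i))"
    have "M *\<^sub>v v = of_real L \<cdot>\<^sub>v v"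
    proof (rule eq_vecI)
      fix i assume "i < dim_vec (of_real L \<cdot>\<^sub>v v)"
      then have i: "i < n" by (simp add: v_def)
      have "(M *\<^sub>v v) $ i = (\<Sum>j<n. G i j * cnj (d j))"
        using i by (subst mult) (auto simp: v_def)
      also have "\<dots> = cnj (\<Sum>j<n. d j * G j i)"
        by (simp add: herm[of i, symmetric] mult.commute)
      also have "\<dots> = of_real L * cnj (d i)" by (simp add: eig i)
      finally show "(M *\<^sub>v v) $ i = (of_real L \<cdot>\<^sub>v v) $ i" using i by (simp add: v_def)
    qed (simp add: M_def v_def)
    moreover have "v \<noteq> 0\<^sub>v n"
    proof
      assume "v = 0\<^sub>v n"
      then have "d i = 0" if "i < n" for i
        using that by (metis complex_cnj_zero_iff index_vec index_zero_vec(1) v_def)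
      then show False using d1 by simp
    qed
    ultimately show ?thesis using M unfolding eigenvalue_def eigenvector_def
      by (intro exI[of _ v]) (auto simp: v_def)
  qed
  have least: "r \<ge> L" if r: "eigenvalue M (of_real r)" for r
  proof -
    obtain v where v: "v \<in> carrier_vec n" "v \<noteq> 0\<^sub>v n" "M *\<^sub>v v = of_real r \<cdot>\<^sub>v v"
      using r M unfolding eigenvalue_def eigenvector_def by auto
    define e where "e i = cnj (v $ i)" for i
    have "sesq {..<n} G e e = (\<Sum>i<n. e i * (\<Sum>j<n. G i j * v $ j))"
      by (simp add: sesq_def e_def sum_distrib_left mult_ac)
    also have "\<dots> = (\<Sum>i<n. e i * (of_real r * v $ i))"
    proof (intro sum.cong refl)
      fix i assume "i \<in> {..<n}"
      then show "e i * (\<Sum>j<n. G i j * v $ j) = e i * (of_real r * v $ i)"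
        using mult[OF v(1), of i] v by simp
    qed
    also have "\<dots> = of_real (r * (\<Sum>i<n. (cmod (e i))\<^sup>2))"
      by (simp add: e_def complex_norm_square sum_distrib_left mult_ac del: of_real_power)
    finally have "L * (\<Sum>i<n. (cmod (e i))\<^sup>2) \<le> r * (\<Sum>i<n. (cmod (e i))\<^sup>2)" using low[of e] by simp
    moreover have "(\<Sum>i<n. (cmod (e i))\<^sup>2) > 0"
    proof -
      obtain i where "i < n" "v $ i \<noteq> 0" using v(1,2) by (metis carrier_vecD eq_vecI index_zero_vec)
      then show ?thesis by (intro sum_pos2[of _ i]) (auto simp: e_def)
    qed
    ultimately show ?thesis by simp
  qed
  \<comment> \<open>\<open>Min\<close> is meaningful for finite sets only; the eigenvalues are roots
    of the nonzero characteristic polynomial.\<close>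
  have "finite {r. eigenvalue M (of_real r)}"
  proof -
    have "{r. eigenvalue M (of_real r)} \<subseteq> of_real -` {k. poly (char_poly M) k = 0}"
      using eigenvalue_root_char_poly[OF M] by auto
    moreover have "char_poly M \<noteq> 0" using degree_monic_char_poly[OF M] by auto
    moreover have "inj (of_real :: real \<Rightarrow> complex)" by (simp add: inj_on_def)
    ultimately show ?thesis
      using finite_subset[OF _ finite_vimageI[OF poly_roots_finite]] by blast
  qed
  then have "smallest_eigenvalue M = L"
    unfolding smallest_eigenvalue_def using least eL by (intro Min_eqI) auto
  moreover have "m \<le> L" if "\<forall>e. m * (\<Sum>i<n. (cmod (e i))\<^sup>2) \<le> Re (sesq {..<n} G e e)"
  proof -
    have "sesq {..<n} G d d = (\<Sum>j<n. cnj (d j) * (\<Sum>i<n. d i * G i j))"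
      unfolding sesq_def by (subst sum.swap) (simp add: sum_distrib_left mult_ac)
    also have "\<dots> = (\<Sum>j<n. cnj (d j) * (of_real L * d j))" by (intro sum.cong) (simp_all add: eig)
    also have "\<dots> = of_real (L * (\<Sum>i<n. (cmod (d i))\<^sup>2))"
      by (simp add: complex_norm_square sum_distrib_left mult_ac del: of_real_power)
    finally show ?thesis using that[rule_format, of d] d1 by simp
  qed
  moreover have "\<forall>e. m * (\<Sum>i<n. (cmod (e i))\<^sup>2) \<le> Re (sesq {..<n} G e e)" if "m \<le> L"
    by (intro allI order_trans[OF mult_right_mono[OF that] low] sum_nonneg) simp
  ultimately show ?thesis by auto
qed

text \<open>For a Gram matrix this is the lower Riesz inequality with constant \<open>m\<close> for
  the vectors indexed by \<open>E\<close>.\<close>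

definition form_ge :: "('i \<Rightarrow> 'i \<Rightarrow> complex) \<Rightarrow> real \<Rightarrow> 'i set \<Rightarrow> bool"
  where "form_ge G m E \<longleftrightarrow> (\<forall>c. m * (\<Sum>j\<in>E. (cmod (c j))\<^sup>2) \<le> Re (sesq E G c c))"

text \<open>Passes between positions in the enumeration of \<open>J\<close>, which index the Gram
  matrix, and the indices themselves.\<close>

lemma form_ge_bij_betw:
  fixes e :: "'a \<Rightarrow> 'b" and G :: "'b \<Rightarrow> 'b \<Rightarrow> complex"
  assumes "bij_betw e N E"
  shows "form_ge (\<lambda>i j. G (e i) (e j)) m N \<longleftrightarrow> form_ge G m E"
proof -
  have *: "m * (\<Sum>i\<in>N. (cmod (c (e i)))\<^sup>2) \<le> Re (sesq N (\<lambda>i j. G (e i) (e j)) (\<lambda>i. c (e i)) (\<lambda>i. c (e i)))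
      \<longleftrightarrow> m * (\<Sum>j\<in>E. (cmod (c j))\<^sup>2) \<le> Re (sesq E G c c)" for c :: "'b \<Rightarrow> complex"
    unfolding sesq_def
    by (simp add: sum.reindex_bij_betw[OF assms, of "\<lambda>j. (cmod (c j))\<^sup>2"]
        sum.reindex_bij_betw[OF assms, of "\<lambda>j. c (e i) * cnj (c j) * G (e i) j" for i]
        sum.reindex_bij_betw[OF assms, of "\<lambda>i. \<Sum>j\<in>E. c i * cnj (c j) * G i j"])
  show ?thesis
  proof
    assume l: "form_ge (\<lambda>i j. G (e i) (e j)) m N"
    show "form_ge G m E"
      unfolding form_ge_def using l *[of c for c] by (auto simp: form_ge_def)
  next
    assume r: "form_ge G m E"
    show "form_ge (\<lambda>i j. G (e i) (e j)) m N"
      unfolding form_ge_def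
    proof
      fix d :: "'a \<Rightarrow> complex"
      define c where "c = d \<circ> inv_into N e"
      have "c (e i) = d i" if "i \<in> N" for i
        using assms that by (simp add: c_def bij_betw_inv_into_left)
      then have "(\<Sum>i\<in>N. (cmod (c (e i)))\<^sup>2) = (\<Sum>i\<in>N. (cmod (d i))\<^sup>2)"
        "sesq N (\<lambda>i j. G (e i) (e j)) (\<lambda>i. c (e i)) (\<lambda>i. c (e i)) = sesq N (\<lambda>i j. G (e i) (e j)) d d"
        by (simp_all add: sesq_def)
      then show "m * (\<Sum>j\<in>N. (cmod (d j))\<^sup>2) \<le> Re (sesq N (\<lambda>i j. G (e i) (e j)) d d)"
        using *[of c] r by (auto simp: form_ge_def)
    qed
  qed
qed

text \<open>Coefficients are extended by zero. This is why smallest eigenvalues of nested Gram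
  matrices can only decrease.\<close>

lemma form_ge_subset:
  fixes G :: "'i \<Rightarrow> 'i \<Rightarrow> complex"
  assumes "finite E" "F \<subseteq> E" "form_ge G m E"
  shows "form_ge G m F"
  unfolding form_ge_def
proof
  fix c :: "'i \<Rightarrow> complex"
  define d where "d j = (if j \<in> F then c j else 0)" for j
  have "(\<Sum>j\<in>F. (cmod (c j))\<^sup>2) = (\<Sum>j\<in>E. (cmod (d j))\<^sup>2)"
    using assms(1,2) by (intro sum.mono_neutral_cong_left) (auto simp: d_def)
  moreover have "sesq F G c c = sesq E G d d"
  proof -
    have "(\<Sum>j\<in>F. c i * cnj (c j) * G i j) = (\<Sum>j\<in>E. d i * cnj (d j) * G i j)" if "i \<in> F" for i
      using assms(1,2) that by (intro sum.mono_neutral_cong_left) (auto simp: d_def)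
    then show ?thesis
      unfolding sesq_def using assms(1,2) by (intro sum.mono_neutral_cong_left) (auto simp: d_def)
  qed
  ultimately show "m * (\<Sum>j\<in>F. (cmod (c j))\<^sup>2) \<le> Re (sesq F G c c)"
    using assms(3) by (simp add: form_ge_def)
qed

text \<open>The smallest eigenvalues of growing Gram matrices decrease, so their limit is positive
  exactly when one positive constant bounds them all from below; and each finite subset of
  \<open>J\<close> lies in an initial segment of the enumeration. For finite \<open>J\<close> the
  last matrix decides.\<close>

theorem strongly_minimal_iff:
  fixes ip :: "'a \<Rightarrow> 'a \<Rightarrow> complex"
  assumes herm: "\<And>x y. ip y x = cnj (ip x y)" and "J \<noteq> {}"
  shows "strongly_minimal ip J f \<longleftrightarrow>
    (\<exists>L>0. \<forall>F. finite F \<longrightarrow> F \<subseteq> J \<longrightarrow> form_ge (\<lambda>i j. ip (f i) (f j)) L F)"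
proof -
  define G where "G i j = ip (f i) (f j)" for i j
  define e where "e = enumerate J"
  define g where "g n = smallest_eigenvalue (gram_matrix ip (\<lambda>i. f (e i)) n)" for n
  have g: "form_ge G m E \<longleftrightarrow> m \<le> g n" if "n > 0" "bij_betw e {..<n} E" for n m E
  proof -
    have "form_ge G m E \<longleftrightarrow> form_ge (\<lambda>i j. G (e i) (e j)) m {..<n}"
      by (rule form_ge_bij_betw[OF that(2), of G m, symmetric])
    also have "\<dots> \<longleftrightarrow> m \<le> g n"
      unfolding form_ge_def g_def gram_matrix_def G_def
      by (rule smallest_eigenvalue_hermitian[OF herm \<open>n > 0\<close>])
    finally show ?thesis .
  qed
  show ?thesis
  proof (cases "finite J")
    case True
    have bij: "bij_betw e {..<card J} J"
      unfolding e_def using finite_bij_enumerate[OF True] .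
    have card: "card J > 0" using True assms(2) by (simp add: card_gt_0_iff)
    have "strongly_minimal ip J f \<longleftrightarrow> g (card J) > 0"
      using True by (simp add: strongly_minimal_def g_def e_def)
    also have "\<dots> \<longleftrightarrow> (\<exists>L>0. form_ge G L J)" using g[OF card bij] by (meson order_refl less_le_trans)
    also have "\<dots> \<longleftrightarrow> (\<exists>L>0. \<forall>F. finite F \<longrightarrow> F \<subseteq> J \<longrightarrow> form_ge G L F)"
      using True form_ge_subset by (metis order_refl)
    finally show ?thesis by (simp add: G_def[abs_def])
  next
    case False
    have inj: "inj e" using strict_mono_enumerate[OF False] strict_mono_imp_inj_on by (auto simp: e_def)
    have bij: "bij_betw e {..<n} (e ` {..<n})" for n using inj_on_subset[OF inj] by (simp add: bij_betw_def)
    have range: "range e = J" unfolding e_def using range_enumerate[OF False] .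
    \<comment> \<open>The shift by one avoids the 0 by 0 matrix, which has no eigenvalue; limits are
      unaffected.\<close>
    have g': "form_ge G m (e ` {..<Suc n}) \<longleftrightarrow> m \<le> g (Suc n)" for m n
      using g[OF _ bij] by simp
    have all: "(\<forall>F. finite F \<longrightarrow> F \<subseteq> J \<longrightarrow> form_ge G L F) \<longleftrightarrow> (\<forall>n. L \<le> g (Suc n))" for L
    proof
      assume "\<forall>F. finite F \<longrightarrow> F \<subseteq> J \<longrightarrow> form_ge G L F"
      then have "form_ge G L (e ` {..<Suc n})" for n using range by auto
      then show "\<forall>n. L \<le> g (Suc n)" by (simp only: g' simp_thms)
    next
      assume ge: "\<forall>n. L \<le> g (Suc n)"
      show "\<forall>F. finite F \<longrightarrow> F \<subseteq> J \<longrightarrow> form_ge G L F"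
      proof (intro allI impI)
        fix F assume F: "finite F" "F \<subseteq> J"
        then have "F \<subseteq> range e" using range by simp
        from finite_subset_image[OF F(1) this] obtain I where I: "finite I" "F = e ` I" by metis
        then obtain n where "I \<subseteq> {..<n}" using finite_nat_iff_bounded[of I] by auto
        then have "I \<subseteq> {..<Suc n}" by auto
        then have "F \<subseteq> e ` {..<Suc n}" using I(2) by (simp add: image_mono)
        moreover have "form_ge G L (e ` {..<Suc n})" using ge by (simp only: g' simp_thms)
        ultimately show "form_ge G L F" by (rule form_ge_subset[rotated]) simp
      qed
    qed
    have dec: "decseq (\<lambda>n. g (Suc n))"
    proof (rule decseq_SucI)
      fix n
      have "form_ge G (g (Suc (Suc n))) (e ` {..<Suc (Suc n)})" by (simp only: g' order_refl)
      then have "form_ge G (g (Suc (Suc n))) (e ` {..<Suc n})" by (rule form_ge_subset[rotated 2]) auto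
      then show "g (Suc (Suc n)) \<le> g (Suc n)" by (simp only: g')
    qed
    have "strongly_minimal ip J f \<longleftrightarrow> (\<exists>L>0. g \<longlonglongrightarrow> L)"
      using False by (simp add: strongly_minimal_def g_def[abs_def] e_def)
    also have "\<dots> \<longleftrightarrow> (\<exists>L>0. (\<lambda>n. g (Suc n)) \<longlonglongrightarrow> L)" by (simp only: filterlim_sequentially_Suc)
    also have "\<dots> \<longleftrightarrow> (\<exists>L>0. \<forall>n. L \<le> g (Suc n))"
    proof
      assume "\<exists>L>0. (\<lambda>n. g (Suc n)) \<longlonglongrightarrow> L"
      then show "\<exists>L>0. \<forall>n. L \<le> g (Suc n)" using decseq_ge[OF dec] by blast
    next
      assume "\<exists>L>0. \<forall>n. L \<le> g (Suc n)"
      then obtain L where L: "L > 0" "\<forall>n. L \<le> g (Suc n)" by blast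
      obtain L' where "(\<lambda>n. g (Suc n)) \<longlonglongrightarrow> L'" using decseq_convergent[OF dec L(2)] by metis
      moreover from this have "L \<le> L'" using L(2) by (intro LIMSEQ_le_const) auto
      ultimately show "\<exists>L>0. (\<lambda>n. g (Suc n)) \<longlonglongrightarrow> L" using L(1) by (intro exI[of _ L']) auto
    qed
    also have "\<dots> \<longleftrightarrow> (\<exists>L>0. \<forall>F. finite F \<longrightarrow> F \<subseteq> J \<longrightarrow> form_ge G L F)" by (simp only: all)
    finally show ?thesis by (simp add: G_def[abs_def])
  qed
qed

section \<open>Bessel inequality, orthogonality and adjoints\<close>

lemma Bessel_inequality:
  fixes f :: "'i \<Rightarrow> 'a::complex_inner"
  assumes "M \<ge> 0"
    and upper: "\<And>a. (norm (\<Sum>j\<in>F. a j *\<^sub>C f j))\<^sup>2 \<le> M * (\<Sum>j\<in>F. (cmod (a j))\<^sup>2)"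
  shows "(\<Sum>j\<in>F. (cmod (cinner x (f j)))\<^sup>2) \<le> M * (norm x)\<^sup>2"
proof -
  define s where "s = (\<Sum>j\<in>F. (cmod (cinner x (f j)))\<^sup>2)"
  \<comment> \<open>With these coefficients the pairing of \<open>x\<close> and \<open>y\<close> is
    \<open>s\<close> itself, while the upper bound controls \<open>norm y\<close> by
    \<open>s\<close> again; one factor \<open>s\<close> cancels.\<close>
  define y where "y = (\<Sum>j\<in>F. cinner x (f j) *\<^sub>C f j)"
  have "cinner x y = (\<Sum>j\<in>F. cinner x (f j) * cnj (cinner x (f j)))"
    by (simp add: y_def cinner_simps mult.commute)
  also have "\<dots> = of_real s" by (simp add: s_def flip: complex_norm_square)
  finally have "s \<le> norm x * norm y" using cmod_cinner_le[of x y] by simp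
  moreover have s0: "s \<ge> 0" by (simp add: s_def sum_nonneg)
  ultimately have "s\<^sup>2 \<le> (norm x)\<^sup>2 * (norm y)\<^sup>2"
    by (metis power_mono power_mult_distrib)
  also have "\<dots> \<le> (norm x)\<^sup>2 * (M * s)"
    using upper by (intro mult_left_mono) (auto simp: y_def s_def)
  finally have "s * s \<le> (M * (norm x)\<^sup>2) * s" by (simp add: power2_eq_square mult_ac)
  then show ?thesis using s0 \<open>M \<ge> 0\<close> by (cases "s = 0") (auto simp: s_def[symmetric])
qed

lemma orthogonal_to_dense:
  fixes x :: "'a::complex_inner"
  assumes "closure S = UNIV" and "\<And>v. v \<in> S \<Longrightarrow> cinner x v = 0"
  shows "x = 0"
proof -
  have "closed {v. cinner x v = 0}"
    by (intro closed_Collect_eq continuous_on_cinner continuous_intros)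
  then have "closure S \<subseteq> {v. cinner x v = 0}" using assms(2) by (intro closure_minimal) auto
  then have "cinner x x = 0" using assms(1) by auto
  then show ?thesis by (simp add: cinner_self)
qed

lemma orthogonal_to_cspan:
  assumes "\<And>v. v \<in> S \<Longrightarrow> cinner x v = 0" and "v \<in> cspan S"
  shows "cinner x v = 0"
  using assms(2)
  by (induction rule: complex_vector.span_induct_alt) (auto simp: cinner_simps assms(1))

text \<open>\<open>op_adjoint\<close> is a definite description, and density of \<open>D\<close>
  makes the described vector unique.\<close>

lemma op_adjoint_eq:
  assumes dense: "closure D = UNIV" and v: "v \<in> adjoint_domain D A" and x: "x \<in> D"
  shows "cinner (A x) v = cinner x (op_adjoint D A v)"
proof -
  obtain w where w: "\<forall>x\<in>D. cinner (A x) v = cinner x w" using v by (auto simp: adjoint_domain_def)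
  have "\<forall>x\<in>D. cinner (A x) v = cinner x (op_adjoint D A v)"
    unfolding op_adjoint_def
  proof (rule theI[of _ w])
    fix w' assume w': "\<forall>x\<in>D. cinner (A x) v = cinner x w'"
    have "w' - w = 0"
    proof (rule orthogonal_to_dense[OF dense])
      fix x assume "x \<in> D"
      then have "cinner x (w' - w) = 0" using w w' by (simp add: cinner_simps)
      then show "cinner (w' - w) x = 0" using cinner_commute[of "w' - w" x] by simp
    qed
    then show "w' = w" by simp
  qed (rule w)
  then show ?thesis using x by blast
qed

text \<open>The equations for the dual eigenvectors contain the adjoint of the coupling operator.
  Riesz representation shows that it is defined everywhere.\<close>

lemma adjoint_domain_bounded:
  fixes B :: "'a::separable_complex_hilbert \<Rightarrow> 'b::separable_complex_hilbert"
  assumes "bounded_clinear B"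
  shows "v \<in> adjoint_domain UNIV B"
proof -
  have "bounded_clinear (\<lambda>x. cinner (B x) v)"
    using assms unfolding bounded_clinear_def
    by (auto intro: bounded_linear_compose[OF bounded_linear_cinner_left]
        simp: cinner_scaleC_left scaleC_complex_def)
  from Riesz_representation[OF this] show ?thesis by (auto simp: adjoint_domain_def)
qed

text \<open>Uniform boundedness applies to the functionals \<open>y \<mapsto> (\<Sum>j\<in>F. c\<^sub>j (y, g\<^sub>j))\<close> with
  \<open>\<parallel>\<Sum>j\<in>F. c\<^sub>j f\<^sub>j\<parallel> \<le> 1\<close>; testing at \<open>y = (\<Sum>j\<in>F. cnj c\<^sub>j \<phi>\<^sub>j)\<close> bounds \<open>\<Sum>j\<in>F. |c\<^sub>j|\<^sup>2\<close>.\<close>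

lemma moment_solvable_imp_form_ge:
  fixes g \<phi> :: "'i \<Rightarrow> 'y::separable_complex_hilbert"
  assumes f: "\<And>j. j \<in> J \<Longrightarrow> f j \<in> L2 T"
    and solvable: "\<And>y. \<exists>u\<in>L2 T. \<forall>j\<in>J. L2_inner T (f j) u = cinner y (g j)"
    and biorth: "\<And>i j. i \<in> J \<Longrightarrow> j \<in> J \<Longrightarrow> cinner (\<phi> i) (g j) = (if i = j then 1 else 0)"
    and upper: "\<And>F a. finite F \<Longrightarrow> F \<subseteq> J \<Longrightarrow>
      (norm (\<Sum>j\<in>F. a j *\<^sub>C \<phi> j))\<^sup>2 \<le> M * (\<Sum>j\<in>F. (cmod (a j))\<^sup>2)"
  shows "\<exists>L>0. \<forall>F. finite F \<longrightarrow> F \<subseteq> J \<longrightarrow> form_ge (\<lambda>i j. L2_inner T (f i) (f j)) L F"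
proof -
  define I where "I = {(F, c). finite F \<and> F \<subseteq> J \<and> L2_sq T (\<lambda>t. \<Sum>j\<in>F. c j * f j t) \<le> 1}"
  define \<Lambda> where "\<Lambda> = (\<lambda>(F, c) y. \<Sum>j\<in>F. c j * cinner y (g j))"
  have "\<exists>B. \<forall>i\<in>I. \<forall>y. norm (\<Lambda> i y) \<le> B * norm y"
  proof (rule uniform_boundedness)
    show "bounded_linear (\<Lambda> i)" if "i \<in> I" for i
      unfolding \<Lambda>_def
      by (cases i) (auto intro!: bounded_linear_sum bounded_linear_const_mult bounded_linear_cinner_left)
    fix y
    obtain u where u: "u \<in> L2 T" "\<And>j. j \<in> J \<Longrightarrow> L2_inner T (f j) u = cinner y (g j)"
      using solvable by blast
    have "norm (\<Lambda> (F, c) y) \<le> sqrt (L2_sq T u)" if Fc: "(F, c) \<in> I" for F c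
    proof -
      have F: "finite F" "F \<subseteq> J" "L2_sq T (\<lambda>t. \<Sum>j\<in>F. c j * f j t) \<le> 1" using Fc by (auto simp: I_def)
      have fF: "\<And>j. j \<in> F \<Longrightarrow> f j \<in> L2 T" using f F by blast
      have "\<Lambda> (F, c) y = (\<Sum>j\<in>F. c j * L2_inner T (f j) u)"
        unfolding \<Lambda>_def using u(2) F(2) by (auto intro!: sum.cong)
      also have "\<dots> = L2_inner T (\<lambda>t. \<Sum>j\<in>F. c j * f j t) u"
        using fF u(1) by (simp add: L2_inner_sum_left)
      finally have "(norm (\<Lambda> (F, c) y))\<^sup>2 \<le> L2_sq T (\<lambda>t. \<Sum>j\<in>F. c j * f j t) * L2_sq T u"
        using L2_Cauchy_Schwarz[OF L2_sum[of F f T c] u(1)] fF by simp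
      also have "\<dots> \<le> 1 * L2_sq T u" by (intro mult_right_mono F L2_sq_nonneg)
      finally show ?thesis by (intro real_le_rsqrt) simp
    qed
    then show "\<exists>B. \<forall>i\<in>I. norm (\<Lambda> i y) \<le> B" by (intro exI[of _ "sqrt (L2_sq T u)"]) auto
  qed
  then obtain B where B: "\<And>F c y. (F, c) \<in> I \<Longrightarrow> norm (\<Lambda> (F, c) y) \<le> B * norm y" by blast
  define K where "K = B\<^sup>2 * M"
  \<comment> \<open>\<open>max\<close> is taken because no sign is prescribed for
    \<open>M\<close>.\<close>
  have le_K: "(\<Sum>j\<in>F. (cmod (c j))\<^sup>2) \<le> max K 0" if Fc: "(F, c) \<in> I" for F c
  proof -
    have F: "finite F" "F \<subseteq> J" using Fc by (auto simp: I_def)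
    define s where "s = (\<Sum>j\<in>F. (cmod (c j))\<^sup>2)"
    define y where "y = (\<Sum>j\<in>F. cnj (c j) *\<^sub>C \<phi> j)"
    have "cinner y (g j) = cnj (c j)" if "j \<in> F" for j
    proof -
      have "cinner y (g j) = (\<Sum>i\<in>F. if i = j then cnj (c i) else 0)"
        unfolding y_def cinner_simps using F that by (intro sum.cong) (auto simp: biorth subset_iff)
      then show ?thesis using F that by simp
    qed
    then have "\<Lambda> (F, c) y = of_real s"
      by (simp add: \<Lambda>_def s_def flip: complex_norm_square)
    then have "s \<le> B * norm y" using B[OF Fc, of y] by simp
    moreover have s0: "s \<ge> 0" by (simp add: s_def sum_nonneg)
    ultimately have "s\<^sup>2 \<le> B\<^sup>2 * (norm y)\<^sup>2" by (metis power_mono power_mult_distrib)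
    also have "\<dots> \<le> B\<^sup>2 * (M * s)"
      using upper[OF F, of "\<lambda>j. cnj (c j)"] by (intro mult_left_mono) (auto simp: y_def s_def)
    finally have "s * s \<le> K * s" by (simp add: K_def power2_eq_square mult_ac)
    then show ?thesis using s0 by (cases "s = 0") (auto simp: s_def)
  qed
  show ?thesis
  \<comment> \<open>The summand 1 keeps the denominator positive and leaves room for a contradiction
    in the degenerate case \<open>Q = 0\<close>.\<close>
  proof (intro exI[of _ "1 / (max K 0 + 1)"] conjI allI impI)
    fix F assume F: "finite F" "F \<subseteq> J"
    then have fF: "\<And>j. j \<in> F \<Longrightarrow> f j \<in> L2 T" using f by blast
    show "form_ge (\<lambda>i j. L2_inner T (f i) (f j)) (1 / (max K 0 + 1)) F"
      unfolding form_ge_def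
    proof
      fix c
      define Q where "Q = L2_sq T (\<lambda>t. \<Sum>j\<in>F. c j * f j t)"
      define s where "s = (\<Sum>j\<in>F. (cmod (c j))\<^sup>2)"
      have Q_eq: "Re (sesq F (\<lambda>i j. L2_inner T (f i) (f j)) c c) = Q"
        unfolding Q_def sesq_def using fF by (simp add: L2_inner_sum_sum)
      have Q0: "Q \<ge> 0" by (simp add: Q_def L2_sq_nonneg)
      have s0: "s \<ge> 0" by (simp add: s_def sum_nonneg)
      have scaled: "r\<^sup>2 * s \<le> max K 0" if "r\<^sup>2 * Q \<le> 1" for r :: real
      proof -
        have "L2_sq T (\<lambda>t. \<Sum>j\<in>F. (of_real r * c j) * f j t) = L2_sq T (\<lambda>t. of_real r * (\<Sum>j\<in>F. c j * f j t))"
          by (simp add: sum_distrib_left mult.assoc)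
        also have "\<dots> = r\<^sup>2 * Q"
          by (simp add: Q_def L2_inner_scale_left L2_inner_scale_right power2_eq_square)
        finally have "(F, \<lambda>j. of_real r * c j) \<in> I" using F that by (simp add: I_def)
        from le_K[OF this] show ?thesis
          by (simp add: s_def norm_mult power_mult_distrib sum_distrib_left)
      qed
      have "s \<le> (max K 0 + 1) * Q"
      proof (cases "Q = 0")
        case True
        have "s = 0"
        proof (rule ccontr)
          assume "s \<noteq> 0"
          then have "s > 0" using s0 by simp
          \<comment> \<open>If \<open>Q = 0\<close>, every rescaling of \<open>c\<close> stays in
            \<open>I\<close>; this one would exceed the bound \<open>max K 0\<close>.\<close>
          then have "(sqrt ((max K 0 + 1) / s))\<^sup>2 * s = max K 0 + 1" by simp
          then show False using scaled[of "sqrt ((max K 0 + 1) / s)"] True by simp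
        qed
        then show ?thesis using True by simp
      next
        case False
        then have "Q > 0" using Q0 by simp
        then have "(1 / sqrt Q)\<^sup>2 * Q = 1" "(1 / sqrt Q)\<^sup>2 = 1 / Q" by (simp_all add: power_divide)
        then have "s / Q \<le> max K 0" using scaled[of "1 / sqrt Q"] by simp
        then have "s \<le> max K 0 * Q" using \<open>Q > 0\<close> by (simp add: field_simps)
        then show ?thesis using Q0 by (simp add: algebra_simps)
      qed
      then show "1 / (max K 0 + 1) * (\<Sum>j\<in>F. (cmod (c j))\<^sup>2) \<le> Re (sesq F (\<lambda>i j. L2_inner T (f i) (f j)) c c)"
        unfolding Q_eq s_def[symmetric] by (simp add: field_simps)
    qed
  qed (simp add: add_nonneg_pos)
qed

section \<open>The coupled system\<close>

text \<open>Makes the integral in the mild solution a genuine Bochner integral, so that bounded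
  functionals may be taken inside. On a bounded interval |u| <= 1 + |u|^2 turns square integrability
  into integrability.\<close>

lemma set_integrable_scaleC_continuous:
  fixes g :: "real \<Rightarrow> 'a::separable_complex_hilbert"
  assumes u: "u \<in> L2 T" and g: "continuous_on {0..T} g"
  shows "set_integrable lborel {0..T} (\<lambda>s. u s *\<^sub>C g s)"
proof -
  have "bounded (g ` {0..T})" by (intro compact_imp_bounded compact_continuous_image g) simp
  then obtain B where B: "\<forall>s\<in>{0..T}. norm (g s) \<le> B" by (auto simp: bounded_iff)
  show ?thesis
  proof (rule set_integrable_bound)
    show "set_integrable lborel {0..T} (\<lambda>s. \<bar>B\<bar> * (1 + (cmod (u s))\<^sup>2))"
      using L2_square_integrable[OF u]
      by (intro set_integrable_mult_right set_integral_add)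
        (simp_all add: set_integrable_def borel_integrable_compact[of "{0..T}" "\<lambda>_. 1 :: real", simplified])
    have "(\<lambda>s. (indicator {0..T} s *\<^sub>R u s) *\<^sub>C (indicator {0..T} s *\<^sub>R g s)) \<in> borel_measurable lborel"
    proof (rule borel_measurable_continuous_Pair[where H = scaleC, OF L2_measurable[OF u]])
      show "(\<lambda>s. indicator {0..T} s *\<^sub>R g s) \<in> borel_measurable lborel"
        using borel_measurable_continuous_on_indicator[OF _ g] by simp
      show "continuous_on UNIV (\<lambda>x. fst x *\<^sub>C snd x :: 'a)"
        by (intro continuous_on_scaleC continuous_intros)
    qed
    also have "(\<lambda>s. (indicator {0..T} s *\<^sub>R u s) *\<^sub>C (indicator {0..T} s *\<^sub>R g s))
        = (\<lambda>s. indicator {0..T} s *\<^sub>R (u s *\<^sub>C g s))"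
      by (auto simp: indicator_def)
    finally show "set_borel_measurable lborel {0..T} (\<lambda>s. u s *\<^sub>C g s)"
      by (simp add: set_borel_measurable_def)
    show "AE s in lborel. s \<in> {0..T} \<longrightarrow> norm (u s *\<^sub>C g s) \<le> norm (\<bar>B\<bar> * (1 + (cmod (u s))\<^sup>2))"
    proof (intro AE_I2 impI)
      fix s assume s: "s \<in> {0..T}"
      have "cmod (u s) \<le> 1 + (cmod (u s))\<^sup>2"
      proof -
        have "2 * cmod (u s) \<le> 1 + (cmod (u s))\<^sup>2"
          using sum_squares_bound[of 1 "cmod (u s)"] by simp
        then show ?thesis using norm_ge_zero[of "u s"] by linarith
      qed
      then have "norm (u s *\<^sub>C g s) \<le> (1 + (cmod (u s))\<^sup>2) * \<bar>B\<bar>"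
        unfolding norm_scaleC using bspec[OF B s] by (intro mult_mono) auto
      then show "norm (u s *\<^sub>C g s) \<le> norm (\<bar>B\<bar> * (1 + (cmod (u s))\<^sup>2))"
        by (simp add: abs_mult mult.commute)
    qed
  qed
qed

lemma set_integral_bounded_linear:
  fixes l :: "'a::{banach, second_countable_topology} \<Rightarrow> 'b::{banach, second_countable_topology}"
  assumes "bounded_linear l" "set_integrable M X f"
  shows "l (LINT s:X|M. f s) = (LINT s:X|M. l (f s))"
proof -
  interpret bounded_linear l by fact
  show ?thesis
    using integral_bounded_linear[OF assms(1), of M "\<lambda>s. indicator X s *\<^sub>R f s"] assms(2)
    by (simp add: set_lebesgue_integral_def set_integrable_def scaleR)
qed

text \<open>The functional \<open>v \<mapsto> (fst v, fst (\<Psi> j)) = (v, \<Psi> j) - (snd v, snd (\<Psi> j))\<close> turns the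
  mild solution formula into one moment equation.\<close>

lemma proj_Y_mild_solution_eq_0_iff:
  fixes S :: "real \<Rightarrow> 'y::separable_complex_hilbert \<times> 'z::separable_complex_hilbert \<Rightarrow> 'y \<times> 'z"
  assumes S: "C0_semigroup S" and T: "T \<ge> 0" and u: "u \<in> L2 T"
    and snd_S: "\<And>t x. t \<ge> 0 \<Longrightarrow> snd (S t x) = S\<^sub>Z t (snd x)"
    and eig: "\<And>j t x. j \<in> J \<Longrightarrow> t \<ge> 0 \<Longrightarrow>
      cinner (S t x) (\<Psi> j) = exp (l j * of_real t) * (cinner x (\<Psi> j) + C j * of_real t * cinner x (\<Psi>2 j))"
    and complete: "\<And>y. (\<And>j. j \<in> J \<Longrightarrow> cinner y (fst (\<Psi> j)) = 0) \<Longrightarrow> y = 0"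
    and a: "\<And>t x j. a t x j = cinner x (\<Psi> j) + C j * of_real t * cinner x (\<Psi>2 j)
      - exp (- l j * of_real t) * cinner (S\<^sub>Z t (snd x)) (snd (\<Psi> j))"
  shows "proj_Y (mild_solution S b x0 u T) = 0 \<longleftrightarrow>
    (\<forall>j\<in>J. (LINT s:{0..T}|lborel. exp (- l j * of_real s) * a (T - s) b j * u s) = - a T x0 j)"
proof -
  interpret strongly_continuous S using S by unfold_locales
  define x1 where "x1 = mild_solution S b x0 u T"
  have cont: "continuous_on {0..T} (\<lambda>s. S (T - s) b)"
    by (rule continuous_on_compose2[OF continuous_on_S]) (auto intro!: continuous_intros)
  have x1: "x1 = S T x0 + (LINT s:{0..T}|lborel. u s *\<^sub>C S (T - s) b)"
    unfolding x1_def mild_solution_def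
    by (intro arg_cong2[where f = "(+)"] refl set_lebesgue_integral_cong) (auto simp: S_scaleC)
  have "cinner (fst x1) (fst (\<Psi> j)) = exp (l j * of_real T) *
      (a T x0 j + (LINT s:{0..T}|lborel. exp (- l j * of_real s) * a (T - s) b j * u s))"
    if j: "j \<in> J" for j
  proof -
    define w where "w v = cinner (fst v) (fst (\<Psi> j))" for v :: "'y \<times> 'z"
    have w: "bounded_linear w"
      unfolding w_def by (rule bounded_linear_compose[OF bounded_linear_cinner_left bounded_linear_fst])
    have w_scale: "w (c *\<^sub>C v) = c * w v" for c v
      by (simp add: w_def scaleC_prod_def cinner_scaleC_left)
    have w_S: "w (S t x) = exp (l j * of_real t) * a t x j" if "t \<ge> 0" for t x
    proof -
      have "exp (l j * of_real t) * exp (- l j * of_real t) = 1" by (simp flip: exp_add)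
      then have "exp (l j * of_real t) * (exp (- l j * of_real t) * y) = y" for y
        by (metis mult.assoc mult_1)
      moreover have "w (S t x) = cinner (S t x) (\<Psi> j) - cinner (snd (S t x)) (snd (\<Psi> j))"
        by (simp add: w_def cinner_prod_def)
      ultimately show ?thesis
        using j that by (simp add: eig snd_S a right_diff_distrib)
    qed
    have "w x1 = w (S T x0) + (LINT s:{0..T}|lborel. w (u s *\<^sub>C S (T - s) b))"
      unfolding x1 using set_integral_bounded_linear[OF w set_integrable_scaleC_continuous[OF u cont]]
      by (simp add: linear_add[OF bounded_linear.linear[OF w]])
    also have "(LINT s:{0..T}|lborel. w (u s *\<^sub>C S (T - s) b))
        = (LINT s:{0..T}|lborel. exp (l j * of_real T) * (exp (- l j * of_real s) * a (T - s) b j * u s))"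
    proof (rule set_lebesgue_integral_cong)
      show "\<forall>s. s \<in> {0..T} \<longrightarrow> w (u s *\<^sub>C S (T - s) b)
          = exp (l j * of_real T) * (exp (- l j * of_real s) * a (T - s) b j * u s)"
      proof (intro allI impI)
        fix s assume s: "s \<in> {0..T}"
        \<comment> \<open>The factor \<open>exp (l j * of_real T)\<close> is common to the free and
          the controlled part; being nonzero, it drops out of the moment equation.\<close>
        have "exp (l j * of_real (T - s)) = exp (l j * of_real T) * exp (- l j * of_real s)"
          by (simp add: algebra_simps flip: exp_add)
        then show "w (u s *\<^sub>C S (T - s) b)
            = exp (l j * of_real T) * (exp (- l j * of_real s) * a (T - s) b j * u s)"
          using s by (simp add: w_scale w_S mult_ac)
      qed
    qed simp
    also have "w (S T x0) = exp (l j * of_real T) * a T x0 j" using T by (rule w_S)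
    finally show ?thesis by (simp add: w_def distrib_left)
  qed
  then have "cinner (fst x1) (fst (\<Psi> j)) = 0 \<longleftrightarrow>
      (LINT s:{0..T}|lborel. exp (- l j * of_real s) * a (T - s) b j * u s) = - a T x0 j"
    if "j \<in> J" for j
    using that by (simp add: eq_neg_iff_add_eq_0 add.commute)
  moreover have "proj_Y x1 = 0 \<longleftrightarrow> fst x1 = 0" by (simp add: proj_Y_def zero_prod_def)
  moreover have "fst x1 = 0 \<longleftrightarrow> (\<forall>j\<in>J. cinner (fst x1) (fst (\<Psi> j)) = 0)"
    using complete by (auto simp: cinner_simps)
  ultimately show ?thesis by (simp add: x1_def)
qed

lemma riesz_basis_upper:
  assumes "riesz_basis J f"
  obtains M where "M > 0" and "\<And>F a. finite F \<Longrightarrow> F \<subseteq> J \<Longrightarrow>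
    (norm (\<Sum>j\<in>F. a j *\<^sub>C f j))\<^sup>2 \<le> M * (\<Sum>j\<in>F. (cmod (a j))\<^sup>2)"
proof -
  from assms[unfolded riesz_basis_def, THEN conjunct2] obtain m M where "M > 0"
    and M: "\<forall>F a. finite F \<longrightarrow> F \<subseteq> J \<longrightarrow>
      m * (\<Sum>j\<in>F. (cmod (a j))\<^sup>2) \<le> (norm (\<Sum>j\<in>F. a j *\<^sub>C f j))\<^sup>2 \<and>
      (norm (\<Sum>j\<in>F. a j *\<^sub>C f j))\<^sup>2 \<le> M * (\<Sum>j\<in>F. (cmod (a j))\<^sup>2)"
    by (elim exE conjE)
  show thesis
    by (rule that[OF \<open>M > 0\<close>]) (rule M[rule_format, THEN conjunct2])
qed

lemma norm_add_square_le:
  fixes p q r :: complex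
  shows "(cmod (p + q - r))\<^sup>2 \<le> 3 * ((cmod p)\<^sup>2 + (cmod q)\<^sup>2 + (cmod r)\<^sup>2)"
proof -
  have "cmod (p + q - r) \<le> cmod p + cmod q + cmod r"
    by (meson add_mono norm_triangle_ineq norm_triangle_ineq4 order_refl order_trans)
  then have "(cmod (p + q - r))\<^sup>2 \<le> (cmod p + cmod q + cmod r)\<^sup>2" by (intro power_mono) auto
  also have "\<dots> \<le> 3 * ((cmod p)\<^sup>2 + (cmod q)\<^sup>2 + (cmod r)\<^sup>2)"
    using sum_squares_bound[of "cmod p" "cmod q"] sum_squares_bound[of "cmod p" "cmod r"]
      sum_squares_bound[of "cmod q" "cmod r"]
    by (simp add: power2_eq_square algebra_simps)
  finally show ?thesis .
qed

theorem theorem6: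
  fixes A\<^sub>Y :: "'y::separable_complex_hilbert \<Rightarrow> 'y" and D\<^sub>Y :: "'y set"
    and A\<^sub>Z :: "'z::separable_complex_hilbert \<Rightarrow> 'z" and D\<^sub>Z :: "'z set"
    and A\<^sub>Y\<^sub>Z :: "'z \<Rightarrow> 'y"
    and A :: "'y \<times> 'z \<Rightarrow> 'y \<times> 'z" and D :: "('y \<times> 'z) set"
    and S\<^sub>Y :: "real \<Rightarrow> 'y \<Rightarrow> 'y" and S\<^sub>Z :: "real \<Rightarrow> 'z \<Rightarrow> 'z"
    and S :: "real \<Rightarrow> 'y \<times> 'z \<Rightarrow> 'y \<times> 'z"
    and b :: "'y \<times> 'z" and t1 :: real
    and \<sigma>\<^sub>Y \<sigma>\<^sub>Z \<sigma>\<^sub>A :: "complex set"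
    and Idx I\<^sub>Y I\<^sub>Z I\<^sub>Y\<^sub>Z :: "nat set" and lam c b1 b2 :: "nat \<Rightarrow> complex"
    and \<phi> \<phi>1 \<phi>2 \<psi> \<psi>1 \<psi>2 :: "nat \<Rightarrow> 'y \<times> 'z"
    and bf :: "nat \<Rightarrow> real \<Rightarrow> complex"
  assumes t1: "t1 > 0"
    \<comment> \<open>operators and semigroups\<close>
    and gen_Y: "generates D\<^sub>Y A\<^sub>Y S\<^sub>Y"
    and gen_Z: "generates D\<^sub>Z A\<^sub>Z S\<^sub>Z"
    and bdd_YZ: "bounded_clinear A\<^sub>Y\<^sub>Z"
    and A_eq: "A = block_op A\<^sub>Y A\<^sub>Y\<^sub>Z A\<^sub>Z" and D_eq: "D = D\<^sub>Y \<times> D\<^sub>Z"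
    and gen_A: "generates D A S"
    \<comment> \<open>spectra\<close>
    and sigma_Y: "\<sigma>\<^sub>Y = op_spectrum D\<^sub>Y A\<^sub>Y"
    and sigma_Z: "\<sigma>\<^sub>Z = op_spectrum D\<^sub>Z A\<^sub>Z"
    and sigma_A: "\<sigma>\<^sub>A = op_spectrum D A"
    and point_spectrum: "\<forall>l\<in>\<sigma>\<^sub>A. op_eigenvalue D A l"
    and discrete: "finite \<sigma>\<^sub>A \<or> (\<forall>l. \<not> l islimpt \<sigma>\<^sub>A)"
    and finite_mult: "\<forall>l\<in>\<sigma>\<^sub>A. finite_multiplicity D A l"
    and gen_eigvec_basis: "\<exists>(J::nat set) e. riesz_basis J e \<and>
          (\<forall>j\<in>J. \<exists>l. e j \<in> gen_eigenspace D A l)"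
    and simple_Y: "\<forall>l. op_eigenvalue D\<^sub>Y A\<^sub>Y l \<longrightarrow> simple_eigenvalue D\<^sub>Y A\<^sub>Y l"
    and simple_Z: "\<forall>l. op_eigenvalue D\<^sub>Z A\<^sub>Z l \<longrightarrow> simple_eigenvalue D\<^sub>Z A\<^sub>Z l"
    and sigma_union: "\<sigma>\<^sub>A = \<sigma>\<^sub>Y \<union> \<sigma>\<^sub>Z"
    and enum: "bij_betw lam Idx \<sigma>\<^sub>A"
    and I_Y: "I\<^sub>Y = {i\<in>Idx. lam i \<in> \<sigma>\<^sub>Y}"
    and I_Z: "I\<^sub>Z = {i\<in>Idx. lam i \<in> \<sigma>\<^sub>Z}"
    and I_YZ: "I\<^sub>Y\<^sub>Z = {i\<in>Idx. lam i \<in> \<sigma>\<^sub>Y \<inter> \<sigma>\<^sub>Z}"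
    and common: "\<sigma>\<^sub>Y \<inter> \<sigma>\<^sub>Z \<noteq> {}"
    \<comment> \<open>eigenvectors for eigenvalues of the first block only\<close>
    and phi_Y: "\<forall>j\<in>I\<^sub>Y - I\<^sub>Y\<^sub>Z. snd (\<phi> j) = 0 \<and>
          fst (\<phi> j) \<in> D\<^sub>Y \<and> A\<^sub>Y (fst (\<phi> j)) = lam j *\<^sub>C fst (\<phi> j)"
    and psi_Y: "\<forall>j\<in>I\<^sub>Y - I\<^sub>Y\<^sub>Z.
          fst (\<psi> j) \<in> adjoint_domain D\<^sub>Y A\<^sub>Y \<and>
          op_adjoint D\<^sub>Y A\<^sub>Y (fst (\<psi> j)) = cnj (lam j) *\<^sub>C fst (\<psi> j) \<and>
          snd (\<psi> j) \<in> adjoint_domain D\<^sub>Z A\<^sub>Z \<and>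
          op_adjoint UNIV A\<^sub>Y\<^sub>Z (fst (\<psi> j)) + op_adjoint D\<^sub>Z A\<^sub>Z (snd (\<psi> j))
            = cnj (lam j) *\<^sub>C snd (\<psi> j)"
    \<comment> \<open>eigenvectors for eigenvalues of the second block only\<close>
    and phi_Z: "\<forall>k\<in>I\<^sub>Z - I\<^sub>Y\<^sub>Z.
          snd (\<phi> k) \<in> D\<^sub>Z \<and> A\<^sub>Z (snd (\<phi> k)) = lam k *\<^sub>C snd (\<phi> k) \<and>
          fst (\<phi> k) \<in> D\<^sub>Y \<and>
          A\<^sub>Y (fst (\<phi> k)) + A\<^sub>Y\<^sub>Z (snd (\<phi> k)) = lam k *\<^sub>C fst (\<phi> k)"
    and psi_Z: "\<forall>k\<in>I\<^sub>Z - I\<^sub>Y\<^sub>Z. fst (\<psi> k) = 0 \<and>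
          snd (\<psi> k) \<in> adjoint_domain D\<^sub>Z A\<^sub>Z \<and>
          op_adjoint D\<^sub>Z A\<^sub>Z (snd (\<psi> k)) = cnj (lam k) *\<^sub>C snd (\<psi> k)"
    \<comment> \<open>generalized eigenvectors for common eigenvalues\<close>
    and phi1: "\<forall>m\<in>I\<^sub>Y\<^sub>Z. snd (\<phi>1 m) = 0 \<and>
          fst (\<phi>1 m) \<in> D\<^sub>Y \<and> A\<^sub>Y (fst (\<phi>1 m)) = lam m *\<^sub>C fst (\<phi>1 m)"
    and phi2: "\<forall>m\<in>I\<^sub>Y\<^sub>Z. snd (\<phi>2 m) \<in> D\<^sub>Z \<and>
          A\<^sub>Z (snd (\<phi>2 m)) = lam m *\<^sub>C snd (\<phi>2 m) \<and>
          \<phi>2 m \<in> D \<and> A (\<phi>2 m) - lam m *\<^sub>C \<phi>2 m = c m *\<^sub>C \<phi>1 m"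
    and psi2: "\<forall>m\<in>I\<^sub>Y\<^sub>Z. fst (\<psi>2 m) = 0 \<and>
          snd (\<psi>2 m) \<in> adjoint_domain D\<^sub>Z A\<^sub>Z \<and>
          op_adjoint D\<^sub>Z A\<^sub>Z (snd (\<psi>2 m)) = cnj (lam m) *\<^sub>C snd (\<psi>2 m)"
    and psi1: "\<forall>m\<in>I\<^sub>Y\<^sub>Z. fst (\<psi>1 m) \<in> adjoint_domain D\<^sub>Y A\<^sub>Y \<and>
          op_adjoint D\<^sub>Y A\<^sub>Y (fst (\<psi>1 m)) = cnj (lam m) *\<^sub>C fst (\<psi>1 m) \<and>
          \<psi>1 m \<in> adjoint_domain D A \<and>
          op_adjoint D A (\<psi>1 m) - cnj (lam m) *\<^sub>C \<psi>1 m = cnj (c m) *\<^sub>C \<psi>2 m"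
    and c: "\<forall>m\<in>I\<^sub>Y\<^sub>Z. c m = cinner (A\<^sub>Y\<^sub>Z (snd (\<phi>2 m))) (fst (\<psi>1 m))"
    and riesz_phi: "riesz_basis (I\<^sub>Y <+> I\<^sub>Z) (joint_family I\<^sub>Y\<^sub>Z \<phi> \<phi>1 \<phi>2)"
    and riesz_psi: "riesz_basis (I\<^sub>Y <+> I\<^sub>Z) (joint_family I\<^sub>Y\<^sub>Z \<psi> \<psi>1 \<psi>2)"
    and biorth: "biorthogonal (I\<^sub>Y <+> I\<^sub>Z)
          (joint_family I\<^sub>Y\<^sub>Z \<phi> \<phi>1 \<phi>2) (joint_family I\<^sub>Y\<^sub>Z \<psi> \<psi>1 \<psi>2)"
    \<comment> \<open>the functions built from the control vector\<close>
    and b1_Y: "\<forall>j\<in>I\<^sub>Y - I\<^sub>Y\<^sub>Z. b1 j = cinner b (\<psi> j)"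
    and b1_YZ: "\<forall>j\<in>I\<^sub>Y\<^sub>Z. b1 j = cinner b (\<psi>1 j)"
    and b2_YZ: "\<forall>j\<in>I\<^sub>Y\<^sub>Z. b2 j = cinner b (\<psi>2 j)"
    and bf_Y: "\<forall>j\<in>I\<^sub>Y - I\<^sub>Y\<^sub>Z. \<forall>\<tau>\<in>{0..t1}. bf j \<tau> =
          b1 j - exp (- lam j * of_real (t1 - \<tau>)) *
            cinner (S\<^sub>Z (t1 - \<tau>) (snd b)) (snd (\<psi> j))"
    and bf_YZ: "\<forall>j\<in>I\<^sub>Y\<^sub>Z. \<forall>\<tau>\<in>{0..t1}. bf j \<tau> =
          b1 j + b2 j * c j * of_real (t1 - \<tau>) - exp (- lam j * of_real (t1 - \<tau>)) *
            cinner (S\<^sub>Z (t1 - \<tau>) (snd b)) (snd (\<psi>1 j))"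
    and series: "\<forall>x0. (\<lambda>j. (cmod (exp (- lam j * of_real t1)))\<^sup>2 *
          (cmod (cinner (S\<^sub>Z t1 x0) (snd (if j \<in> I\<^sub>Y\<^sub>Z then \<psi>1 j else \<psi> j))))\<^sup>2)
          summable_on I\<^sub>Y"
  shows "partially_null_controllable S b t1 \<longleftrightarrow>
    strongly_minimal_L2 t1 I\<^sub>Y (\<lambda>j t. exp (- lam j * of_real t) * bf j t)"
proof -
  interpret S: generated_semigroup S D A
    using gen_A by unfold_locales (auto simp: generates_def)
  interpret Z: generated_semigroup S\<^sub>Z D\<^sub>Z A\<^sub>Z
    using gen_Z by unfold_locales (auto simp: generates_def)
  define \<Phi> where "\<Phi> = joint_family I\<^sub>Y\<^sub>Z \<phi> \<phi>1 \<phi>2"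
  define \<Psi> where "\<Psi> = joint_family I\<^sub>Y\<^sub>Z \<psi> \<psi>1 \<psi>2"
  define \<Psi>Y where "\<Psi>Y j = (if j \<in> I\<^sub>Y\<^sub>Z then \<psi>1 j else \<psi> j)" for j
  \<comment> \<open>Setting \<open>\<Psi>2\<close> and \<open>C\<close> to zero off
    \<open>I\<^sub>Y\<^sub>Z\<close> turns plain eigenvectors into chains with trivial second
    member, so one formula covers both cases of \<open>bf\<close>.\<close>
  define \<Psi>2 where "\<Psi>2 j = (if j \<in> I\<^sub>Y\<^sub>Z then \<psi>2 j else 0)" for j
  define C where "C j = (if j \<in> I\<^sub>Y\<^sub>Z then c j else 0)" for j
  have \<Psi>_Inl: "\<Psi> (Inl j) = \<Psi>Y j" for j by (simp add: \<Psi>_def \<Psi>Y_def joint_family_def)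
  have I_YZ_sub: "I\<^sub>Y\<^sub>Z \<subseteq> I\<^sub>Y" "I\<^sub>Y\<^sub>Z \<subseteq> I\<^sub>Z" by (auto simp: I_Y I_Z I_YZ)
  have snd_\<Phi>: "snd (\<Phi> (Inl j)) = 0" if "j \<in> I\<^sub>Y" for j
    using that phi_Y phi1 by (simp add: \<Phi>_def joint_family_def)
  have fst_\<Psi>: "fst (\<Psi> (Inr k)) = 0" if "k \<in> I\<^sub>Z" for k
    using that psi_Z psi2 by (simp add: \<Psi>_def joint_family_def)
  have fst_\<Psi>2: "fst (\<Psi>2 j) = 0" for j
    using psi2 by (simp add: \<Psi>2_def)

  \<comment> \<open>Density of the domains\<close>
  have \<Phi>_D: "\<Phi> i \<in> D" if "i \<in> I\<^sub>Y <+> I\<^sub>Z" for i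
  proof (cases i)
    case (Inl j)
    then have j: "j \<in> I\<^sub>Y" using that by auto
    have "fst (\<Phi> i) \<in> D\<^sub>Y" using j Inl phi_Y phi1 by (simp add: \<Phi>_def joint_family_def)
    moreover have "snd (\<Phi> i) \<in> D\<^sub>Z" using snd_\<Phi>[OF j] Inl Z.zero_in_D by simp
    ultimately show ?thesis unfolding D_eq by (simp add: mem_Times_iff)
  next
    case (Inr k)
    then have "k \<in> I\<^sub>Z" using that by auto
    then show ?thesis
      using Inr phi_Z phi2 by (auto simp: \<Phi>_def joint_family_def D_eq mem_Times_iff)
  qed
  \<comment> \<open>\<open>D\<close> is a subspace that contains a Riesz basis, hence dense; the
    closure of a product then gives density of both factors.\<close>
  have "cspan (\<Phi> ` (I\<^sub>Y <+> I\<^sub>Z)) \<subseteq> D"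
  proof
    fix x assume "x \<in> cspan (\<Phi> ` (I\<^sub>Y <+> I\<^sub>Z))"
    then show "x \<in> D"
      by (induction rule: complex_vector.span_induct_alt)
        (auto intro!: S.zero_in_D S.subspace_D \<Phi>_D)
  qed
  moreover have "closure (cspan (\<Phi> ` (I\<^sub>Y <+> I\<^sub>Z))) = UNIV"
    using riesz_phi by (simp add: \<Phi>_def riesz_basis_def)
  ultimately have dense: "closure D = UNIV" using closure_mono by blast
  then have dense_Y: "closure D\<^sub>Y = UNIV" and dense_Z: "closure D\<^sub>Z = UNIV"
    unfolding D_eq closure_Times using times_eq_iff[of "closure D\<^sub>Y" "closure D\<^sub>Z" UNIV UNIV] by auto

  \<comment> \<open>Evolution of the second component\<close>
  have snd_S: "snd (S t x) = S\<^sub>Z t (snd x)" if t: "t \<ge> 0" for t x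
  proof -
    have D: "snd (S t x) = S\<^sub>Z t (snd x)" if x: "x \<in> D" for x
    proof -
      \<comment> \<open>The block operator is triangular, so the second component of an orbit in
        \<open>D\<close> solves the equation of \<open>A\<^sub>Z\<close> alone.\<close>
      have "snd (S t x) = S\<^sub>Z t (snd (S 0 x))"
      proof (rule Z.solution_unique[OF t])
        fix s assume s: "s \<in> {0..t}"
        then have sD: "S s x \<in> D" "A (S s x) = S s (A x)" using S.S_in_D[OF x] by auto
        show "snd (S s x) \<in> D\<^sub>Z" using sD(1) by (auto simp: D_eq mem_Times_iff)
        have "((\<lambda>s. snd (S s x)) has_vector_derivative snd (S s (A x))) (at s within {0..t})"
          using s by (intro bounded_linear.has_vector_derivative[OF bounded_linear_snd]
              has_vector_derivative_within_subset[OF S.has_vector_derivative_S[OF x]]) auto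
        moreover have "snd (S s (A x)) = A\<^sub>Z (snd (S s x))"
          unfolding sD(2)[symmetric] by (simp add: A_eq block_op_def case_prod_beta)
        ultimately show "((\<lambda>s. snd (S s x)) has_vector_derivative A\<^sub>Z (snd (S s x))) (at s within {0..t})"
          by simp
      qed
      then show ?thesis by simp
    qed
    have "closed {x. snd (S t x) = S\<^sub>Z t (snd x)}"
      by (intro closed_Collect_eq continuous_on_snd linear_continuous_on S.bounded_linear_S t
          linear_continuous_on[OF bounded_linear_compose[OF Z.bounded_linear_S[OF t] bounded_linear_snd]])
    then have "closure D \<subseteq> {x. snd (S t x) = S\<^sub>Z t (snd x)}"
      by (rule closure_minimal[rotated]) (use D in auto)
    then show ?thesis using dense by auto
  qed

  \<comment> \<open>Dual eigenvectors along the semigroup\<close>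
  have A_fst: "fst (A x) = A\<^sub>Y (fst x) + A\<^sub>Y\<^sub>Z (snd x)" and A_snd: "snd (A x) = A\<^sub>Z (snd x)" for x
    by (simp_all add: A_eq block_op_def case_prod_beta)
  have in_D: "fst x \<in> D\<^sub>Y" "snd x \<in> D\<^sub>Z" if "x \<in> D" for x
    using that by (auto simp: D_eq)
  have eig: "cinner (S t x) (\<Psi>Y j)
      = exp (lam j * of_real t) * (cinner x (\<Psi>Y j) + C j * of_real t * cinner x (\<Psi>2 j))"
    if j: "j \<in> I\<^sub>Y" and t: "t \<ge> 0" for j t x
  proof (rule S.cinner_S_adjoint_eigenvector[OF dense _ _ t])
    fix x assume x: "x \<in> D"
    show "cinner (A x) (\<Psi>2 j) = lam j * cinner x (\<Psi>2 j)"
    proof (cases "j \<in> I\<^sub>Y\<^sub>Z")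
      case True
      then have "cinner (A\<^sub>Z (snd x)) (snd (\<psi>2 j)) = cinner (snd x) (cnj (lam j) *\<^sub>C snd (\<psi>2 j))"
        using psi2 op_adjoint_eq[OF dense_Z, of "snd (\<psi>2 j)" A\<^sub>Z "snd x"] in_D[OF x] by simp
      then show ?thesis
        using True psi2 by (simp add: \<Psi>2_def cinner_prod_def A_snd cinner_simps)
    qed (simp add: \<Psi>2_def cinner_simps)
    show "cinner (A x) (\<Psi>Y j) = lam j * cinner x (\<Psi>Y j) + C j * cinner x (\<Psi>2 j)"
    proof (cases "j \<in> I\<^sub>Y\<^sub>Z")
      case True
      \<comment> \<open>At a common eigenvalue the adjoint equation is given for the full operator;
        in the other case it is assembled from its two components.\<close>
      have "cinner (A x) (\<psi>1 j) = cinner x (op_adjoint D A (\<psi>1 j))"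
        using True psi1 x by (intro op_adjoint_eq dense) auto
      also have "op_adjoint D A (\<psi>1 j) = cnj (lam j) *\<^sub>C \<psi>1 j + cnj (c j) *\<^sub>C \<psi>2 j"
        using True psi1 by (metis add.commute diff_add_cancel)
      finally show ?thesis using True by (simp add: \<Psi>Y_def \<Psi>2_def C_def cinner_simps)
    next
      case False
      define v where "v = fst (\<psi> j)"
      define w where "w = snd (\<psi> j)"
      have v: "v \<in> adjoint_domain D\<^sub>Y A\<^sub>Y" "op_adjoint D\<^sub>Y A\<^sub>Y v = cnj (lam j) *\<^sub>C v"
        "w \<in> adjoint_domain D\<^sub>Z A\<^sub>Z"
        "op_adjoint UNIV A\<^sub>Y\<^sub>Z v + op_adjoint D\<^sub>Z A\<^sub>Z w = cnj (lam j) *\<^sub>C w"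
        using psi_Y j False by (auto simp: v_def w_def)
      have "cinner (A x) (\<psi> j) = cinner (A\<^sub>Y (fst x)) v
          + (cinner (A\<^sub>Y\<^sub>Z (snd x)) v + cinner (A\<^sub>Z (snd x)) w)"
        by (simp add: cinner_prod_def A_fst A_snd cinner_add_left v_def w_def)
      also have "cinner (A\<^sub>Y (fst x)) v = cinner (fst x) (cnj (lam j) *\<^sub>C v)"
        using op_adjoint_eq[OF dense_Y v(1)] in_D[OF x] v(2) by simp
      also have "cinner (A\<^sub>Y\<^sub>Z (snd x)) v + cinner (A\<^sub>Z (snd x)) w
          = cinner (snd x) (op_adjoint UNIV A\<^sub>Y\<^sub>Z v + op_adjoint D\<^sub>Z A\<^sub>Z w)"
        using op_adjoint_eq[OF dense_Z v(3)] in_D[OF x]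
          op_adjoint_eq[OF closure_UNIV adjoint_domain_bounded[OF bdd_YZ], of "snd x" v]
        by (simp add: cinner_add_right)
      finally show ?thesis
        using False by (simp add: v(4)[unfolded v_def w_def] \<Psi>Y_def C_def cinner_prod_def cinner_scaleC_right distrib_left v_def w_def)
    qed
  qed

  \<comment> \<open>Completeness of the first components\<close>
  have complete: "y = 0" if y: "\<And>j. j \<in> I\<^sub>Y \<Longrightarrow> cinner y (fst (\<Psi>Y j)) = 0" for y
  proof -
    have "closure (cspan (\<Psi> ` (I\<^sub>Y <+> I\<^sub>Z))) = UNIV"
      using riesz_psi by (simp add: \<Psi>_def riesz_basis_def)
    \<comment> \<open>\<open>(y, 0)\<close> is orthogonal to the \<open>Inl\<close> members of the
      dual basis by assumption on \<open>y\<close>, and to the \<open>Inr\<close> members because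
      their first component is 0.\<close>
    then have "(y, 0) = (0 :: 'y \<times> 'z)"
    proof (rule orthogonal_to_dense)
      fix v assume v: "v \<in> cspan (\<Psi> ` (I\<^sub>Y <+> I\<^sub>Z))"
      show "cinner (y, 0) v = 0"
      proof (rule orthogonal_to_cspan[OF _ v])
        fix v assume "v \<in> \<Psi> ` (I\<^sub>Y <+> I\<^sub>Z)"
        then show "cinner (y, 0) v = 0"
          using y fst_\<Psi> by (auto simp: cinner_prod_def cinner_simps \<Psi>_Inl)
      qed
    qed
    then show ?thesis by (simp add: zero_prod_def)
  qed

  \<comment> \<open>Reduction to a moment problem\<close>
  define a where "a t x j = cinner x (\<Psi>Y j) + C j * of_real t * cinner x (\<Psi>2 j)
      - exp (- lam j * of_real t) * cinner (S\<^sub>Z t (snd x)) (snd (\<Psi>Y j))" for t x j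
  define f where "f j t = exp (- lam j * of_real t) * bf j t" for j t
  \<comment> \<open>The same expression \<open>a\<close> serves twice: with \<open>b\<close> and the
    remaining time it gives \<open>bf\<close>, with \<open>x0\<close> and \<open>t1\<close> the
    prescribed moments.\<close>
  have f_eq: "f j t = exp (- lam j * of_real t) * a (t1 - t) b j" if "j \<in> I\<^sub>Y" "t \<in> {0..t1}" for j t
    using that bf_Y bf_YZ b1_Y b1_YZ b2_YZ
    by (auto simp: f_def a_def \<Psi>Y_def \<Psi>2_def C_def)
  have f_L2: "f j \<in> L2 t1" if j: "j \<in> I\<^sub>Y" for j
  proof -
    have "continuous_on {0..t1} (\<lambda>t. S\<^sub>Z (t1 - t) (snd b))"
      by (rule continuous_on_compose2[OF Z.continuous_on_S]) (auto intro!: continuous_intros)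
    then have "continuous_on {0..t1} (\<lambda>t. exp (- lam j * of_real t) * a (t1 - t) b j)"
      unfolding a_def by (intro continuous_intros continuous_on_cinner)
    then show ?thesis using L2_continuous L2_cong[of t1 "f j", OF f_eq[OF j]] by blast
  qed
  \<comment> \<open>\<open>L2_inner\<close> conjugates its second argument and the moment integral
    does not, hence the conjugate of \<open>u\<close>.\<close>
  have moments: "proj_Y (mild_solution S b x0 u t1) = 0 \<longleftrightarrow>
      (\<forall>j\<in>I\<^sub>Y. L2_inner t1 (f j) (\<lambda>t. cnj (u t)) = - a t1 x0 j)" if u: "u \<in> L2 t1" for x0 u
  proof -
    have "L2_inner t1 (f j) (\<lambda>t. cnj (u t))
        = (LINT s:{0..t1}|lborel. exp (- lam j * of_real s) * a (t1 - s) b j * u s)" if "j \<in> I\<^sub>Y" for j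
      unfolding L2_inner_def by (rule set_lebesgue_integral_cong) (simp_all add: f_eq[OF that])
    then show ?thesis
      using proj_Y_mild_solution_eq_0_iff[where a = a, OF S.C0 _ u snd_S eig complete a_def] t1
      by simp
  qed
  have control: "partially_null_controllable S b t1 \<longleftrightarrow>
      (\<forall>x0. \<exists>v\<in>L2 t1. \<forall>j\<in>I\<^sub>Y. L2_inner t1 (f j) v = - a t1 x0 j)"
    unfolding partially_null_controllable_def
  proof (intro all_cong1 iffI)
    fix x0
    assume "\<exists>u\<in>L2 t1. proj_Y (mild_solution S b x0 u t1) = 0"
    then obtain u where u: "u \<in> L2 t1" "proj_Y (mild_solution S b x0 u t1) = 0" by blast
    then show "\<exists>v\<in>L2 t1. \<forall>j\<in>I\<^sub>Y. L2_inner t1 (f j) v = - a t1 x0 j"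
      using moments[OF u(1)] L2_cnj[OF u(1)] by blast
  next
    fix x0
    assume "\<exists>v\<in>L2 t1. \<forall>j\<in>I\<^sub>Y. L2_inner t1 (f j) v = - a t1 x0 j"
    then obtain v where v: "v \<in> L2 t1" "\<forall>j\<in>I\<^sub>Y. L2_inner t1 (f j) v = - a t1 x0 j" by blast
    then show "\<exists>u\<in>L2 t1. proj_Y (mild_solution S b x0 u t1) = 0"
      using moments[OF L2_cnj[OF v(1)], of x0] L2_cnj[OF v(1)] by auto
  qed

  have nonempty: "I\<^sub>Y \<noteq> {}"
    using common enum I_Y sigma_union by (auto simp: bij_betw_def) (metis imageE UnI1)
  have minimal: "strongly_minimal_L2 t1 I\<^sub>Y f \<longleftrightarrow>
      (\<exists>L>0. \<forall>F. finite F \<longrightarrow> F \<subseteq> I\<^sub>Y \<longrightarrow> form_ge (\<lambda>i j. L2_inner t1 (f i) (f j)) L F)"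
    unfolding strongly_minimal_L2_def
    using f_L2 strongly_minimal_iff[of "L2_inner t1" "I\<^sub>Y" f, OF L2_inner_commute nonempty] by blast

  obtain M\<^sub>\<Phi> where M\<^sub>\<Phi>: "M\<^sub>\<Phi> > 0" "\<And>F a. finite F \<Longrightarrow> F \<subseteq> I\<^sub>Y <+> I\<^sub>Z \<Longrightarrow>
      (norm (\<Sum>j\<in>F. a j *\<^sub>C \<Phi> j))\<^sup>2 \<le> M\<^sub>\<Phi> * (\<Sum>j\<in>F. (cmod (a j))\<^sup>2)"
    by (rule riesz_basis_upper[OF riesz_phi, folded \<Phi>_def]) (rule that)
  obtain M\<^sub>\<Psi> where M\<^sub>\<Psi>: "M\<^sub>\<Psi> > 0" "\<And>F a. finite F \<Longrightarrow> F \<subseteq> I\<^sub>Y <+> I\<^sub>Z \<Longrightarrow>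
      (norm (\<Sum>j\<in>F. a j *\<^sub>C \<Psi> j))\<^sup>2 \<le> M\<^sub>\<Psi> * (\<Sum>j\<in>F. (cmod (a j))\<^sup>2)"
    by (rule riesz_basis_upper[OF riesz_psi, folded \<Psi>_def]) (rule that)
  have Bessel: "(\<Sum>i\<in>F. (cmod (cinner x (\<Psi> i)))\<^sup>2) \<le> M\<^sub>\<Psi> * (norm x)\<^sup>2"
    if "finite F" "F \<subseteq> I\<^sub>Y <+> I\<^sub>Z" for F x
    using M\<^sub>\<Psi>(1) M\<^sub>\<Psi>(2)[OF that] by (intro Bessel_inequality) auto

  have sub_Inl: "Inl ` F \<subseteq> I\<^sub>Y <+> I\<^sub>Z" if "F \<subseteq> I\<^sub>Y" for F
    using that by (auto simp: Plus_def)
  have sub_Inr: "Inr ` F \<subseteq> I\<^sub>Y <+> I\<^sub>Z" if "F \<subseteq> I\<^sub>Z" for F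
    using that by (auto simp: Plus_def)
  have norm_fst: "norm (fst z) \<le> norm z" and norm_snd: "norm (snd z) \<le> norm z" for z :: "'y \<times> 'z"
    using norm_fst_le[of "fst z" "snd z"] norm_snd_le[of "snd z" "fst z"] by simp_all

  \<comment> \<open>The two implications\<close>
  show ?thesis
  proof
    assume ctrl: "partially_null_controllable S b t1"
    have "\<exists>L>0. \<forall>F. finite F \<longrightarrow> F \<subseteq> I\<^sub>Y \<longrightarrow> form_ge (\<lambda>i j. L2_inner t1 (f i) (f j)) L F"
    proof (rule moment_solvable_imp_form_ge[where g = "\<lambda>j. fst (\<Psi>Y j)" and \<phi> = "\<lambda>j. fst (\<Phi> (Inl j))"])
      show "f j \<in> L2 t1" if "j \<in> I\<^sub>Y" for j using that by (rule f_L2)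
      show "\<exists>u\<in>L2 t1. \<forall>j\<in>I\<^sub>Y. L2_inner t1 (f j) u = cinner y (fst (\<Psi>Y j))" for y
      proof -
        \<comment> \<open>With zero second component every term of \<open>a\<close> but the first
          pairing vanishes; the sign in the state offsets the one in the moment equation.\<close>
        have "- a t1 (- y, 0) j = cinner y (fst (\<Psi>Y j))" for j
          using cinner_scaleC_left[of "-1" y "fst (\<Psi>Y j)"] scaleC_of_real[of "-1" y]
            linear_0[OF bounded_linear.linear[OF Z.bounded_linear_S[of t1]]] t1
          by (simp add: a_def cinner_prod_def fst_\<Psi>2 cinner_simps)
        then show ?thesis using ctrl[unfolded control, rule_format, of "(- y, 0)"] by simp
      qed
      show "cinner (fst (\<Phi> (Inl i))) (fst (\<Psi>Y j)) = (if i = j then 1 else 0)" if "i \<in> I\<^sub>Y" "j \<in> I\<^sub>Y" for i j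
      proof -
        have "cinner (\<Phi> (Inl i)) (\<Psi> (Inl j)) = (if i = j then 1 else 0)"
          using biorth[folded \<Phi>_def \<Psi>_def, unfolded biorthogonal_def, rule_format,
              OF InlI[OF that(1)] InlI[OF that(2)]] by simp
        then show ?thesis using snd_\<Phi>[OF that(1)] by (simp add: cinner_prod_def cinner_simps \<Psi>_Inl)
      qed
      show "(norm (\<Sum>j\<in>F. a j *\<^sub>C fst (\<Phi> (Inl j))))\<^sup>2 \<le> M\<^sub>\<Phi> * (\<Sum>j\<in>F. (cmod (a j))\<^sup>2)"
        if F: "finite F" "F \<subseteq> I\<^sub>Y" for F and a :: "nat \<Rightarrow> complex"
      proof -
        have "(\<Sum>j\<in>F. a j *\<^sub>C fst (\<Phi> (Inl j))) = fst (\<Sum>j\<in>F. a j *\<^sub>C \<Phi> (Inl j))"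
          by (simp add: fst_sum scaleC_prod_def)
        also have "(\<Sum>j\<in>F. a j *\<^sub>C \<Phi> (Inl j)) = (\<Sum>i\<in>Inl ` F. a (projl i) *\<^sub>C \<Phi> i)"
          by (simp add: sum.reindex)
        finally have "(norm (\<Sum>j\<in>F. a j *\<^sub>C fst (\<Phi> (Inl j))))\<^sup>2
            \<le> (norm (\<Sum>i\<in>Inl ` F. a (projl i) *\<^sub>C \<Phi> i))\<^sup>2"
          by (simp add: norm_fst power_mono)
        also have "\<dots> \<le> M\<^sub>\<Phi> * (\<Sum>i\<in>(Inl ` F :: (nat + nat) set). (cmod (a (projl i)))\<^sup>2)"
          using M\<^sub>\<Phi>(2)[of "Inl ` F" "\<lambda>i. a (projl i)"] F sub_Inl by auto
        finally show ?thesis by (simp add: sum.reindex)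
      qed
    qed
    then show "strongly_minimal_L2 t1 I\<^sub>Y (\<lambda>j t. exp (- lam j * of_real t) * bf j t)"
      using minimal by (simp add: f_def[abs_def])
  next
    assume "strongly_minimal_L2 t1 I\<^sub>Y (\<lambda>j t. exp (- lam j * of_real t) * bf j t)"
    then obtain L where L: "L > 0"
      "\<And>F. finite F \<Longrightarrow> F \<subseteq> I\<^sub>Y \<Longrightarrow> form_ge (\<lambda>i j. L2_inner t1 (f i) (f j)) L F"
      using minimal unfolding f_def[abs_def] by blast
    \<comment> \<open>By its formula \<open>c\<close> pairs the image of one basis vector under the
      bounded coupling with a dual vector, and an upper Riesz bound on singletons bounds the norm of
      each basis vector.\<close>
    obtain B where B: "\<And>j. cmod (C j) \<le> B"
    proof -
      have "bounded_linear A\<^sub>Y\<^sub>Z" using bdd_YZ by (simp add: bounded_clinear_def)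
      then obtain K where K: "K > 0" "\<forall>z. norm (A\<^sub>Y\<^sub>Z z) \<le> norm z * K"
        using bounded_linear.pos_bounded by blast
      have "cmod (C j) \<le> sqrt M\<^sub>\<Phi> * K * sqrt M\<^sub>\<Psi>" for j
      proof (cases "j \<in> I\<^sub>Y\<^sub>Z")
        case True
        then have j: "j \<in> I\<^sub>Y" "j \<in> I\<^sub>Z" using I_YZ_sub by auto
        have "(norm (\<phi>2 j))\<^sup>2 \<le> M\<^sub>\<Phi>"
          using M\<^sub>\<Phi>(2)[of "{Inr j}" "\<lambda>_. 1"] j True by (simp add: \<Phi>_def joint_family_def norm_scaleC InrI)
        then have 1: "norm (\<phi>2 j) \<le> sqrt M\<^sub>\<Phi>" by (rule real_le_rsqrt)
        have "(norm (\<psi>1 j))\<^sup>2 \<le> M\<^sub>\<Psi>"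
          using M\<^sub>\<Psi>(2)[of "{Inl j}" "\<lambda>_. 1"] j True by (simp add: \<Psi>_def joint_family_def norm_scaleC InlI)
        then have 2: "norm (\<psi>1 j) \<le> sqrt M\<^sub>\<Psi>" by (rule real_le_rsqrt)
        have "cmod (c j) \<le> norm (A\<^sub>Y\<^sub>Z (snd (\<phi>2 j))) * norm (fst (\<psi>1 j))"
          using c True cmod_cinner_le by simp
        also have "\<dots> \<le> (norm (snd (\<phi>2 j)) * K) * norm (fst (\<psi>1 j))"
          using K(2) by (intro mult_right_mono) auto
        also have "\<dots> \<le> (sqrt M\<^sub>\<Phi> * K) * sqrt M\<^sub>\<Psi>"
          using K(1) M\<^sub>\<Phi>(1) M\<^sub>\<Psi>(1) order_trans[OF norm_snd 1] order_trans[OF norm_fst 2]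
          by (intro mult_mono) auto
        finally show ?thesis using True by (simp add: C_def)
      next
        case False
        then show ?thesis using K(1) M\<^sub>\<Phi>(1) M\<^sub>\<Psi>(1) by (simp add: C_def)
      qed
      then show thesis by (rule that)
    qed
    show "partially_null_controllable S b t1"
      unfolding control
    proof
      fix x0 :: "'y \<times> 'z"
      define e where "e j = (cmod (exp (- lam j * of_real t1)))\<^sup>2 *
          (cmod (cinner (S\<^sub>Z t1 (snd x0)) (snd (if j \<in> I\<^sub>Y\<^sub>Z then \<psi>1 j else \<psi> j))))\<^sup>2" for j
      \<comment> \<open>One summand for each part of \<open>a\<close>: Bessel for
        \<open>\<Psi>Y\<close>, Bessel for \<open>\<Psi>2\<close> scaled by the bounds on
        \<open>C\<close> and time, and the assumed series. The 3 comes from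
        \<open>norm_add_square_le\<close>.\<close>
      define K where "K = 3 * (M\<^sub>\<Psi> * (norm x0)\<^sup>2 + (B * t1)\<^sup>2 * (M\<^sub>\<Psi> * (norm x0)\<^sup>2) + infsum e I\<^sub>Y)"
      show "\<exists>v\<in>L2 t1. \<forall>j\<in>I\<^sub>Y. L2_inner t1 (f j) v = - a t1 x0 j"
      proof (rule L2_moment_problem[OF f_L2 L(1)])
        show "L * (\<Sum>j\<in>F. (cmod (d j))\<^sup>2) \<le> L2_sq t1 (\<lambda>t. \<Sum>j\<in>F. d j * f j t)"
          if F: "finite F" "F \<subseteq> I\<^sub>Y" for F d
          using L(2)[OF F] f_L2 F(2)
          by (subst L2_inner_sum_sum) (auto simp: form_ge_def sesq_def)
        show "(\<Sum>j\<in>F. (cmod (- a t1 x0 j))\<^sup>2) \<le> K" if F: "finite F" "F \<subseteq> I\<^sub>Y" for F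
        proof -
          have "(\<Sum>j\<in>F. (cmod (- a t1 x0 j))\<^sup>2) \<le> (\<Sum>j\<in>F. 3 * ((cmod (cinner x0 (\<Psi>Y j)))\<^sup>2
              + (cmod (C j * of_real t1 * cinner x0 (\<Psi>2 j)))\<^sup>2 + e j))"
          proof (rule sum_mono)
            fix j assume "j \<in> F"
            show "(cmod (- a t1 x0 j))\<^sup>2 \<le> 3 * ((cmod (cinner x0 (\<Psi>Y j)))\<^sup>2
                + (cmod (C j * of_real t1 * cinner x0 (\<Psi>2 j)))\<^sup>2 + e j)"
              unfolding norm_minus_cancel a_def
              using norm_add_square_le[of "cinner x0 (\<Psi>Y j)" "C j * of_real t1 * cinner x0 (\<Psi>2 j)"
                  "exp (- lam j * of_real t1) * cinner (S\<^sub>Z t1 (snd x0)) (snd (\<Psi>Y j))"]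
              by (simp add: e_def \<Psi>Y_def norm_mult power_mult_distrib)
          qed
          also have "\<dots> = 3 * ((\<Sum>j\<in>F. (cmod (cinner x0 (\<Psi>Y j)))\<^sup>2)
              + (\<Sum>j\<in>F. (cmod (C j * of_real t1 * cinner x0 (\<Psi>2 j)))\<^sup>2) + (\<Sum>j\<in>F. e j))"
            by (simp add: sum_distrib_left sum.distrib)
          also have "\<dots> \<le> K"
            unfolding K_def
          proof (intro mult_left_mono add_mono)
            have "(\<Sum>j\<in>F. (cmod (cinner x0 (\<Psi>Y j)))\<^sup>2) = (\<Sum>i\<in>Inl ` F. (cmod (cinner x0 (\<Psi> i)))\<^sup>2)"
              by (simp add: sum.reindex \<Psi>_Inl)
            also have "\<dots> \<le> M\<^sub>\<Psi> * (norm x0)\<^sup>2" using F by (intro Bessel sub_Inl) auto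
            finally show "(\<Sum>j\<in>F. (cmod (cinner x0 (\<Psi>Y j)))\<^sup>2) \<le> M\<^sub>\<Psi> * (norm x0)\<^sup>2" .
            have "(\<Sum>j\<in>F. (cmod (C j * of_real t1 * cinner x0 (\<Psi>2 j)))\<^sup>2)
                \<le> (\<Sum>j\<in>F. (B * t1)\<^sup>2 * (cmod (cinner x0 (\<Psi>2 j)))\<^sup>2)"
            proof (rule sum_mono)
              fix j
              have "cmod (C j) * \<bar>t1\<bar> \<le> B * t1" using B t1 by simp
              then have "(cmod (C j) * \<bar>t1\<bar>)\<^sup>2 \<le> (B * t1)\<^sup>2" by (intro power_mono) auto
              then show "(cmod (C j * of_real t1 * cinner x0 (\<Psi>2 j)))\<^sup>2
                  \<le> (B * t1)\<^sup>2 * (cmod (cinner x0 (\<Psi>2 j)))\<^sup>2"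
                unfolding norm_mult norm_of_real power_mult_distrib[of _ "cmod (cinner x0 (\<Psi>2 j))"]
                by (intro mult_right_mono) auto
            qed
            also have "\<dots> = (B * t1)\<^sup>2 * (\<Sum>j\<in>F. (cmod (cinner x0 (\<Psi>2 j)))\<^sup>2)"
              by (simp add: sum_distrib_left)
            \<comment> \<open>Where \<open>\<Psi>2\<close> is not set to zero it is the
              \<open>Inr\<close> member of the dual basis, so the Bessel bound applies to it
              too.\<close>
            also have "(\<Sum>j\<in>F. (cmod (cinner x0 (\<Psi>2 j)))\<^sup>2)
                = (\<Sum>j\<in>F \<inter> I\<^sub>Y\<^sub>Z. (cmod (cinner x0 (\<Psi> (Inr j))))\<^sup>2)"
              using F(1) by (intro sum.mono_neutral_cong_right)
                (auto simp: \<Psi>2_def \<Psi>_def joint_family_def cinner_simps)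
            also have "\<dots> = (\<Sum>i\<in>Inr ` (F \<inter> I\<^sub>Y\<^sub>Z). (cmod (cinner x0 (\<Psi> i)))\<^sup>2)"
              by (simp add: sum.reindex)
            also have "(B * t1)\<^sup>2 * \<dots> \<le> (B * t1)\<^sup>2 * (M\<^sub>\<Psi> * (norm x0)\<^sup>2)"
              using F I_YZ_sub by (intro mult_left_mono Bessel sub_Inr) auto
            finally show "(\<Sum>j\<in>F. (cmod (C j * of_real t1 * cinner x0 (\<Psi>2 j)))\<^sup>2)
                \<le> (B * t1)\<^sup>2 * (M\<^sub>\<Psi> * (norm x0)\<^sup>2)" .
            show "sum e F \<le> infsum e I\<^sub>Y"
              using series F unfolding e_def[abs_def] by (intro finite_sum_le_infsum) auto
          qed simp
          finally show ?thesis .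
        qed
      qed
    qed
  qed
qed

end
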